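(* Assume that $B=\sum_{k=1}^\infty b_k\langle\cdot,e_k\rangle e_k$ where, for some $N\in\mathbb{N}$, $b_k>0$ for all $k\in\{1,\dots,N\}$, and $\frac12(N+1)^2-\lambda>0$. Then for any $c\in(-1,1)$ the limit semigroup $(P^c_t)_{t\ge0}$ on $\mathrm{H}_c$ is weakly topologically irreducible.
   Context: Setting. $\langle\cdot,\cdot\rangle$ is the scalar product of $L^2(0,1)$. $A$ is the Laplace operator on $L^2(0,1)$ with Neumann boundary conditions, $D(A)=\{h\in W^{2,2}(0,1): h'(0)=h'(1)=0\}$, with complete orthonormal system of eigenvectors $(e_i)_{i\ge 0}$, $e_0=1$, $e_i(\theta)=\sqrt2\cos(i\pi\theta)$, and eigenvalues $\lambda_i=-(i\pi)^2$. For $\gamma\in\mathbb{R}$, $V_\gamma=D((-A)^{\gamma/2})$ (defined by interpolation/completion), and for $h=\sum_i h_ie_i$ set $\bar h=h_0$ (the average of $h$), $|h|_\gamma=\big(\sum_{i\ge1}(-\lambda_i)^\gamma h_i^2\big)^{1/2}$, $\|h\|_\gamma=(|h|_\gamma^2+\bar h^2)^{1/2}$. Put $\mathrm{H}=V_{-1}$ and, for $c\in\mathbb{R}$, $\mathrm{H}_c=\{h\in \mathrm{H}:\bar h=c\}$ with metric $|x-y|_{-1}$. $\mathcal{B}_b(\mathrm{H}_c)$ is the space of bounded Borel functions $\mathrm{H}_c\to\mathbb{R}$. Noise. $W$ is a cylindrical Wiener process on $L^2(0,1)$; $B$ is a covariance operator (nonnegative, self-adjoint; so $b_k\ge0$ for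 all $k$) on $L^2(0,1)$ with $\sqrt B e_0=0$ and $\mathrm{Tr}_{-1}<+\infty$, where $\mathrm{Tr}_\gamma=\mathrm{Tr}[\sqrt B(-A)^\gamma\sqrt B^{*}]$. Approximated equation. Fix $\lambda\in\mathbb{R}$ and for $n\in\mathbb{N}$ let $f_n(u)=-2\sum_{k=0}^n\frac{u^{2k+1}}{2k+1}+\lambda u$. For $x\in \mathrm{H}$, $X^n=X^n(\cdot,x)$ is the unique solution, a.s. in $C([0,T];\mathrm{H})\cap L^{2n+2}((0,T)\times(0,1))$ for every $T>0$, of $$dX^n+\tfrac12\big(A^2X^n+Af_n(X^n)\big)dt=\sqrt B\,dW,\qquad X^n(0)=x.$$ The average of $X^n(t)$ does not depend on $t$. For $c\in\mathbb{R}$ set $P^{n,c}_t\varphi(x)=\mathbb{E}[\varphi(X^n(t,x))]$, $x\in \mathrm{H}_c$, $\varphi\in\mathcal{B}_b(\mathrm{H}_c)$. Limit semigroup. For $c\in(-1,1)$, $(P^c_t)_{t\ge0}$ denotes a transition semigroup on $\mathcal{B}_b(\mathrm{H}_c)$ obtained as limit along a subsequence $(n_k)$: $P^{n_k,c}_t\varphi(x)\to P^c_t\varphi(x)$ as $k\to\infty$ for all $\varphi\in\mathcal{B}_b(\mathrm{H}_c)$, $x\in \mathrm{H}_c$, $t\ge0$ (its existence is established in the paper). Write $P^c_t(x,\Gamma)=P^c_t\mathbf{1}_\Gamma(x)$ for Borel $\Gamma$. Definition. A semigroup $P_t$ on a space $E$ (here $E=\mathrm{H}_c$) is weakly topologically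 irreducible if for all $x_1,x_2\in E$ there exists $y\in E$ such that for any open set $\mathcal{O}$ containing $y$ there exist $t_1,t_2>0$ with $P_{t_i}(x_i,\mathcal{O})>0$ for $i=1,2$. *)

theory Defs
  imports "HOL-Probability.Probability"
begin

section \<open>The Neumann Laplacian in its eigenbasis\<close>

definition eigfun :: "nat \<Rightarrow> real \<Rightarrow> real" where
  "eigfun i \<theta> = (if i = 0 then 1 else sqrt 2 * cos (real i * pi * \<theta>))"

definition eigval :: "nat \<Rightarrow> real" where
  "eigval i = - ((real i * pi)\<^sup>2)"

text \<open>Elements of the spaces \<open>V\<^sub>\<gamma>\<close> (which for negative \<open>\<gamma>\<close> are not functions) are given by
  their sequence of coefficients with respect to the \<open>eigfun i\<close>.\<close>

definition coeffs :: "(real \<Rightarrow> real) \<Rightarrow> nat \<Rightarrow> real" where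
  "coeffs g i = (LINT \<theta>:{0<..<1}|lborel. g \<theta> * eigfun i \<theta>)"

text \<open>The operator with eigenvectors \<open>eigfun i\<close> and eigenvalues \<open>m i\<close>.\<close>

definition diag_op :: "(nat \<Rightarrow> real) \<Rightarrow> (nat \<Rightarrow> real) \<Rightarrow> nat \<Rightarrow> real" where
  "diag_op m h = (\<lambda>i. m i * h i)"

definition laplace :: "(nat \<Rightarrow> real) \<Rightarrow> nat \<Rightarrow> real" where
  "laplace = diag_op eigval"

text \<open>As \<open>0 powr \<gamma> = 0\<close>, the power below maps \<open>e\<^sub>0\<close> to \<open>0\<close>; it is only applied to sequences
  whose zeroth coefficient vanishes.\<close>

definition neg_laplace_power :: "real \<Rightarrow> (nat \<Rightarrow> real) \<Rightarrow> nat \<Rightarrow> real" where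
  "neg_laplace_power \<gamma> = diag_op (\<lambda>i. (- eigval i) powr \<gamma>)"

definition V :: "real \<Rightarrow> (nat \<Rightarrow> real) set" where
  "V \<gamma> = {h. summable (\<lambda>i. (- eigval (Suc i)) powr \<gamma> * (h (Suc i))\<^sup>2)}"

definition V_seminorm :: "real \<Rightarrow> (nat \<Rightarrow> real) \<Rightarrow> real" where
  "V_seminorm \<gamma> h = sqrt (\<Sum>i. (- eigval (Suc i)) powr \<gamma> * (h (Suc i))\<^sup>2)"

definition V_norm :: "real \<Rightarrow> (nat \<Rightarrow> real) \<Rightarrow> real" where
  "V_norm \<gamma> h = sqrt ((V_seminorm \<gamma> h)\<^sup>2 + (h 0)\<^sup>2)"

definition V_inner :: "real \<Rightarrow> (nat \<Rightarrow> real) \<Rightarrow> (nat \<Rightarrow> real) \<Rightarrow> real" where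
  "V_inner \<gamma> g h = (\<Sum>i. (- eigval (Suc i)) powr \<gamma> * (g (Suc i) * h (Suc i))) + g 0 * h 0"

lemma V_zero: "(\<lambda>_. 0) \<in> V \<gamma>"
  by (simp add: V_def)

lemma V_summable_mult:
  assumes "g \<in> V \<gamma>" "h \<in> V \<gamma>"
  shows "summable (\<lambda>i. (- eigval (Suc i)) powr \<gamma> * (g (Suc i) * h (Suc i)))"
proof (rule summable_comparison_test')
  show "summable (\<lambda>i. (- eigval (Suc i)) powr \<gamma> * (g (Suc i))\<^sup>2
          + (- eigval (Suc i)) powr \<gamma> * (h (Suc i))\<^sup>2)"
    using assms by (auto simp: V_def intro: summable_add)
  fix i :: nat
  have *: "\<bar>a * b\<bar> \<le> a\<^sup>2 + b\<^sup>2" for a b :: real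
  proof -
    have "0 \<le> (\<bar>a\<bar> - \<bar>b\<bar>)\<^sup>2" by simp
    hence "2 * \<bar>a * b\<bar> \<le> a\<^sup>2 + b\<^sup>2" by (simp add: power2_diff abs_mult)
    thus ?thesis using abs_ge_zero[of "a * b"] by linarith
  qed
  show "norm ((- eigval (Suc i)) powr \<gamma> * (g (Suc i) * h (Suc i)))
      \<le> (- eigval (Suc i)) powr \<gamma> * (g (Suc i))\<^sup>2 + (- eigval (Suc i)) powr \<gamma> * (h (Suc i))\<^sup>2"
    using mult_left_mono[OF *[of "g (Suc i)" "h (Suc i)"], of "(- eigval (Suc i)) powr \<gamma>"]
    by (simp add: abs_mult distrib_left)
qed

lemma V_add:
  assumes "g \<in> V \<gamma>" "h \<in> V \<gamma>"
  shows "(\<lambda>i. g i + h i) \<in> V \<gamma>"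
proof -
  have "summable (\<lambda>i. ((- eigval (Suc i)) powr \<gamma> * (g (Suc i))\<^sup>2
          + (- eigval (Suc i)) powr \<gamma> * (h (Suc i))\<^sup>2)
          + 2 * ((- eigval (Suc i)) powr \<gamma> * (g (Suc i) * h (Suc i))))"
    using assms V_summable_mult[OF assms]
    by (intro summable_add summable_mult) (auto simp: V_def)
  thus ?thesis by (simp add: V_def power2_sum algebra_simps)
qed

lemma V_scale:
  assumes "h \<in> V \<gamma>"
  shows "(\<lambda>i. a * h i) \<in> V \<gamma>"
proof -
  have "summable (\<lambda>i. a\<^sup>2 * ((- eigval (Suc i)) powr \<gamma> * (h (Suc i))\<^sup>2))"
    using assms by (intro summable_mult) (auto simp: V_def)
  thus ?thesis by (simp add: V_def power_mult_distrib mult_ac)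
qed

section \<open>The state space\<close>

typedef H = "V (-1)"
  morphisms coord Abs_H
  using V_zero by blast

lemma coord_V: "coord x \<in> V (-1)"
  by (rule coord)

lemma H_eqI: "(\<And>i. coord x i = coord y i) \<Longrightarrow> x = y"
  by (metis coord_inject ext)

instantiation H :: real_inner
begin

definition "0 = Abs_H (\<lambda>_. 0)"
definition "x + y = Abs_H (\<lambda>i. coord x i + coord y i)"
definition "- x = Abs_H (\<lambda>i. - 1 * coord x i)" for x :: H
definition "x - y = x + (- y)" for x y :: H
definition "scaleR a x = Abs_H (\<lambda>i. a * coord x i)"
definition "inner x y = V_inner (-1) (coord x) (coord y)"
definition "norm x = sqrt (inner x x)" for x :: H
definition "sgn x = inverse (norm x) *\<^sub>R x" for x :: H
definition "dist x y = norm (x - y)" for x y :: H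
definition "uniformity = (INF e\<in>{0 <..}. principal {(x :: H, y). dist x y < e})"
definition "open U = (\<forall>x\<in>U. eventually (\<lambda>(x', y). x' = x \<longrightarrow> y \<in> U) uniformity)" for U :: "H set"

lemma coord_zero: "coord 0 i = 0"
  by (simp add: zero_H_def Abs_H_inverse V_zero)

lemma coord_add: "coord (x + y) i = coord x i + coord y i"
  by (simp add: plus_H_def Abs_H_inverse V_add coord_V)

lemma coord_uminus: "coord (- x) i = - coord x i"
  unfolding uminus_H_def by (subst Abs_H_inverse[OF V_scale[OF coord_V]]) simp

lemma coord_diff: "coord (x - y) i = coord x i - coord y i"
  by (simp add: minus_H_def coord_add coord_uminus)

lemma coord_scaleR: "coord (a *\<^sub>R x) i = a * coord x i"
  by (simp add: scaleR_H_def Abs_H_inverse V_scale coord_V)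

lemmas coord_simps = coord_zero coord_add coord_uminus coord_diff coord_scaleR

instance
proof
  fix x y z :: H and a b :: real
  show "x + y + z = x + (y + z)" "x + y = y + x" "0 + x = x" "- x + x = 0" "x - y = x + - y"
    "a *\<^sub>R (x + y) = a *\<^sub>R x + a *\<^sub>R y" "(a + b) *\<^sub>R x = a *\<^sub>R x + b *\<^sub>R x"
    "a *\<^sub>R b *\<^sub>R x = (a * b) *\<^sub>R x" "1 *\<^sub>R x = x"
    by (auto intro!: H_eqI simp: coord_simps algebra_simps)
  show "dist x y = norm (x - y)" "sgn x = scaleR (inverse (norm x)) x" "norm x = sqrt (inner x x)"
    by (simp_all add: dist_H_def sgn_H_def norm_H_def)
  show "uniformity = (INF e\<in>{0 <..}. principal {(x :: H, y). dist x y < e})"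
    by (rule uniformity_H_def)
  show "open U = (\<forall>x\<in>U. eventually (\<lambda>(x', y). x' = x \<longrightarrow> y \<in> U) uniformity)" for U :: "H set"
    by (rule open_H_def)
  show "inner x y = inner y x"
    by (simp add: inner_H_def V_inner_def mult.commute)
  show "inner (x + y) z = inner x z + inner y z"
    using suminf_add[OF V_summable_mult[OF coord_V[of x] coord_V[of z]]
        V_summable_mult[OF coord_V[of y] coord_V[of z]]]
    unfolding inner_H_def V_inner_def coord_add by (simp only: distrib_left distrib_right)
  show "inner (a *\<^sub>R x) y = a * inner x y"
    using suminf_mult[OF V_summable_mult[OF coord_V[of x] coord_V[of y]], of a]
    unfolding inner_H_def V_inner_def coord_scaleR
    by (simp only: distrib_left mult.assoc mult.left_commute[of _ a])
  have s: "summable (\<lambda>i. (- eigval (Suc i)) powr (-1) * (coord x (Suc i) * coord x (Suc i)))"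
    by (rule V_summable_mult[OF coord_V coord_V])
  have p: "0 \<le> (\<Sum>i. (- eigval (Suc i)) powr (-1) * (coord x (Suc i) * coord x (Suc i)))"
    by (rule suminf_nonneg[OF s]) simp
  show "0 \<le> inner x x"
    using p by (simp add: inner_H_def V_inner_def)
  show "(inner x x = 0) = (x = 0)"
  proof
    assume "inner x x = 0"
    with p have 0: "coord x 0 = 0"
      and "(\<Sum>i. (- eigval (Suc i)) powr (-1) * (coord x (Suc i) * coord x (Suc i))) = 0"
      by (auto simp: inner_H_def V_inner_def add_nonneg_eq_0_iff)
    hence "(- eigval (Suc i)) powr (-1) * (coord x (Suc i) * coord x (Suc i)) = 0" for i
      using suminf_eq_zero_iff[OF s] by simp
    hence "coord x (Suc i) = 0" for i
      by (auto simp: eigval_def)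
    with 0 show "x = 0"
      by (metis H_eqI coord_zero not0_implies_Suc)
  next
    assume "x = 0"
    thus "inner x x = 0"
      by (simp add: inner_H_def V_inner_def coord_simps)
  qed
qed

end

definition H_avg :: "real \<Rightarrow> H set" where
  "H_avg c = {h. coord h 0 = c}"

lemma norm_H_eq: "norm x = V_norm (-1) (coord x)"
proof -
  have "0 \<le> (\<Sum>i. (- eigval (Suc i)) powr (-1) * (coord x (Suc i))\<^sup>2)"
    using coord_V[of x] by (intro suminf_nonneg) (auto simp: V_def)
  thus ?thesis
    by (simp add: norm_H_def inner_H_def V_inner_def V_norm_def V_seminorm_def power2_eq_square)
qed

lemma dist_H_avg:
  assumes "x \<in> H_avg c" "y \<in> H_avg c"
  shows "dist x y = V_seminorm (-1) (\<lambda>i. coord x i - coord y i)"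
proof -
  have "0 \<le> (\<Sum>i. (- eigval (Suc i)) powr (-1) * (coord (x - y) (Suc i))\<^sup>2)"
    using coord_V[of "x - y"] by (intro suminf_nonneg) (auto simp: V_def)
  thus ?thesis using assms
    by (simp add: dist_H_def norm_H_eq V_norm_def V_seminorm_def coord_simps H_avg_def)
qed

definition bounded_borel :: "H set \<Rightarrow> (H \<Rightarrow> real) set" where
  "bounded_borel E = {\<phi>. \<phi> \<in> borel_measurable (restrict_space borel E) \<and> bounded (\<phi> ` E)}"

section \<open>The noise\<close>

definition brownian_motion :: "'w measure \<Rightarrow> (real \<Rightarrow> 'w \<Rightarrow> real) \<Rightarrow> bool" where
  "brownian_motion M \<beta> \<longleftrightarrow> prob_space M
    \<and> (\<forall>t\<ge>0. \<beta> t \<in> borel_measurable M)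
    \<and> (AE \<omega> in M. \<beta> 0 \<omega> = 0 \<and> continuous_on {0..} (\<lambda>t. \<beta> t \<omega>))
    \<and> (\<forall>s t. 0 \<le> s \<and> s < t \<longrightarrow>
         distributed M lborel (\<lambda>\<omega>. \<beta> t \<omega> - \<beta> s \<omega>) (normal_density 0 (sqrt (t - s))))
    \<and> (\<forall>(\<tau> :: nat \<Rightarrow> real) m. 0 \<le> \<tau> 0 \<and> mono \<tau> \<longrightarrow>
         prob_space.indep_vars M (\<lambda>_. borel) (\<lambda>i \<omega>. \<beta> (\<tau> (Suc i)) \<omega> - \<beta> (\<tau> i) \<omega>) {..<m})"

text \<open>\<open>W t \<omega> k\<close> is the coefficient along \<open>e\<^sub>k\<close> of the (formal) sum
  \<open>W(t) = \<Sum>k. \<beta>\<^sub>k(t) e\<^sub>k\<close> with independent Brownian motions \<open>\<beta>\<^sub>k\<close>.\<close>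

definition cylindrical_wiener :: "'w measure \<Rightarrow> (real \<Rightarrow> 'w \<Rightarrow> nat \<Rightarrow> real) \<Rightarrow> bool" where
  "cylindrical_wiener M W \<longleftrightarrow> prob_space M
    \<and> (\<forall>k. brownian_motion M (\<lambda>t \<omega>. W t \<omega> k))
    \<and> prob_space.indep_vars M (\<lambda>_. \<Pi>\<^sub>M t\<in>{0..}. borel) (\<lambda>k \<omega>. \<lambda>t\<in>{0..}. W t \<omega> k) UNIV"

text \<open>The square root of the covariance operator \<open>\<Sum>k. b\<^sub>k \<langle>\<cdot>,e\<^sub>k\<rangle> e\<^sub>k\<close>.\<close>

definition cov_sqrt :: "(nat \<Rightarrow> real) \<Rightarrow> (nat \<Rightarrow> real) \<Rightarrow> nat \<Rightarrow> real" where
  "cov_sqrt b = diag_op (\<lambda>k. sqrt (b k))"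

definition basis_vec :: "nat \<Rightarrow> nat \<Rightarrow> real" where
  "basis_vec k = (\<lambda>i. if i = k then 1 else 0)"

text \<open>Finiteness of the trace of \<open>\<surd>B (-A)\<^sup>\<gamma> \<surd>B\<^sup>*\<close>, where \<open>S = \<surd>B\<close> is self-adjoint; all its
  diagonal entries are nonnegative.\<close>

definition finite_trace :: "real \<Rightarrow> ((nat \<Rightarrow> real) \<Rightarrow> nat \<Rightarrow> real) \<Rightarrow> bool" where
  "finite_trace \<gamma> S \<longleftrightarrow> summable (\<lambda>k. S (neg_laplace_power \<gamma> (S (basis_vec k))) k)"

section \<open>The approximated equation and its transition semigroup\<close>

definition f_approx :: "real \<Rightarrow> nat \<Rightarrow> real \<Rightarrow> real" where
  "f_approx lam n u = - 2 * (\<Sum>k=0..n. u ^ (2 * k + 1) / real (2 * k + 1)) + lam * u"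

text \<open>One path \<open>\<xi>\<close> of a solution driven by the path \<open>w\<close> of the noise. The function \<open>u\<close> of time and
  space is the representative of \<open>\<xi>\<close> in \<open>L\<^sup>2\<^sup>n\<^sup>+\<^sup>2((0,T) \<times> (0,1))\<close>; the equation, integrated in time,
  is an identity between generalised functions, i.e. between their coefficient sequences.\<close>

definition solution_path ::
    "real \<Rightarrow> nat \<Rightarrow> (real \<Rightarrow> nat \<Rightarrow> real) \<Rightarrow> H \<Rightarrow> (real \<Rightarrow> H) \<Rightarrow> bool" where
  "solution_path lam n w x \<xi> \<longleftrightarrow> continuous_on {0..} \<xi> \<and> \<xi> 0 = x
    \<and> (\<exists>u :: real \<times> real \<Rightarrow> real.
         u \<in> borel_measurable borel
       \<and> (\<forall>T>0. set_integrable lborel ({0<..<T} \<times> {0<..<1}) (\<lambda>z. \<bar>u z\<bar> ^ (2 * n + 2)))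
       \<and> (AE s in lborel. 0 < s \<longrightarrow> coord (\<xi> s) = coeffs (\<lambda>\<theta>. u (s, \<theta>)))
       \<and> (\<forall>t\<ge>0. \<forall>k. coord (\<xi> t) k = coord x k
            - 1/2 * (LINT s:{0..t}|lborel. laplace (laplace (coord (\<xi> s))) k
                       + laplace (coeffs (\<lambda>\<theta>. f_approx lam n (u (s, \<theta>)))) k)
            + w t k))"

definition solution :: "'w measure \<Rightarrow> (real \<Rightarrow> 'w \<Rightarrow> nat \<Rightarrow> real)
    \<Rightarrow> ((nat \<Rightarrow> real) \<Rightarrow> nat \<Rightarrow> real) \<Rightarrow> real \<Rightarrow> nat \<Rightarrow> H \<Rightarrow> (real \<Rightarrow> 'w \<Rightarrow> H) \<Rightarrow> bool" where
  "solution M W S lam n x X \<longleftrightarrow>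
     (\<forall>t\<ge>0. X t \<in> measurable M borel)
   \<and> (AE \<omega> in M. solution_path lam n (\<lambda>t. S (W t \<omega>)) x (\<lambda>t. X t \<omega>))"

text \<open>\<open>E[\<phi>(X(t,x))]\<close> for \<open>\<phi>\<close> defined on \<open>H_avg c\<close>. For \<open>x \<in> H_avg c\<close> the restriction of the
  integral removes only a null set: the process stays in \<open>H_avg c\<close> almost surely.\<close>

definition P_approx :: "'w measure \<Rightarrow> (H \<Rightarrow> real \<Rightarrow> 'w \<Rightarrow> H) \<Rightarrow> real
    \<Rightarrow> real \<Rightarrow> (H \<Rightarrow> real) \<Rightarrow> H \<Rightarrow> real" where
  "P_approx M X c t \<phi> x = (LINT \<omega>:{\<omega> \<in> space M. X x t \<omega> \<in> H_avg c}|M. \<phi> (X x t \<omega>))"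

section \<open>Transition semigroups and irreducibility\<close>

text \<open>Values of \<open>P t \<phi>\<close> outside \<open>E\<close>, and of \<open>P t\<close> for negative \<open>t\<close>, are irrelevant. The inclusion of
  \<open>P t ` bounded_borel E\<close> in \<open>bounded_borel E\<close> follows from the kernel representation.\<close>

definition transition_semigroup :: "H set \<Rightarrow> (real \<Rightarrow> (H \<Rightarrow> real) \<Rightarrow> H \<Rightarrow> real) \<Rightarrow> bool" where
  "transition_semigroup E P \<longleftrightarrow>
     (\<forall>t\<ge>0. \<exists>\<kappa> \<in> measurable (restrict_space borel E) (prob_algebra (restrict_space borel E)).
        \<forall>\<phi>\<in>bounded_borel E. \<forall>x\<in>E. P t \<phi> x = (\<integral>y. \<phi> y \<partial>\<kappa> x))
   \<and> (\<forall>\<phi>\<in>bounded_borel E. \<forall>x\<in>E. P 0 \<phi> x = \<phi> x)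
   \<and> (\<forall>s\<ge>0. \<forall>t\<ge>0. \<forall>\<phi>\<in>bounded_borel E. \<forall>x\<in>E. P (s + t) \<phi> x = P s (P t \<phi>) x)"

definition weakly_top_irreducible :: "H set \<Rightarrow> (real \<Rightarrow> (H \<Rightarrow> real) \<Rightarrow> H \<Rightarrow> real) \<Rightarrow> bool" where
  "weakly_top_irreducible E P \<longleftrightarrow>
     (\<forall>x\<^sub>1\<in>E. \<forall>x\<^sub>2\<in>E. \<exists>y\<in>E. \<forall>U. openin (top_of_set E) U \<and> y \<in> U \<longrightarrow>
        (\<exists>t\<^sub>1>0. \<exists>t\<^sub>2>0. P t\<^sub>1 (indicator U) x\<^sub>1 > 0 \<and> P t\<^sub>2 (indicator U) x\<^sub>2 > 0))"

end

theory Submission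
  imports Defs
begin

text \<open>
  Let \<open>y\<close> be the constant function \<open>c\<close>, and for \<open>x\<close> in \<open>H\<^sub>c\<close> let \<open>\<rho>\<close> be the infimum of the radii \<open>r\<close> such that
  some \<open>P\<^sub>t(x, ball y r)\<close> is positive. If \<open>\<rho> > 0\<close>, a short time step started in a ball of radius
  slightly above \<open>\<rho>\<close> reaches, with positive probability, a ball of radius below \<open>\<rho>\<close>, which
  contradicts the semigroup property; no Feller property is used. The probability of the step is
  bounded below uniformly in \<open>n\<close>, so that it survives in the limit.

  For the step, the noise follows with positive probability a straight line on the modes
  \<open>1, \<dots>, N\<close> and is small on the others. The slope is proportional to the initial coefficients: over a
  short time it cancels the destabilising part of \<open>\<lambda>u\<close>, and the modes above \<open>N\<close> are stable. After
  subtracting the stochastic convolution, the energy estimate in \<open>V\<^sub>-\<^sub>1\<close> gives a contraction whose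
  constants do not depend on \<open>n\<close>: the polynomial nonlinearity is monotone, and it is only evaluated
  explicitly near \<open>c\<close>, where it is bounded by a geometric series because \<open>\<bar>c\<bar> < 1\<close>.
\<close>

section \<open>Fejer means of cosine series\<close>

text \<open>The equation is given coefficient by coefficient, while monotonicity of the nonlinearity
  is pointwise in space. Testing the equation with the solution therefore needs sums of products of
  coefficients to converge to an integral, for a function of class L^(2n+2) and a nonlinear term
  that lies only in the dual class. Cesaro weights serve this: their kernel is nonnegative, so
  Young's inequality under the kernel gives bounds uniform in the truncation.

  The noise must be small uniformly in space, because the nonlinearity is evaluated at
  \<open>c\<close> plus the convolution; as eigenfunctions are bounded, absolutely summable
  coefficients suffice. Mode k relaxes in time of order k^-4, so a fixed time holds of order k^4
  blocks; 24th moments bring the failure probability down to order k^-2. An oscillation k^-7/4 per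
  block is small enough, since the trace condition makes b_k / k^2 and hence sqrt(b_k) k^-7/4
  summable.

  The slope is frozen at the initial coefficients. The error is quadratic in the displacement of the
  low modes, which after absorption by the dissipation is of second order in the step length,
  against a gain of first order.\<close>

definition unit_lborel :: "real measure" where
  "unit_lborel = restrict_space lborel {0<..<1}"

lemma space_unit_lborel [simp]: "space unit_lborel = {0<..<1}"
  by (simp add: unit_lborel_def)

lemma measurable_unit_lborel [measurable (raw)]:
  "f \<in> borel_measurable borel \<Longrightarrow> f \<in> borel_measurable unit_lborel"
  unfolding unit_lborel_def by (rule measurable_restrict_space1) simp

interpretation unit_lborel: prob_space unit_lborel
  by standard (simp add: unit_lborel_def emeasure_restrict_space)

lemma integral_unit_lborel: "(\<integral>\<theta>. f \<theta> \<partial>unit_lborel) = (LINT \<theta>:{0<..<1}|lborel. f \<theta>)"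
  for f :: "real \<Rightarrow> real"
  unfolding unit_lborel_def set_lebesgue_integral_def by (subst integral_restrict_space) auto

lemma integrable_unit_lborel:
  "integrable unit_lborel f \<longleftrightarrow> set_integrable lborel {0<..<1} f" for f :: "real \<Rightarrow> real"
  unfolding unit_lborel_def set_integrable_def by (subst integrable_restrict_space) auto

lemma coeffs_eq: "coeffs g i = (\<integral>\<theta>. g \<theta> * eigfun i \<theta> \<partial>unit_lborel)"
  by (simp add: coeffs_def integral_unit_lborel)

lemma continuous_eigfun [continuous_intros]: "continuous_on A (eigfun i)"
  by (cases "i = 0") (auto simp: eigfun_def[abs_def] intro!: continuous_intros)

lemma borel_measurable_eigfun [measurable]: "eigfun i \<in> borel_measurable borel"
  by (intro borel_measurable_continuous_onI continuous_eigfun)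

lemma abs_eigfun_le: "\<bar>eigfun i \<theta>\<bar> \<le> sqrt 2"
  using abs_cos_le_one[of "real i * pi * \<theta>"]
  by (auto simp: eigfun_def abs_mult intro: mult_left_le)

lemma eigfun_mult_eigfun:
  assumes "i \<noteq> 0" "j \<noteq> 0"
  shows "eigfun i \<theta> * eigfun j \<eta>
    = cos (real i * pi * \<theta> - real j * pi * \<eta>) + cos (real i * pi * \<theta> + real j * pi * \<eta>)"
proof -
  have "eigfun i \<theta> * eigfun j \<eta>
      = (sqrt 2 * sqrt 2) * (cos (real i * pi * \<theta>) * cos (real j * pi * \<eta>))"
    using assms unfolding eigfun_def by (simp only: if_False mult_ac)
  thus ?thesis by (simp add: cos_times_cos)
qed

lemma eigfun_0 [simp]: "eigfun 0 \<theta> = 1"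
  by (simp add: eigfun_def)

text \<open>The frequency is an integer because the product of two modes contains the difference of
  their indices, which may be negative.\<close>

lemma integral_cos_unit:
  assumes "k \<noteq> 0"
  shows "(\<integral>\<theta>. cos (of_int k * pi * \<theta>) \<partial>unit_lborel) = 0"
proof -
  have "(LINT \<theta>:{0<..<1}|lborel. cos (of_int k * pi * \<theta>))
      = (LBINT \<theta>=ereal 0..ereal 1. cos (of_int k * pi * \<theta>))"
    by (simp add: interval_lebesgue_integral_def)
  also have "\<dots> = sin (of_int k * pi * 1) / (of_int k * pi) - sin (of_int k * pi * 0) / (of_int k * pi)"
    using assms
    by (intro interval_integral_FTC_finite continuous_intros)
       (auto intro!: derivative_eq_intros simp flip: has_real_derivative_iff_has_vector_derivative)
  also have "\<dots> = 0"
    using sin_int_times_real[of k pi] sin_zero_iff_int2[of "of_int k * pi"] by auto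
  finally show ?thesis by (simp add: integral_unit_lborel)
qed

lemma integrable_bounded_mult_eigfun:
  assumes "integrable unit_lborel f"
  shows "integrable unit_lborel (\<lambda>\<theta>. f \<theta> * eigfun i \<theta>)"
proof (rule Bochner_Integration.integrable_bound)
  show "integrable unit_lborel (\<lambda>\<theta>. sqrt 2 * f \<theta>)" using assms by simp
  show "(\<lambda>\<theta>. f \<theta> * eigfun i \<theta>) \<in> borel_measurable unit_lborel"
    using assms by measurable
  show "AE \<theta> in unit_lborel. norm (f \<theta> * eigfun i \<theta>) \<le> norm (sqrt 2 * f \<theta>)"
    using abs_eigfun_le[of i] by (auto simp: abs_mult mult.commute intro!: AE_I2 mult_left_mono)
qed

lemma integral_eigfun: "(\<integral>\<theta>. eigfun i \<theta> \<partial>unit_lborel) = (if i = 0 then 1 else 0)"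
proof (cases "i = 0")
  case True
  then show ?thesis using unit_lborel.prob_space by (simp add: eigfun_def)
next
  case False
  then show ?thesis using integral_cos_unit[of "int i"] by (simp add: eigfun_def)
qed

lemma integrable_continuous_unit:
  assumes "continuous_on UNIV f" "\<And>\<theta>. \<bar>f \<theta>\<bar> \<le> B"
  shows "integrable unit_lborel (f :: real \<Rightarrow> real)"
  using assms
  by (intro unit_lborel.integrable_const_bound[of _ B])
     (auto intro!: measurable_unit_lborel borel_measurable_continuous_onI)

lemma coeffs_eigfun: "coeffs (eigfun j) i = (if i = j then 1 else 0)"
proof (cases "i = 0 \<or> j = 0")
  case True
  then show ?thesis using integral_eigfun[of i] integral_eigfun[of j] by (auto simp: coeffs_eq)
next
  case False
  have int: "integrable unit_lborel (\<lambda>\<theta>. cos (of_int k * pi * \<theta>))" for k :: int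
    by (rule integrable_continuous_unit[of _ 1]) (auto intro!: continuous_intros)
  have "eigfun j \<theta> * eigfun i \<theta>
      = cos (of_int (int j - int i) * pi * \<theta>) + cos (of_int (int j + int i) * pi * \<theta>)" for \<theta>
    using False eigfun_mult_eigfun[of j i \<theta> \<theta>] by (simp add: algebra_simps)
  hence "coeffs (eigfun j) i = (\<integral>\<theta>. cos (of_int (int j - int i) * pi * \<theta>) \<partial>unit_lborel)
      + (\<integral>\<theta>. cos (of_int (int j + int i) * pi * \<theta>) \<partial>unit_lborel)"
    unfolding coeffs_eq by (simp only: Bochner_Integration.integral_add[OF int int])
  moreover have "(\<integral>\<theta>. cos (of_int (int j + int i) * pi * \<theta>) \<partial>unit_lborel) = 0"
    using False by (intro integral_cos_unit) auto
  moreover have "(\<integral>\<theta>. cos (of_int (int j - int i) * pi * \<theta>) \<partial>unit_lborel) = (if i = j then 1 else 0)"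
    using integral_cos_unit[of "int j - int i"] unit_lborel.prob_space by auto
  ultimately show ?thesis by simp
qed

lemma coeffs_add:
  assumes "integrable unit_lborel f" "integrable unit_lborel g"
  shows "coeffs (\<lambda>\<theta>. f \<theta> + g \<theta>) i = coeffs f i + coeffs g i"
  unfolding coeffs_eq
  by (simp add: distrib_right integrable_bounded_mult_eigfun assms)

lemma coeffs_diff:
  assumes "integrable unit_lborel f" "integrable unit_lborel g"
  shows "coeffs (\<lambda>\<theta>. f \<theta> - g \<theta>) i = coeffs f i - coeffs g i"
  unfolding coeffs_eq
  by (simp add: left_diff_distrib integrable_bounded_mult_eigfun assms)

lemma coeffs_scale: "coeffs (\<lambda>\<theta>. a * f \<theta>) i = a * coeffs f i"
  unfolding coeffs_eq by (simp add: mult.assoc)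

lemma coeffs_const: "coeffs (\<lambda>\<theta>. a) i = (if i = 0 then a else 0)"
  using integral_eigfun[of i] unfolding coeffs_eq by simp

section \<open>Cesaro weights and the Fejer kernel\<close>

definition fejer_weight :: "nat \<Rightarrow> nat \<Rightarrow> real" where
  "fejer_weight m k = (if k < m then 1 - real k / real m else 0)"

lemma fejer_weight_nonneg: "0 \<le> fejer_weight m k"
  by (auto simp: fejer_weight_def divide_simps)

lemma fejer_weight_le_1: "fejer_weight m k \<le> 1"
  by (auto simp: fejer_weight_def)

lemma fejer_weight_tendsto: "(\<lambda>m. fejer_weight m k) \<longlonglongrightarrow> 1"
proof (rule Lim_transform_eventually)
  show "(\<lambda>m. 1 - real k * (1 / real m)) \<longlonglongrightarrow> 1"
    using tendsto_diff[OF tendsto_const tendsto_mult[OF tendsto_const lim_1_over_n]] by fastforce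
  show "\<forall>\<^sub>F m in sequentially. 1 - real k * (1 / real m) = fejer_weight m k"
    using eventually_gt_at_top[of k] by eventually_elim (simp add: fejer_weight_def)
qed

text \<open>The left-hand side is the squared modulus of the sum of exp(i k x) over k < m. In its
  expansion a difference k of two indices occurs m - k times for each sign. This is the source of
  the positivity of the Fejer kernel.\<close>

lemma fejer_sum_squares:
  "(\<Sum>i<m. cos (real i * x))\<^sup>2 + (\<Sum>i<m. sin (real i * x))\<^sup>2
    = real m + 2 * (\<Sum>k=1..<m. (real m - real k) * cos (real k * x))"
proof (induction m)
  case (Suc m)
  \<comment> \<open>Passing from m to m + 1 adds the products of index m with every smaller index,
    one for each difference 1, ..., m.\<close>
  have 1: "(\<Sum>i<m. cos (real i * x) * cos (real m * x) + sin (real i * x) * sin (real m * x))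
      = (\<Sum>k=1..<Suc m. cos (real k * x))"
  proof -
    have "(\<Sum>i<m. cos (real i * x) * cos (real m * x) + sin (real i * x) * sin (real m * x))
        = (\<Sum>i<m. cos (real (m - i) * x))"
    proof (intro sum.cong refl)
      fix i assume "i \<in> {..<m}"
      hence "real (m - i) * x = real m * x - real i * x"
        by (simp add: of_nat_diff left_diff_distrib)
      thus "cos (real i * x) * cos (real m * x) + sin (real i * x) * sin (real m * x)
          = cos (real (m - i) * x)"
        by (simp add: cos_diff mult.commute)
    qed
    also have "\<dots> = (\<Sum>k=1..<Suc m. cos (real k * x))"
      by (rule sum.reindex_bij_witness[of _ "\<lambda>k. m - k" "\<lambda>i. m - i"]) auto
    finally show ?thesis .
  qed
  have 2: "(\<Sum>k=1..<Suc m. (real (Suc m) - real k) * cos (real k * x))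
      = (\<Sum>k=1..<m. (real m - real k) * cos (real k * x)) + (\<Sum>k=1..<Suc m. cos (real k * x))"
  proof (cases m)
    case (Suc j)
    have "(\<Sum>k=1..<Suc m. (real (Suc m) - real k) * cos (real k * x))
       = (\<Sum>k=1..<Suc m. (real m - real k) * cos (real k * x)) + (\<Sum>k=1..<Suc m. cos (real k * x))"
      by (subst sum.distrib[symmetric]) (intro sum.cong refl, simp add: algebra_simps)
    then show ?thesis using Suc by simp
  qed simp
  let ?C = "\<Sum>i<m. cos (real i * x)" and ?S = "\<Sum>i<m. sin (real i * x)"
  have "(\<Sum>i<Suc m. cos (real i * x))\<^sup>2 + (\<Sum>i<Suc m. sin (real i * x))\<^sup>2
      = ?C\<^sup>2 + ?S\<^sup>2 + ((sin (real m * x))\<^sup>2 + (cos (real m * x))\<^sup>2)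
        + 2 * (?C * cos (real m * x) + ?S * sin (real m * x))"
    by (simp add: power2_sum algebra_simps)
  also have "?C * cos (real m * x) + ?S * sin (real m * x) = (\<Sum>k=1..<Suc m. cos (real k * x))"
    unfolding 1[symmetric] by (simp add: sum_distrib_right sum.distrib)
  finally show ?case unfolding Suc.IH 2 by (simp add: algebra_simps)
qed simp

definition fejer_kernel :: "nat \<Rightarrow> real \<Rightarrow> real \<Rightarrow> real" where
  "fejer_kernel m \<theta> \<eta> = (\<Sum>k<m. fejer_weight m k * (eigfun k \<theta> * eigfun k \<eta>))"

text \<open>A product of cosines splits into the classical kernel at \<theta> - \<eta> and its
  reflection at \<theta> + \<eta>; each is a sum of two squares up to the factor
  \<open>2 * real m\<close>.\<close>

lemma fejer_kernel_nonneg: "0 \<le> fejer_kernel m \<theta> \<eta>"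
proof (cases "m = 0")
  case False
  define \<Phi> where "\<Phi> x = real m + 2 * (\<Sum>k=1..<m. (real m - real k) * cos (real k * x))" for x
  have \<Phi>: "0 \<le> \<Phi> x" for x
    unfolding \<Phi>_def fejer_sum_squares[symmetric] by simp
  have "{..<m} = insert 0 {1..<m}" using False by auto
  hence "fejer_kernel m \<theta> \<eta> = 1 + (\<Sum>k=1..<m. fejer_weight m k * (eigfun k \<theta> * eigfun k \<eta>))"
    using False unfolding fejer_kernel_def by (simp add: fejer_weight_def)
  also have "(\<Sum>k=1..<m. fejer_weight m k * (eigfun k \<theta> * eigfun k \<eta>))
     = (\<Sum>k=1..<m. (real m - real k) * cos (real k * (pi * (\<theta> - \<eta>))) / real m
          + (real m - real k) * cos (real k * (pi * (\<theta> + \<eta>))) / real m)"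
  proof (intro sum.cong refl)
    fix k assume k: "k \<in> {1..<m}"
    have 1: "real k * (pi * (\<theta> - \<eta>)) = real k * pi * \<theta> - real k * pi * \<eta>"
      "real k * (pi * (\<theta> + \<eta>)) = real k * pi * \<theta> + real k * pi * \<eta>"
      by (simp_all add: algebra_simps)
    have 2: "eigfun k \<theta> * eigfun k \<eta>
        = cos (real k * (pi * (\<theta> - \<eta>))) + cos (real k * (pi * (\<theta> + \<eta>)))"
      unfolding 1 using k by (intro eigfun_mult_eigfun) auto
    show "fejer_weight m k * (eigfun k \<theta> * eigfun k \<eta>)
       = (real m - real k) * cos (real k * (pi * (\<theta> - \<eta>))) / real m
          + (real m - real k) * cos (real k * (pi * (\<theta> + \<eta>))) / real m"
      unfolding 2 using k by (simp add: fejer_weight_def field_simps)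
  qed
  also have "1 + \<dots> = (\<Phi> (pi * (\<theta> - \<eta>)) + \<Phi> (pi * (\<theta> + \<eta>))) / (2 * real m)"
    using False unfolding \<Phi>_def sum.distrib by (simp add: sum_divide_distrib[symmetric] field_simps)
  finally show ?thesis using \<Phi> by simp
qed (simp add: fejer_kernel_def)

definition fejer_mean :: "nat \<Rightarrow> (real \<Rightarrow> real) \<Rightarrow> real \<Rightarrow> real" where
  "fejer_mean m h \<theta> = (\<Sum>k<m. fejer_weight m k * (coeffs h k * eigfun k \<theta>))"

text \<open>A Cesaro-weighted Parseval sum. With the weights on the products of coefficients it is
  what the mode equations produce, and at the same time the pairing of \<open>g\<close> with the
  mean of \<open>h\<close>.\<close>

definition fejer_form :: "nat \<Rightarrow> (real \<Rightarrow> real) \<Rightarrow> (real \<Rightarrow> real) \<Rightarrow> real" where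
  "fejer_form m h g = (\<Sum>k<m. fejer_weight m k * (coeffs h k * coeffs g k))"

lemma integrable_kernel_mult:
  assumes "integrable unit_lborel h"
  shows "integrable unit_lborel (\<lambda>\<eta>. fejer_kernel m \<theta> \<eta> * h \<eta>)"
proof -
  have "fejer_kernel m \<theta> \<eta> * h \<eta> = (\<Sum>k<m. fejer_weight m k * eigfun k \<theta> * (h \<eta> * eigfun k \<eta>))" for \<eta>
    by (simp add: fejer_kernel_def sum_distrib_left sum_distrib_right mult_ac)
  thus ?thesis using integrable_bounded_mult_eigfun[OF assms] by auto
qed

lemma fejer_mean_eq:
  assumes "integrable unit_lborel h"
  shows "fejer_mean m h \<theta> = (\<integral>\<eta>. fejer_kernel m \<theta> \<eta> * h \<eta> \<partial>unit_lborel)"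
proof -
  have "(\<integral>\<eta>. fejer_kernel m \<theta> \<eta> * h \<eta> \<partial>unit_lborel)
     = (\<integral>\<eta>. (\<Sum>k<m. fejer_weight m k * eigfun k \<theta> * (h \<eta> * eigfun k \<eta>)) \<partial>unit_lborel)"
    by (simp add: fejer_kernel_def sum_distrib_left sum_distrib_right mult_ac)
  also have "\<dots> = (\<Sum>k<m. fejer_weight m k * eigfun k \<theta> * coeffs h k)"
    unfolding coeffs_eq
    using integrable_bounded_mult_eigfun[OF assms]
    by (subst Bochner_Integration.integral_sum) auto
  finally show ?thesis by (simp add: fejer_mean_def mult_ac)
qed

lemma integral_fejer_mean:
  assumes "0 < m"
  shows "(\<integral>\<theta>. fejer_mean m h \<theta> \<partial>unit_lborel) = coeffs h 0"
proof -
  have i: "integrable unit_lborel (eigfun k)" for k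
    by (rule integrable_continuous_unit[OF continuous_eigfun abs_eigfun_le])
  have "(\<integral>\<theta>. fejer_mean m h \<theta> \<partial>unit_lborel)
      = (\<Sum>k<m. fejer_weight m k * (coeffs h k * (if k = 0 then 1 else 0)))"
    unfolding fejer_mean_def integral_eigfun[symmetric] using i
    by (subst Bochner_Integration.integral_sum) auto
  also have "\<dots> = coeffs h 0"
    using assms by (simp add: fejer_weight_def if_distrib sum.delta' cong: if_cong)
  finally show ?thesis .
qed

lemma integrable_fejer_mean: "integrable unit_lborel (fejer_mean m h)"
  unfolding fejer_mean_def
  using integrable_continuous_unit[OF continuous_eigfun abs_eigfun_le] by auto

lemma fejer_form_eq:
  assumes "integrable unit_lborel g"
  shows "fejer_form m h g = (\<integral>\<theta>. fejer_mean m h \<theta> * g \<theta> \<partial>unit_lborel)"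
    and "integrable unit_lborel (\<lambda>\<theta>. fejer_mean m h \<theta> * g \<theta>)"
proof -
  have e: "fejer_mean m h \<theta> * g \<theta> = (\<Sum>k<m. fejer_weight m k * coeffs h k * (g \<theta> * eigfun k \<theta>))" for \<theta>
    by (simp add: fejer_mean_def sum_distrib_left sum_distrib_right mult_ac)
  show "integrable unit_lborel (\<lambda>\<theta>. fejer_mean m h \<theta> * g \<theta>)"
    unfolding e using integrable_bounded_mult_eigfun[OF assms]
    by (intro Bochner_Integration.integrable_sum integrable_mult_right)
  show "fejer_form m h g = (\<integral>\<theta>. fejer_mean m h \<theta> * g \<theta> \<partial>unit_lborel)"
  proof -
    have "fejer_form m h g
        = (\<Sum>k<m. \<integral>\<theta>. fejer_weight m k * coeffs h k * (g \<theta> * eigfun k \<theta>) \<partial>unit_lborel)"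
      by (simp add: fejer_form_def coeffs_eq[of g] mult.assoc)
    thus ?thesis
      unfolding e using integrable_bounded_mult_eigfun[OF assms]
      by (subst Bochner_Integration.integral_sum) auto
  qed
qed

text \<open>Young's inequality for the exponent \<open>Suc q\<close> and its conjugate, with crude
  constants and no fractional powers: either b is at most a / B, or a is at most B b. The free
  parameter \<open>B\<close> lets the first term be made small.\<close>

lemma young_power:
  fixes a b B :: real
  assumes "0 \<le> a" "0 \<le> b" "0 < B"
  shows "a ^ q * b \<le> a ^ Suc q / B + B ^ q * b ^ Suc q"
proof (cases "b \<le> a / B")
  case True
  have "a ^ q * b \<le> a ^ q * (a / B)" using True assms by (intro mult_left_mono) auto
  also have "\<dots> \<le> a ^ Suc q / B + B ^ q * b ^ Suc q" using assms by (simp add: field_simps)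
  finally show ?thesis .
next
  case False
  hence "a \<le> B * b" using assms by (simp add: field_simps)
  hence "a ^ q * b \<le> (B * b) ^ q * b" using assms by (intro mult_right_mono power_mono) auto
  also have "\<dots> \<le> a ^ Suc q / B + B ^ q * b ^ Suc q" using assms
    by (simp add: power_mult_distrib mult_ac)
  finally show ?thesis .
qed

lemma young_power_1:
  fixes a b B :: real
  assumes "0 \<le> a" "0 \<le> b" "0 < B"
  shows "(1 + a ^ q) * b \<le> (1 + a ^ Suc q) / B + 2 * B ^ q * b ^ Suc q"
  using young_power[of a b B q] young_power[of 1 b B q] assms
  by (simp add: algebra_simps add_divide_distrib)

lemma integrable_if_power:
  fixes h :: "real \<Rightarrow> real"
  assumes [measurable]: "h \<in> borel_measurable unit_lborel"
    and "integrable unit_lborel (\<lambda>\<theta>. \<bar>h \<theta>\<bar> ^ Suc q)"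
  shows "integrable unit_lborel h"
proof (rule Bochner_Integration.integrable_bound)
  show "integrable unit_lborel (\<lambda>\<theta>. 1 + \<bar>h \<theta>\<bar> ^ Suc q)" using assms by auto
  have "\<bar>x\<bar> \<le> 1 + \<bar>x\<bar> ^ Suc q" for x :: real
    using young_power[of 1 "\<bar>x\<bar>" 1 q] by simp
  thus "AE \<theta> in unit_lborel. norm (h \<theta>) \<le> norm (1 + \<bar>h \<theta>\<bar> ^ Suc q)"
    by (auto intro!: AE_I2 order_trans[OF _ abs_ge_self] simp del: power_Suc)
qed measurable

text \<open>Growth of order \<open>q\<close> in a function of class L^(q+1) puts \<open>g\<close> in
  the dual class; the pointwise formulation avoids the conjugate exponent. It is used with
  \<open>q = 2 * n + 1\<close> and with \<open>g\<close> the polynomial nonlinearity at a slice of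
  the solution.\<close>

locale dual_pair =
  fixes q :: nat and U g :: "real \<Rightarrow> real" and A :: real
  assumes U_measurable [measurable]: "U \<in> borel_measurable unit_lborel"
    and g_measurable [measurable]: "g \<in> borel_measurable unit_lborel"
    and U_integrable: "integrable unit_lborel (\<lambda>\<theta>. \<bar>U \<theta>\<bar> ^ Suc q)"
    and g_bound: "\<And>\<theta>. \<bar>g \<theta>\<bar> \<le> A * (1 + \<bar>U \<theta>\<bar> ^ q)"
    and A_nonneg: "0 \<le> A"
begin

definition mass :: real where "mass = (\<integral>\<theta>. 1 + \<bar>U \<theta>\<bar> ^ Suc q \<partial>unit_lborel)"

lemma g_integrable: "integrable unit_lborel g"
proof (rule Bochner_Integration.integrable_bound)
  show "integrable unit_lborel (\<lambda>\<theta>. A * (1 + \<bar>U \<theta>\<bar> ^ Suc q + 2))" using U_integrable by auto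
  have "\<bar>g \<theta>\<bar> \<le> A * (1 + \<bar>U \<theta>\<bar> ^ Suc q + 2)" for \<theta>
  proof -
    have "(1 + \<bar>U \<theta>\<bar> ^ q) \<le> 1 + \<bar>U \<theta>\<bar> ^ Suc q + 2"
      using young_power_1[of "\<bar>U \<theta>\<bar>" 1 1 q] by simp
    thus ?thesis using g_bound[of \<theta>] A_nonneg by (meson mult_left_mono order_trans)
  qed
  thus "AE \<theta> in unit_lborel. norm (g \<theta>) \<le> norm (A * (1 + \<bar>U \<theta>\<bar> ^ Suc q + 2))"
    by (auto intro!: AE_I2 order_trans[OF _ abs_ge_self] simp del: power_Suc)
qed measurable

lemma mult_integrable_bound:
  assumes [measurable]: "h \<in> borel_measurable unit_lborel"
    and h: "integrable unit_lborel (\<lambda>\<theta>. \<bar>h \<theta>\<bar> ^ Suc q)" and B: "0 < B"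
  shows "integrable unit_lborel (\<lambda>\<theta>. h \<theta> * g \<theta>)"
    and "\<bar>\<integral>\<theta>. h \<theta> * g \<theta> \<partial>unit_lborel\<bar>
      \<le> A * (mass / B + 2 * B ^ q * (\<integral>\<theta>. \<bar>h \<theta>\<bar> ^ Suc q \<partial>unit_lborel))"
proof -
  let ?D = "\<lambda>\<theta>. A * ((1 + \<bar>U \<theta>\<bar> ^ Suc q) / B + 2 * B ^ q * \<bar>h \<theta>\<bar> ^ Suc q)"
  have D: "integrable unit_lborel ?D" using U_integrable h by auto
  have le: "\<bar>h \<theta> * g \<theta>\<bar> \<le> ?D \<theta>" for \<theta>
  proof -
    have "\<bar>h \<theta> * g \<theta>\<bar> \<le> A * ((1 + \<bar>U \<theta>\<bar> ^ q) * \<bar>h \<theta>\<bar>)"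
      using mult_right_mono[OF g_bound[of \<theta>], of "\<bar>h \<theta>\<bar>"] by (simp add: abs_mult mult_ac)
    also have "\<dots> \<le> ?D \<theta>"
      using young_power_1[of "\<bar>U \<theta>\<bar>" "\<bar>h \<theta>\<bar>" B q] B A_nonneg by (intro mult_left_mono) auto
    finally show ?thesis .
  qed
  show *: "integrable unit_lborel (\<lambda>\<theta>. h \<theta> * g \<theta>)"
    by (rule Bochner_Integration.integrable_bound[OF D])
       (use order_trans[OF le abs_ge_self] in \<open>auto intro!: AE_I2 simp del: power_Suc\<close>)
  have "\<bar>\<integral>\<theta>. h \<theta> * g \<theta> \<partial>unit_lborel\<bar> \<le> (\<integral>\<theta>. ?D \<theta> \<partial>unit_lborel)"
    by (rule order_trans[OF integral_abs_bound integral_mono]) (use * D le in auto)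
  also have "\<dots> = A * (mass / B + 2 * B ^ q * (\<integral>\<theta>. \<bar>h \<theta>\<bar> ^ Suc q \<partial>unit_lborel))"
    using U_integrable h unfolding mass_def by (subst integral_mult_right_zero, subst Bochner_Integration.integral_add) auto
  finally show "\<bar>\<integral>\<theta>. h \<theta> * g \<theta> \<partial>unit_lborel\<bar>
      \<le> A * (mass / B + 2 * B ^ q * (\<integral>\<theta>. \<bar>h \<theta>\<bar> ^ Suc q \<partial>unit_lborel))" .
qed

text \<open>Young's inequality is applied under the integral against the kernel, which is nonnegative
  with marginals \<open>1\<close>; so the means of \<open>h\<close> obey the same bound as \<open>h\<close> itself.\<close>

lemma fejer_form_bound:
  assumes [measurable]: "h \<in> borel_measurable unit_lborel"
    and h: "integrable unit_lborel (\<lambda>\<theta>. \<bar>h \<theta>\<bar> ^ Suc q)" and B: "0 < B" and m: "0 < m"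
  shows "\<bar>fejer_form m h g\<bar> \<le> A * (mass / B + 2 * B ^ q * (\<integral>\<theta>. \<bar>h \<theta>\<bar> ^ Suc q \<partial>unit_lborel))"
proof -
  let ?hp = "\<lambda>\<theta>. \<bar>h \<theta>\<bar> ^ Suc q"
  let ?D = "\<lambda>\<theta>. A * ((1 + \<bar>U \<theta>\<bar> ^ Suc q) / B + 2 * B ^ q * fejer_mean m ?hp \<theta>)"
  have hi: "integrable unit_lborel h" by (rule integrable_if_power[OF _ h]) measurable
  \<comment> \<open>Only index 0 survives, and its weight is 1 because \<open>m\<close> is positive:
    the kernel has total mass 1.\<close>
  have one: "fejer_mean m (\<lambda>_. a) \<theta> = a" for a \<theta>
    using m by (simp add: fejer_mean_def coeffs_const fejer_weight_def if_distrib if_distribR sum.delta'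
        cong: if_cong)
  have D: "integrable unit_lborel ?D" using U_integrable integrable_fejer_mean by auto
  have le: "\<bar>fejer_mean m h \<theta> * g \<theta>\<bar> \<le> ?D \<theta>" for \<theta>
  proof -
    let ?k = "fejer_kernel m \<theta>"
    have "\<bar>fejer_mean m h \<theta>\<bar> \<le> (\<integral>\<eta>. ?k \<eta> * \<bar>h \<eta>\<bar> \<partial>unit_lborel)"
      unfolding fejer_mean_eq[OF hi]
      by (rule order_trans[OF integral_abs_bound])
         (simp add: abs_mult fejer_kernel_nonneg)
    hence "\<bar>fejer_mean m h \<theta> * g \<theta>\<bar> \<le> (\<integral>\<eta>. ?k \<eta> * \<bar>h \<eta>\<bar> \<partial>unit_lborel) * (A * (1 + \<bar>U \<theta>\<bar> ^ q))"
      unfolding abs_mult using g_bound[of \<theta>] by (intro mult_mono) (auto simp: fejer_kernel_nonneg)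
    also have "\<dots> = A * (\<integral>\<eta>. ?k \<eta> * ((1 + \<bar>U \<theta>\<bar> ^ q) * \<bar>h \<eta>\<bar>) \<partial>unit_lborel)"
      by (simp add: mult_ac flip: integral_mult_right_zero integral_mult_left_zero)
    also have "\<dots> \<le> A * (\<integral>\<eta>. ?k \<eta> * ((1 + \<bar>U \<theta>\<bar> ^ Suc q) / B + 2 * B ^ q * ?hp \<eta>) \<partial>unit_lborel)"
      using A_nonneg B h hi young_power_1[of "\<bar>U \<theta>\<bar>" _ B q] fejer_kernel_nonneg
      by (intro mult_left_mono integral_mono integrable_kernel_mult) auto
    also have "(\<integral>\<eta>. ?k \<eta> * ((1 + \<bar>U \<theta>\<bar> ^ Suc q) / B + 2 * B ^ q * ?hp \<eta>) \<partial>unit_lborel)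
      = (\<integral>\<eta>. ?k \<eta> * ((1 + \<bar>U \<theta>\<bar> ^ Suc q) / B) \<partial>unit_lborel) + 2 * B ^ q * (\<integral>\<eta>. ?k \<eta> * ?hp \<eta> \<partial>unit_lborel)"
    proof -
      have "(\<lambda>\<eta>. ?k \<eta> * ((1 + \<bar>U \<theta>\<bar> ^ Suc q) / B + 2 * B ^ q * ?hp \<eta>))
         = (\<lambda>\<eta>. ?k \<eta> * ((1 + \<bar>U \<theta>\<bar> ^ Suc q) / B) + 2 * B ^ q * (?k \<eta> * ?hp \<eta>))"
        by (simp add: algebra_simps)
      thus ?thesis using h
        by (simp only:) (subst Bochner_Integration.integral_add; (intro integrable_mult_right integrable_kernel_mult)?; simp)
    qed
    also have "(\<integral>\<eta>. ?k \<eta> * ((1 + \<bar>U \<theta>\<bar> ^ Suc q) / B) \<partial>unit_lborel) = (1 + \<bar>U \<theta>\<bar> ^ Suc q) / B"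
      by (subst fejer_mean_eq[symmetric]) (simp_all add: one)
    also have "(\<integral>\<eta>. ?k \<eta> * ?hp \<eta> \<partial>unit_lborel) = fejer_mean m ?hp \<theta>"
      using h by (simp add: fejer_mean_eq)
    finally show ?thesis .
  qed
  have "\<bar>fejer_form m h g\<bar> \<le> (\<integral>\<theta>. ?D \<theta> \<partial>unit_lborel)"
    unfolding fejer_form_eq(1)[OF g_integrable]
    by (rule order_trans[OF integral_abs_bound integral_mono])
       (use fejer_form_eq(2)[OF g_integrable] D le in auto)
  also have "\<dots> = A * (mass / B + 2 * B ^ q * (\<integral>\<theta>. fejer_mean m ?hp \<theta> \<partial>unit_lborel))"
    using U_integrable integrable_fejer_mean unfolding mass_def
    by (subst integral_mult_right_zero, subst Bochner_Integration.integral_add) auto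
  also have "(\<integral>\<theta>. fejer_mean m ?hp \<theta> \<partial>unit_lborel) = (\<integral>\<theta>. ?hp \<theta> \<partial>unit_lborel)"
    by (simp only: integral_fejer_mean[OF m]) (simp add: coeffs_eq)
  finally show ?thesis .
qed

end

section \<open>Approximation by cosine polynomials\<close>

text \<open>Inductive, so that the convergence of Fejer forms can be checked on one mode and
  extended by linearity.\<close>

inductive cosine_poly :: "(real \<Rightarrow> real) \<Rightarrow> bool" where
  cosine_poly_eigfun: "cosine_poly (eigfun j)"
| cosine_poly_add: "cosine_poly f \<Longrightarrow> cosine_poly g \<Longrightarrow> cosine_poly (\<lambda>\<theta>. f \<theta> + g \<theta>)"
| cosine_poly_scale: "cosine_poly f \<Longrightarrow> cosine_poly (\<lambda>\<theta>. a * f \<theta>)"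

lemma cosine_poly_const: "cosine_poly (\<lambda>_. a)"
  using cosine_poly_scale[OF cosine_poly_eigfun[of 0], of a] by simp

lemma cosine_poly_cos: "cosine_poly (\<lambda>\<theta>. cos (real k * pi * \<theta>))"
proof (cases "k = 0")
  case True
  then show ?thesis using cosine_poly_const[of 1] by simp
next
  case False
  then show ?thesis
    using cosine_poly_scale[OF cosine_poly_eigfun[of k], of "1 / sqrt 2"] by (simp add: eigfun_def)
qed

text \<open>The product formula shifts the index of a mode by one in either direction. Iterated from
  the constants, this yields every power of \<open>cos (pi * \<theta>)\<close>.\<close>

lemma cosine_poly_mult_cos:
  assumes "cosine_poly f"
  shows "cosine_poly (\<lambda>\<theta>. cos (pi * \<theta>) * f \<theta>)"
  using assms
proof induction
  case (cosine_poly_eigfun j)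
  show ?case
  proof (cases "j = 0")
    case True
    then show ?thesis using cosine_poly_cos[of 1] by simp
  next
    case False
    have "cos (pi * \<theta>) * eigfun j \<theta>
        = (sqrt 2 / 2) * (cos (real (j - 1) * pi * \<theta>) + cos (real (j + 1) * pi * \<theta>))" for \<theta>
    proof -
      have *: "real j * pi * \<theta> - pi * \<theta> = real (j - 1) * pi * \<theta>"
        "real j * pi * \<theta> + pi * \<theta> = real (j + 1) * pi * \<theta>"
        using False by (simp_all add: of_nat_diff algebra_simps)
      show ?thesis
        using False cos_times_cos[of "real j * pi * \<theta>" "pi * \<theta>"] unfolding *
        by (simp add: eigfun_def mult_ac)
    qed
    then show ?thesis
      by (simp only:) (intro cosine_poly_scale cosine_poly_add cosine_poly_cos)
  qed
next
  case (cosine_poly_add f g)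
  then show ?case using cosine_poly.cosine_poly_add by (simp add: distrib_left)
next
  case (cosine_poly_scale f a)
  then show ?case using cosine_poly.cosine_poly_scale[of _ a] by (simp add: mult.left_commute[of _ a])
qed

lemma cosine_poly_power: "cosine_poly (\<lambda>\<theta>. cos (pi * \<theta>) ^ k)"
  by (induction k) (auto intro: cosine_poly_const cosine_poly_mult_cos)

lemma cosine_poly_sum:
  "(\<And>k. cosine_poly (f k)) \<Longrightarrow> cosine_poly (\<lambda>\<theta>. \<Sum>k\<le>(n::nat). f k \<theta>)"
  by (induction n) (auto intro: cosine_poly_const cosine_poly_add)

lemma cosine_poly_continuous: "cosine_poly f \<Longrightarrow> continuous_on A f"
  by (induction rule: cosine_poly.induct) (auto intro!: continuous_intros continuous_eigfun)

lemma cosine_poly_bounded: "cosine_poly f \<Longrightarrow> \<exists>B. \<forall>\<theta>. \<bar>f \<theta>\<bar> \<le> B"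
proof (induction rule: cosine_poly.induct)
  case (cosine_poly_eigfun j)
  then show ?case using abs_eigfun_le by blast
next
  case (cosine_poly_add f g)
  then obtain B C where "\<And>\<theta>. \<bar>f \<theta>\<bar> \<le> B" "\<And>\<theta>. \<bar>g \<theta>\<bar> \<le> C" by blast
  then have "\<bar>f \<theta> + g \<theta>\<bar> \<le> B + C" for \<theta>
    by (meson abs_triangle_ineq add_mono order_trans)
  then show ?case by blast
next
  case (cosine_poly_scale f a)
  then obtain B where "\<And>\<theta>. \<bar>f \<theta>\<bar> \<le> B" by blast
  then have "\<bar>a * f \<theta>\<bar> \<le> \<bar>a\<bar> * B" for \<theta>
    by (simp add: abs_mult mult_left_mono)
  then show ?case by blast
qed

lemma cosine_poly_integrable: "cosine_poly f \<Longrightarrow> integrable unit_lborel f"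
  using cosine_poly_bounded cosine_poly_continuous integrable_continuous_unit by blast

text \<open>With x = cos(pi \<theta>) a continuous function on the unit interval becomes one on
  [-1, 1]. The Weierstrass polynomial in x found there is a cosine polynomial in \<theta>.\<close>

lemma cosine_poly_uniform_approx:
  assumes "continuous_on UNIV f" "0 < e"
  obtains g where "cosine_poly g" "\<And>\<theta>. \<theta> \<in> {0<..<1} \<Longrightarrow> \<bar>f \<theta> - g \<theta>\<bar> < e"
proof -
  let ?h = "\<lambda>x. f (arccos x / pi)"
  have "continuous_on {-1..1} ?h"
    by (intro continuous_on_compose2[OF assms(1)] continuous_intros continuous_on_arccos') auto
  then obtain p where p: "real_polynomial_function p" "\<And>x. x \<in> {-1..1} \<Longrightarrow> \<bar>?h x - p x\<bar> < e"
    using Stone_Weierstrass_real_polynomial_function[of "{-1..1}" ?h e] assms(2) by auto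
  obtain a n where a: "p = (\<lambda>x. \<Sum>i\<le>n. a i * x ^ i)"
    using p(1) real_polynomial_function_iff_sum by auto
  show ?thesis
  proof (rule that)
    show "cosine_poly (\<lambda>\<theta>. p (cos (pi * \<theta>)))"
      unfolding a by (intro cosine_poly_sum cosine_poly_scale cosine_poly_power)
    fix \<theta> :: real assume \<theta>: "\<theta> \<in> {0<..<1}"
    have "arccos (cos (pi * \<theta>)) = pi * \<theta>"
      using \<theta> mult_left_le[of \<theta> pi] by (intro arccos_cos) auto
    thus "\<bar>f \<theta> - p (cos (pi * \<theta>))\<bar> < e"
      using p(2)[of "cos (pi * \<theta>)"] by simp
  qed
qed

lemma power_sum3_le:
  fixes a b c :: real
  assumes "0 \<le> a" "0 \<le> b" "0 \<le> c"
  shows "(a + b + c) ^ k \<le> 3 ^ k * (a ^ k + b ^ k + c ^ k)"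
proof -
  define m where "m = max a (max b c)"
  have "(a + b + c) ^ k \<le> (3 * m) ^ k"
    using assms by (intro power_mono) (auto simp: m_def)
  also have "\<dots> \<le> 3 ^ k * (a ^ k + b ^ k + c ^ k)"
    using assms unfolding power_mult_distrib m_def by (intro mult_left_mono) (auto simp: max_def)
  finally show ?thesis .
qed

text \<open>Truncation at a height \<open>R\<close> gains boundedness, a measurable function is an
  almost everywhere limit of continuous ones, and these are uniformly close to cosine polynomials.
  The first two limits are taken by dominated convergence.\<close>

lemma cosine_poly_dense:
  assumes [measurable]: "v \<in> borel_measurable unit_lborel"
    and v: "integrable unit_lborel (\<lambda>\<theta>. \<bar>v \<theta>\<bar> ^ Suc q)" and e: "0 < e"
  obtains g where "cosine_poly g" "integrable unit_lborel (\<lambda>\<theta>. \<bar>v \<theta> - g \<theta>\<bar> ^ Suc q)"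
    "(\<integral>\<theta>. \<bar>v \<theta> - g \<theta>\<bar> ^ Suc q \<partial>unit_lborel) < e"
proof -
  define clamp where "clamp R x = max (- real R) (min (real R) x)" for R x
  have clamp_abs: "\<bar>clamp R x\<bar> \<le> real R" for R x by (auto simp: clamp_def)
  have [measurable]: "clamp R \<in> borel_measurable borel" for R
    unfolding clamp_def by measurable
  have clamp_cont: "continuous_on A (clamp R)" for A R
    unfolding clamp_def by (intro continuous_intros)
  \<comment> \<open>Three errors of size \<open>e'\<close> are multiplied by the factor of
    \<open>power_sum3_le\<close>; the denominator 4 keeps the total below \<open>e\<close>.\<close>
  define e' where "e' = e / (4 * 3 ^ Suc q)"
  have e': "0 < e'" using e by (simp add: e'_def)

  have "(\<lambda>R. \<integral>\<theta>. \<bar>v \<theta> - clamp R (v \<theta>)\<bar> ^ Suc q \<partial>unit_lborel) \<longlonglongrightarrow> (\<integral>\<theta>. 0 \<partial>unit_lborel)"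
  proof (rule integral_dominated_convergence[OF _ _ v])
    show "AE \<theta> in unit_lborel. (\<lambda>R. \<bar>v \<theta> - clamp R (v \<theta>)\<bar> ^ Suc q) \<longlonglongrightarrow> 0"
    proof (rule AE_I2)
      fix \<theta> :: real
      obtain R0 :: nat where "\<bar>v \<theta>\<bar> \<le> real R0" using real_arch_simple by blast
      hence "\<forall>\<^sub>F R in sequentially. \<bar>v \<theta> - clamp R (v \<theta>)\<bar> ^ Suc q = 0"
        by (intro eventually_sequentiallyI[of R0]) (auto simp: clamp_def)
      thus "(\<lambda>R. \<bar>v \<theta> - clamp R (v \<theta>)\<bar> ^ Suc q) \<longlonglongrightarrow> 0" by (simp add: tendsto_eventually)
    qed
    fix R
    have "\<bar>v \<theta> - clamp R (v \<theta>)\<bar> \<le> \<bar>v \<theta>\<bar>" for \<theta> by (auto simp: clamp_def)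
    thus "AE \<theta> in unit_lborel. norm (\<bar>v \<theta> - clamp R (v \<theta>)\<bar> ^ Suc q) \<le> \<bar>v \<theta>\<bar> ^ Suc q"
      by (auto simp del: power_Suc simp: power_mono)
  qed measurable
  from order_tendstoD(2)[OF this, of e'] e' obtain R where
    R: "(\<integral>\<theta>. \<bar>v \<theta> - clamp R (v \<theta>)\<bar> ^ Suc q \<partial>unit_lborel) < e'"
    by (auto simp: eventually_sequentially)
  have iR: "integrable unit_lborel (\<lambda>\<theta>. \<bar>v \<theta> - clamp R (v \<theta>)\<bar> ^ Suc q)"
  proof (rule Bochner_Integration.integrable_bound[OF v])
    have "\<bar>v \<theta> - clamp R (v \<theta>)\<bar> \<le> \<bar>v \<theta>\<bar>" for \<theta> by (auto simp: clamp_def)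
    thus "AE \<theta> in unit_lborel. norm (\<bar>v \<theta> - clamp R (v \<theta>)\<bar> ^ Suc q) \<le> norm (\<bar>v \<theta>\<bar> ^ Suc q)"
      by (auto simp del: power_Suc simp: power_mono)
  qed measurable

  have "v \<in> borel_measurable (lebesgue_on {0<..<1})"
    using assms(1) unfolding unit_lborel_def
    by (simp add: borel_measurable_restrict_space_iff borel_measurable_if_lebesgue_on measurable_completion)
  then obtain S w where S: "negligible S" and w: "\<And>n. continuous_on UNIV (w n)"
    and lim: "\<And>\<theta>. \<theta> \<notin> S \<Longrightarrow> (\<lambda>n. w n \<theta>) \<longlonglongrightarrow> (if \<theta> \<in> {0<..<1} then v \<theta> else (0::real))"
  proof -
    have "(\<lambda>\<theta>. if \<theta> \<in> {0<..<1} then v \<theta> else 0) \<in> borel_measurable lebesgue"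
      using \<open>v \<in> borel_measurable (lebesgue_on {0<..<1})\<close>
      by (subst borel_measurable_if) auto
    from lebesgue_measurable_imp_measurable_on[OF this, of "{0<..<1}"] show ?thesis
      using that unfolding measurable_on_def by (auto cong: if_cong)
  qed
  have AE: "AE \<theta> in unit_lborel. \<theta> \<notin> S"
  proof -
    obtain S' where "S \<subseteq> S'" "S' \<in> null_sets lborel"
      using S unfolding negligible_iff_null_sets null_sets_completion_iff2 by blast
    hence "AE \<theta> in lborel. \<theta> \<notin> S" by (auto intro: AE_I')
    thus ?thesis unfolding unit_lborel_def by (subst AE_restrict_space_iff) auto
  qed
  have [measurable]: "w n \<in> borel_measurable borel" for n
    by (intro borel_measurable_continuous_onI w)
  \<comment> \<open>The continuous approximants come without any common bound. Truncating them at
    the same height bounds every difference by \<open>2 * real R\<close>.\<close>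
  have i2: "integrable unit_lborel (\<lambda>\<theta>. \<bar>clamp R (v \<theta>) - clamp R (w n \<theta>)\<bar> ^ Suc q)"
    and b2: "\<bar>clamp R (v \<theta>) - clamp R (w n \<theta>)\<bar> ^ Suc q \<le> (2 * real R) ^ Suc q" for n \<theta>
  proof -
    have b: "\<bar>clamp R (v \<theta>) - clamp R (w n \<theta>)\<bar> ^ Suc q \<le> (2 * real R) ^ Suc q" for \<theta>
      using clamp_abs[of R "v \<theta>"] clamp_abs[of R "w n \<theta>"] by (intro power_mono) auto
    thus "\<bar>clamp R (v \<theta>) - clamp R (w n \<theta>)\<bar> ^ Suc q \<le> (2 * real R) ^ Suc q" .
    show "integrable unit_lborel (\<lambda>\<theta>. \<bar>clamp R (v \<theta>) - clamp R (w n \<theta>)\<bar> ^ Suc q)"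
      by (rule unit_lborel.integrable_const_bound[of _ "(2 * real R) ^ Suc q"])
         (use b in \<open>auto simp del: power_Suc\<close>)
  qed
  have "(\<lambda>n. \<integral>\<theta>. \<bar>clamp R (v \<theta>) - clamp R (w n \<theta>)\<bar> ^ Suc q \<partial>unit_lborel) \<longlonglongrightarrow> (\<integral>\<theta>. 0 \<partial>unit_lborel)"
  proof (rule integral_dominated_convergence[where w = "\<lambda>_. (2 * real R) ^ Suc q"])
    show "AE \<theta> in unit_lborel. (\<lambda>n. \<bar>clamp R (v \<theta>) - clamp R (w n \<theta>)\<bar> ^ Suc q) \<longlonglongrightarrow> 0"
      using AE AE_space
    proof eventually_elim
      case (elim \<theta>)
      hence "(\<lambda>n. w n \<theta>) \<longlonglongrightarrow> v \<theta>" using lim[of \<theta>] by simp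
      hence "(\<lambda>n. clamp R (w n \<theta>)) \<longlonglongrightarrow> clamp R (v \<theta>)"
        unfolding clamp_def by (intro tendsto_intros)
      hence "(\<lambda>n. \<bar>clamp R (v \<theta>) - clamp R (w n \<theta>)\<bar> ^ Suc q) \<longlonglongrightarrow> \<bar>clamp R (v \<theta>) - clamp R (v \<theta>)\<bar> ^ Suc q"
        by (intro tendsto_intros)
      thus ?case by simp
    qed
  qed (use b2 in \<open>auto simp del: power_Suc\<close>)
  from order_tendstoD(2)[OF this, of e'] e' obtain n where
    n: "(\<integral>\<theta>. \<bar>clamp R (v \<theta>) - clamp R (w n \<theta>)\<bar> ^ Suc q \<partial>unit_lborel) < e'"
    by (auto simp: eventually_sequentially)

  \<comment> \<open>Below 1 a power does not exceed its base, so uniform closeness \<open>d\<close>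
    serves every exponent.\<close>
  define d where "d = min 1 e'"
  obtain g where g: "cosine_poly g" "\<And>\<theta>. \<theta> \<in> {0<..<1} \<Longrightarrow> \<bar>clamp R (w n \<theta>) - g \<theta>\<bar> < d"
  proof (rule cosine_poly_uniform_approx)
    show "continuous_on UNIV (\<lambda>\<theta>. clamp R (w n \<theta>))"
      by (rule continuous_on_compose2[OF clamp_cont[of UNIV R] w]) auto
    show "0 < d" using e' by (simp add: d_def)
  qed blast
  have [measurable]: "g \<in> borel_measurable borel"
    using g(1) by (intro borel_measurable_continuous_onI cosine_poly_continuous)
  let ?D = "\<lambda>\<theta>. 3 ^ Suc q * (\<bar>v \<theta> - clamp R (v \<theta>)\<bar> ^ Suc q
      + \<bar>clamp R (v \<theta>) - clamp R (w n \<theta>)\<bar> ^ Suc q + e')"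
  have D: "integrable unit_lborel ?D" using iR i2[of n] by auto
  have le: "\<bar>v \<theta> - g \<theta>\<bar> ^ Suc q \<le> ?D \<theta>" if "\<theta> \<in> {0<..<1}" for \<theta>
  proof -
    have "\<bar>v \<theta> - g \<theta>\<bar> ^ Suc q \<le> (\<bar>v \<theta> - clamp R (v \<theta>)\<bar> + \<bar>clamp R (v \<theta>) - clamp R (w n \<theta>)\<bar>
       + \<bar>clamp R (w n \<theta>) - g \<theta>\<bar>) ^ Suc q"
      by (intro power_mono) auto
    also have "\<dots> \<le> 3 ^ Suc q * (\<bar>v \<theta> - clamp R (v \<theta>)\<bar> ^ Suc q + \<bar>clamp R (v \<theta>) - clamp R (w n \<theta>)\<bar> ^ Suc q
       + \<bar>clamp R (w n \<theta>) - g \<theta>\<bar> ^ Suc q)"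
      by (intro power_sum3_le) auto
    also have "\<bar>clamp R (w n \<theta>) - g \<theta>\<bar> ^ Suc q \<le> \<bar>clamp R (w n \<theta>) - g \<theta>\<bar> ^ 1"
      using g(2)[OF that] by (intro power_decreasing) (auto simp: d_def)
    also have "\<dots> \<le> e'" using g(2)[OF that] by (auto simp: d_def)
    finally show ?thesis by simp
  qed
  show ?thesis
  proof (rule that[OF g(1)])
    show i: "integrable unit_lborel (\<lambda>\<theta>. \<bar>v \<theta> - g \<theta>\<bar> ^ Suc q)"
      by (rule Bochner_Integration.integrable_bound[OF D])
         (use order_trans[OF le abs_ge_self] in \<open>auto intro!: AE_I2 simp del: power_Suc\<close>)
    have "(\<integral>\<theta>. \<bar>v \<theta> - g \<theta>\<bar> ^ Suc q \<partial>unit_lborel) \<le> (\<integral>\<theta>. ?D \<theta> \<partial>unit_lborel)"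
      using i D le by (intro integral_mono) (auto simp del: power_Suc)
    also have "\<dots> = 3 ^ Suc q * ((\<integral>\<theta>. \<bar>v \<theta> - clamp R (v \<theta>)\<bar> ^ Suc q \<partial>unit_lborel)
       + (\<integral>\<theta>. \<bar>clamp R (v \<theta>) - clamp R (w n \<theta>)\<bar> ^ Suc q \<partial>unit_lborel) + e')"
      using iR i2[of n] unit_lborel.prob_space by (simp del: power_Suc)
    also have "\<dots> < 3 ^ Suc q * (e' + e' + e')"
      using R n by (intro mult_strict_left_mono) auto
    also have "\<dots> \<le> e" using e by (simp add: e'_def field_simps)
    finally show "(\<integral>\<theta>. \<bar>v \<theta> - g \<theta>\<bar> ^ Suc q \<partial>unit_lborel) < e" .
  qed
qed

text \<open>For a single mode the form consists of one term, whose weight tends to 1; the rest is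
  linearity.\<close>

lemma (in dual_pair) fejer_form_cosine_poly:
  assumes "cosine_poly \<psi>"
  shows "(\<lambda>m. fejer_form m \<psi> g) \<longlonglongrightarrow> (\<integral>\<theta>. \<psi> \<theta> * g \<theta> \<partial>unit_lborel)"
  using assms
proof induction
  case (cosine_poly_eigfun j)
  have "(\<lambda>m. fejer_weight m j * coeffs g j) \<longlonglongrightarrow> 1 * coeffs g j"
    by (intro tendsto_mult fejer_weight_tendsto tendsto_const)
  moreover have "fejer_form m (eigfun j) g = fejer_weight m j * coeffs g j" for m
  proof -
    have "fejer_form m (eigfun j) g = (\<Sum>k<m. if k = j then fejer_weight m j * coeffs g j else 0)"
      unfolding fejer_form_def by (intro sum.cong) (auto simp: coeffs_eigfun)
    thus ?thesis by (auto simp: fejer_weight_def sum.delta)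
  qed
  ultimately show ?case by (simp add: coeffs_eq mult.commute)
next
  case (cosine_poly_add f h)
  have i: "integrable unit_lborel (\<lambda>\<theta>. f \<theta> * g \<theta>)" if "cosine_poly f" for f
  proof -
    obtain B where "\<And>\<theta>. \<bar>f \<theta>\<bar> \<le> B" using cosine_poly_bounded[OF \<open>cosine_poly f\<close>] by blast
    moreover have [measurable]: "f \<in> borel_measurable borel"
      using that by (intro borel_measurable_continuous_onI cosine_poly_continuous)
    ultimately show ?thesis
      using g_integrable
      by (intro Bochner_Integration.integrable_bound[OF integrable_mult_right[of B, OF g_integrable]])
         (auto intro!: AE_I2 mult_mono simp: abs_mult intro: order_trans[OF _ abs_ge_self])
  qed
  have "fejer_form m (\<lambda>\<theta>. f \<theta> + h \<theta>) g = fejer_form m f g + fejer_form m h g" for m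
    using cosine_poly_add.hyps cosine_poly_integrable
    by (simp add: fejer_form_def coeffs_add sum.distrib distrib_left distrib_right)
  moreover have "(\<integral>\<theta>. (f \<theta> + h \<theta>) * g \<theta> \<partial>unit_lborel)
      = (\<integral>\<theta>. f \<theta> * g \<theta> \<partial>unit_lborel) + (\<integral>\<theta>. h \<theta> * g \<theta> \<partial>unit_lborel)"
    using i cosine_poly_add.hyps by (simp add: distrib_right)
  ultimately show ?case using tendsto_add[OF cosine_poly_add.IH] by simp
next
  case (cosine_poly_scale f a)
  have "fejer_form m (\<lambda>\<theta>. a * f \<theta>) g = a * fejer_form m f g" for m
    by (simp add: fejer_form_def coeffs_scale sum_distrib_left mult_ac)
  then show ?case using tendsto_mult_left[OF cosine_poly_scale.IH, of a] by (simp add: mult.assoc)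
qed

text \<open>A density argument: the forms converge on cosine polynomials, and on the remainder both
  the forms and the limit pairing are small, uniformly in \<open>m\<close>.\<close>

theorem (in dual_pair) fejer_form_tendsto:
  assumes [measurable]: "v \<in> borel_measurable unit_lborel"
    and v: "integrable unit_lborel (\<lambda>\<theta>. \<bar>v \<theta>\<bar> ^ Suc q)"
  shows "(\<lambda>m. fejer_form m v g) \<longlonglongrightarrow> (\<integral>\<theta>. v \<theta> * g \<theta> \<partial>unit_lborel)"
proof (rule LIMSEQ_I)
  fix e :: real assume e: "0 < e"
  have mass: "0 \<le> mass" unfolding mass_def by (intro integral_nonneg_AE) auto
  \<comment> \<open>\<open>B\<close> is chosen first to make the fixed mass term small;
    \<open>d\<close> then compensates for the large power of \<open>B\<close> in front of the
    remainder.\<close>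
  define B where "B = 8 * (A * mass + 1) / e"
  have Am: "0 \<le> A * mass" using mass A_nonneg by simp
  have B: "0 < B" using e Am by (simp add: B_def)
  have B': "A * mass / B \<le> e / 8" using e Am by (simp add: B_def field_simps)
  define d where "d = e / (8 * (2 * A * B ^ q + 1))"
  have AB: "0 \<le> 2 * A * B ^ q" using A_nonneg B by simp
  have d: "0 < d" using e AB by (simp add: d_def)
  have d': "2 * A * B ^ q * d \<le> e / 8"
    using e AB by (simp add: d_def field_simps)
  obtain \<psi> where \<psi>: "cosine_poly \<psi>" "integrable unit_lborel (\<lambda>\<theta>. \<bar>v \<theta> - \<psi> \<theta>\<bar> ^ Suc q)"
    "(\<integral>\<theta>. \<bar>v \<theta> - \<psi> \<theta>\<bar> ^ Suc q \<partial>unit_lborel) < d"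
    using cosine_poly_dense[OF assms d] by blast
  have [measurable]: "\<psi> \<in> borel_measurable borel"
    using \<psi>(1) by (intro borel_measurable_continuous_onI cosine_poly_continuous)
  have bnd: "A * (mass / B + 2 * B ^ q * (\<integral>\<theta>. \<bar>v \<theta> - \<psi> \<theta>\<bar> ^ Suc q \<partial>unit_lborel)) \<le> e / 4"
  proof -
    have "2 * A * B ^ q * (\<integral>\<theta>. \<bar>v \<theta> - \<psi> \<theta>\<bar> ^ Suc q \<partial>unit_lborel) \<le> 2 * A * B ^ q * d"
      using \<psi>(3) AB by (intro mult_left_mono) auto
    moreover have eq: "A * (mass / B + 2 * B ^ q * x) = A * mass / B + 2 * A * B ^ q * x" for x
      by (simp add: algebra_simps)
    ultimately show ?thesis using B' d' unfolding eq by linarith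
  qed
  have vi: "integrable unit_lborel v" by (rule integrable_if_power[OF _ v]) measurable
  have \<psi>i: "integrable unit_lborel \<psi>" by (rule cosine_poly_integrable[OF \<psi>(1)])
  have split: "fejer_form m v g = fejer_form m (\<lambda>\<theta>. v \<theta> - \<psi> \<theta>) g + fejer_form m \<psi> g" for m
    by (simp add: fejer_form_def coeffs_diff vi \<psi>i flip: sum.distrib) (simp add: algebra_simps)
  have m1: "integrable unit_lborel (\<lambda>\<theta>. (v \<theta> - \<psi> \<theta>) * g \<theta>)"
    "\<bar>\<integral>\<theta>. (v \<theta> - \<psi> \<theta>) * g \<theta> \<partial>unit_lborel\<bar> \<le> e / 4"
    by (rule mult_integrable_bound(1)[OF _ \<psi>(2) B], measurable)
       (rule order_trans[OF mult_integrable_bound(2)[OF _ \<psi>(2) B] bnd], measurable)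
  have m2: "integrable unit_lborel (\<lambda>\<theta>. v \<theta> * g \<theta>)"
    using mult_integrable_bound(1)[of v B] v B by auto
  have split': "(\<integral>\<theta>. \<psi> \<theta> * g \<theta> \<partial>unit_lborel)
      = (\<integral>\<theta>. v \<theta> * g \<theta> \<partial>unit_lborel) - (\<integral>\<theta>. (v \<theta> - \<psi> \<theta>) * g \<theta> \<partial>unit_lborel)"
    using Bochner_Integration.integral_diff[OF m2 m1(1)] by (simp add: algebra_simps)
  obtain m0 where m0: "\<And>m. m \<ge> m0 \<Longrightarrow> \<bar>fejer_form m \<psi> g - (\<integral>\<theta>. \<psi> \<theta> * g \<theta> \<partial>unit_lborel)\<bar> < e / 4"
    using LIMSEQ_D[OF fejer_form_cosine_poly[OF \<psi>(1)], of "e / 4"] e by auto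
  show "\<exists>no. \<forall>m\<ge>no. norm (fejer_form m v g - (\<integral>\<theta>. v \<theta> * g \<theta> \<partial>unit_lborel)) < e"
  proof (intro exI allI impI)
    fix m assume m: "max 1 m0 \<le> m"
    have "\<bar>fejer_form m (\<lambda>\<theta>. v \<theta> - \<psi> \<theta>) g\<bar> \<le> e / 4"
      by (rule order_trans[OF fejer_form_bound[OF _ \<psi>(2) B] bnd]) (use m in auto)
    thus "norm (fejer_form m v g - (\<integral>\<theta>. v \<theta> * g \<theta> \<partial>unit_lborel)) < e"
      using m0[of m] m m1(2) split[of m] split' e by (simp add: abs_if split: if_splits)
  qed
qed

section \<open>Small deviations of Brownian motion\<close>

text \<open>The 24th moment of the standard normal law. The order is dictated by the number of
  blocks of the high modes, see \<open>high_mode_prob\<close>.\<close>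

definition moment24 :: real where
  "moment24 = fact 24 / (2 ^ 12 * fact 12)"

lemma moment24_pos: "0 < moment24"
  by (simp add: moment24_def)

lemma brownian_increment_tail:
  assumes bm: "brownian_motion M \<beta>" and st: "0 \<le> s" "s < t" and x: "0 < x"
  shows "measure M {\<omega> \<in> space M. x < \<bar>\<beta> t \<omega> - \<beta> s \<omega>\<bar>} \<le> moment24 * (t - s) ^ 12 / x ^ 24"
proof -
  interpret prob_space M using bm by (simp add: brownian_motion_def)
  have [measurable]: "\<beta> s \<in> borel_measurable M" "\<beta> t \<in> borel_measurable M"
    using bm st by (auto simp: brownian_motion_def)
  define \<sigma> where "\<sigma> = sqrt (t - s)"
  have \<sigma>: "0 < \<sigma>" "\<sigma>\<^sup>2 = t - s" using st by (auto simp: \<sigma>_def)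
  have D: "distributed M lborel (\<lambda>\<omega>. \<beta> t \<omega> - \<beta> s \<omega>) (normal_density 0 \<sigma>)"
    using bm st by (auto simp: brownian_motion_def \<sigma>_def)
  have h: "has_bochner_integral lborel (\<lambda>y. normal_density 0 \<sigma> y * y ^ 24) (moment24 * (t - s) ^ 12)"
    using normal_moment_even[OF \<sigma>(1), of 0 12] \<sigma>
    by (simp add: moment24_def power_divide)
  have int: "integrable M (\<lambda>\<omega>. (\<beta> t \<omega> - \<beta> s \<omega>) ^ 24)"
    using distributed_integrable[OF D, of "\<lambda>y. y ^ 24"] h by (simp add: has_bochner_integral_iff)
  have E: "expectation (\<lambda>\<omega>. (\<beta> t \<omega> - \<beta> s \<omega>) ^ 24) = moment24 * (t - s) ^ 12"
    using distributed_integral[OF D, of "\<lambda>y. y ^ 24"] h by (simp add: has_bochner_integral_iff)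
  have "prob {\<omega> \<in> space M. x < \<bar>\<beta> t \<omega> - \<beta> s \<omega>\<bar>} \<le> prob {\<omega> \<in> space M. x ^ 24 \<le> (\<beta> t \<omega> - \<beta> s \<omega>) ^ 24}"
  proof (intro finite_measure_mono subsetI, clarsimp)
    fix \<omega> assume "x < \<bar>\<beta> t \<omega> - \<beta> s \<omega>\<bar>"
    hence "x ^ 24 \<le> \<bar>\<beta> t \<omega> - \<beta> s \<omega>\<bar> ^ 24" using x by (intro power_mono) auto
    thus "x ^ 24 \<le> (\<beta> t \<omega> - \<beta> s \<omega>) ^ 24" by simp
  qed measurable
  also have "\<dots> \<le> (\<integral>\<omega>. (\<beta> t \<omega> - \<beta> s \<omega>) ^ 24 \<partial>M) / x ^ 24"
    using int x by (intro integral_Markov_inequality_measure[where A = "space M"]) auto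
  finally show ?thesis by (simp add: E)
qed

text \<open>The window lies within distance \<open>D * (t - s)\<close> of 0, so the Gaussian
  exponent is at most \<open>D\<^sup>2 / 2\<close> for every length up to 1. The bound is
  proportional to the width of the window, with a constant that survives the refinement of the
  blocks.\<close>

lemma brownian_increment_window:
  assumes bm: "brownian_motion M \<beta>" and st: "0 \<le> s" "s < t" and y: "0 < \<kappa>" "\<bar>y\<bar> + \<kappa> \<le> D * (t - s)"
    and t: "t - s \<le> 1"
  shows "2 * \<kappa> * (exp (- (D\<^sup>2 / 2)) / sqrt (2 * pi))
      \<le> measure M {\<omega> \<in> space M. \<bar>\<beta> t \<omega> - \<beta> s \<omega> - y\<bar> \<le> \<kappa>}"
proof -
  interpret prob_space M using bm by (simp add: brownian_motion_def)
  define \<sigma> where "\<sigma> = sqrt (t - s)"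
  have \<sigma>: "0 < \<sigma>" "\<sigma>\<^sup>2 = t - s" using st by (auto simp: \<sigma>_def)
  have D: "distributed M lborel (\<lambda>\<omega>. \<beta> t \<omega> - \<beta> s \<omega>) (normal_density 0 \<sigma>)"
    using bm st by (auto simp: brownian_motion_def \<sigma>_def)
  have D0: "0 \<le> D" using y st by (smt (verit) mult_neg_pos)
  let ?c = "exp (- (D\<^sup>2 / 2)) / sqrt (2 * pi)"
  have dens: "?c \<le> normal_density 0 \<sigma> v" if v: "v \<in> {y - \<kappa>..y + \<kappa>}" for v
  proof -
    have "\<bar>v\<bar> \<le> D * (t - s)" using v y by auto
    hence "v\<^sup>2 \<le> (D * (t - s))\<^sup>2" by (meson abs_le_square_iff abs_ge_self order_trans)
    also have "\<dots> = D\<^sup>2 * (t - s) * (t - s)" by (simp add: power2_eq_square)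
    also have "\<dots> \<le> D\<^sup>2 * 1 * (t - s)" using t st by (intro mult_right_mono mult_left_mono) auto
    finally have "v\<^sup>2 \<le> D\<^sup>2 * \<sigma>\<^sup>2" by (simp add: \<sigma>(2))
    hence "v\<^sup>2 / (2 * \<sigma>\<^sup>2) \<le> D\<^sup>2 / 2" using \<sigma>(1) by (simp add: field_simps)
    hence e: "exp (- (D\<^sup>2 / 2)) \<le> exp (- v\<^sup>2 / (2 * \<sigma>\<^sup>2))" by simp
    have "sqrt (2 * pi * \<sigma>\<^sup>2) \<le> sqrt (2 * pi)" using t \<sigma> by simp
    hence "?c \<le> exp (- v\<^sup>2 / (2 * \<sigma>\<^sup>2)) / sqrt (2 * pi * \<sigma>\<^sup>2)"
      using e \<sigma>(1) by (intro frac_le) auto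
    thus ?thesis by (simp add: normal_density_def)
  qed
  have "{\<omega> \<in> space M. \<bar>\<beta> t \<omega> - \<beta> s \<omega> - y\<bar> \<le> \<kappa>} = (\<lambda>\<omega>. \<beta> t \<omega> - \<beta> s \<omega>) -` {y - \<kappa>..y + \<kappa>} \<inter> space M"
    by auto
  hence "emeasure M {\<omega> \<in> space M. \<bar>\<beta> t \<omega> - \<beta> s \<omega> - y\<bar> \<le> \<kappa>}
      = (\<integral>\<^sup>+v. ennreal (normal_density 0 \<sigma> v) * indicator {y - \<kappa>..y + \<kappa>} v \<partial>lborel)"
    using distributed_emeasure[OF D, of "{y - \<kappa>..y + \<kappa>}"] by simp
  also have "\<dots> \<ge> (\<integral>\<^sup>+v. ennreal ?c * indicator {y - \<kappa>..y + \<kappa>} v \<partial>lborel)"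
    using dens by (intro nn_integral_mono) (auto split: split_indicator intro!: ennreal_leI)
  also have "(\<integral>\<^sup>+v. ennreal ?c * indicator {y - \<kappa>..y + \<kappa>} v \<partial>lborel) = ennreal (2 * \<kappa> * ?c)"
    using y by (subst nn_integral_cmult_indicator) (auto simp flip: ennreal_mult'' simp: mult_ac)
  finally show ?thesis
    by (simp add: emeasure_eq_measure ennreal_le_iff)
qed

text \<open>The thresholds of all levels add up to \<open>x\<close>. Their ratio 4/5 exceeds 1/sqrt
  2, the ratio of typical Brownian increments, so that violations become rarer with the
  level.\<close>

definition dyadic_small :: "(real \<Rightarrow> real) \<Rightarrow> real \<Rightarrow> real \<Rightarrow> real \<Rightarrow> nat \<Rightarrow> bool" where
  "dyadic_small f s L x j \<longleftrightarrow>
     (\<forall>l<2 ^ j. \<bar>f (s + real (Suc l) * L / 2 ^ j) - f (s + real l * L / 2 ^ j)\<bar> \<le> x / 5 * (4 / 5) ^ j)"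

text \<open>A dyadic point of odd index is one increment away from a point of the previous level.\<close>

lemma dyadic_small_sum:
  assumes "\<And>j. j \<le> J \<Longrightarrow> dyadic_small f s L x j" "0 \<le> x" "i \<le> 2 ^ J"
  shows "\<bar>f (s + real i * L / 2 ^ J) - f s\<bar> \<le> (\<Sum>j\<le>J. x / 5 * (4 / 5) ^ j)"
  using assms
proof (induction J arbitrary: i)
  case 0
  then have "i = 0 \<or> i = 1" by auto
  then show ?case using 0(1)[of 0] 0(2) by (auto simp: dyadic_small_def)
next
  case (Suc J)
  have IH: "\<bar>f (s + real i * L / 2 ^ J) - f s\<bar> \<le> (\<Sum>j\<le>J. x / 5 * (4 / 5) ^ j)" if "i \<le> 2 ^ J" for i
    using Suc.IH[of i] Suc.prems that by auto
  have x: "0 \<le> x / 5 * (4 / 5) ^ Suc J" using Suc.prems by simp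
  show ?case
  proof (cases "even i")
    case True
    then obtain k where k: "i = 2 * k" by blast
    then have "\<bar>f (s + real i * L / 2 ^ Suc J) - f s\<bar> \<le> (\<Sum>j\<le>J. x / 5 * (4 / 5) ^ j)"
      using IH[of k] Suc.prems(3) by simp
    then show ?thesis using x by simp
  next
    case False
    then obtain k where k: "i = Suc (2 * k)" by (auto elim: oddE)
    have k2: "k < 2 ^ J" using Suc.prems(3) k by auto
    have "\<bar>f (s + real (2 * k) * L / 2 ^ Suc J) - f s\<bar> \<le> (\<Sum>j\<le>J. x / 5 * (4 / 5) ^ j)"
      using IH[of k] k2 by simp
    moreover have "\<bar>f (s + real i * L / 2 ^ Suc J) - f (s + real (2 * k) * L / 2 ^ Suc J)\<bar>
        \<le> x / 5 * (4 / 5) ^ Suc J"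
    proof -
      have "2 * k < 2 ^ Suc J" using k2 by simp
      thus ?thesis using Suc.prems(1)[of "Suc J"] unfolding dyadic_small_def k by blast
    qed
    ultimately show ?thesis unfolding sum.atMost_Suc by linarith
  qed
qed

lemma geometric_sum_le: "0 \<le> x \<Longrightarrow> (\<Sum>j\<le>J. x / 5 * (4 / 5) ^ j) \<le> (x :: real)"
proof -
  assume x: "0 \<le> x"
  have "(\<Sum>j\<le>J. x / 5 * (4 / 5) ^ j) = x * (1 - (4 / 5) ^ Suc J)"
    unfolding sum_distrib_left[symmetric] by (subst sum_gp0) simp
  also have "\<dots> \<le> x" using x by (intro mult_left_le) auto
  finally show ?thesis .
qed

text \<open>The left neighbours \<open>r J\<close> of \<open>t\<close> on the dyadic grids converge
  to \<open>t\<close>, so continuity carries the bound from grid points to all times.\<close>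

lemma dyadic_small_continuous:
  assumes f: "continuous_on {s..s + L} f" and x: "0 \<le> x" and L: "0 < L"
    and small: "\<And>j. dyadic_small f s L x j" and t: "t \<in> {s..s + L}"
  shows "\<bar>f t - f s\<bar> \<le> x"
proof -
  define i where "i J = nat \<lfloor>(t - s) / L * 2 ^ J\<rfloor>" for J :: nat
  define r where "r J = s + real (i J) * L / 2 ^ J" for J
  have ts: "0 \<le> (t - s) / L" "(t - s) / L \<le> 1" using t L by (auto simp: field_simps)
  have i1: "real (i J) \<le> (t - s) / L * 2 ^ J" and i2: "(t - s) / L * 2 ^ J - 1 \<le> real (i J)" for J
  proof -
    define X where "X = (t - s) / L * 2 ^ J"
    have "0 \<le> X" unfolding X_def using ts(1) by (intro mult_nonneg_nonneg) auto
    hence "real (nat \<lfloor>X\<rfloor>) \<le> X" "X - 1 \<le> real (nat \<lfloor>X\<rfloor>)" by linarith+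
    thus "real (i J) \<le> (t - s) / L * 2 ^ J" "(t - s) / L * 2 ^ J - 1 \<le> real (i J)"
      by (simp_all add: i_def X_def)
  qed
  have i_le: "i J \<le> 2 ^ J" for J
  proof -
    have "real (i J) \<le> 1 * 2 ^ J"
      using i1[of J] mult_right_mono[OF ts(2), of "2 ^ J"] by (rule order_trans) simp
    hence "real (i J) \<le> real (2 ^ J)" by simp
    thus ?thesis unfolding of_nat_le_iff .
  qed
  have r1: "r J \<le> t" and r2: "t - L * (1 / 2) ^ J \<le> r J" and r3: "s \<le> r J" for J
  proof -
    have "real (i J) * L / 2 ^ J \<le> t - s" using i1[of J] L by (simp add: field_simps)
    moreover have "(t - s) / L - 1 / 2 ^ J \<le> real (i J) / 2 ^ J"
      using divide_right_mono[OF i2[of J], of "2 ^ J"] by (simp add: diff_divide_distrib)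
    hence "((t - s) / L - 1 / 2 ^ J) * L \<le> real (i J) / 2 ^ J * L"
      using L by (intro mult_right_mono) auto
    hence "t - s - L * (1 / 2) ^ J \<le> real (i J) * L / 2 ^ J"
    proof -
      have "((t - s) / L - 1 / 2 ^ J) * L = t - s - L * (1 / 2) ^ J"
      proof -
        have "(t - s) / L * L = t - s" using L by simp
        thus ?thesis unfolding left_diff_distrib[of "(t - s) / L"] by (simp add: power_one_over)
      qed
      thus ?thesis using \<open>((t - s) / L - 1 / 2 ^ J) * L \<le> real (i J) / 2 ^ J * L\<close> by (simp add: mult.commute)
    qed
    ultimately show "r J \<le> t" "t - L * (1 / 2) ^ J \<le> r J" "s \<le> r J"
      using L by (auto simp: r_def)
  qed
  have "(\<lambda>J. L * (1 / 2) ^ J) \<longlonglongrightarrow> L * 0" by (intro tendsto_intros) auto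
  hence "r \<longlonglongrightarrow> t"
    using r1 r2 tendsto_diff[OF tendsto_const, of "\<lambda>J. L * (1 / 2) ^ J" 0 sequentially t]
    by (intro tendsto_sandwich[of "\<lambda>J. t - L * (1 / 2) ^ J" r _ "\<lambda>_. t"]) auto
  hence "(\<lambda>J. f (r J)) \<longlonglongrightarrow> f t"
  proof (rule continuous_on_tendsto_compose[OF f])
    have "r J \<in> {s..s + L}" for J using r1[of J] r3[of J] t by auto
    thus "\<forall>\<^sub>F J in sequentially. r J \<in> {s..s + L}" by simp
  qed (use t in auto)
  moreover have "\<bar>f (r J) - f s\<bar> \<le> x" for J
    using dyadic_small_sum[of J f s L x "i J"] small x i_le geometric_sum_le[OF x, of J]
    unfolding r_def by force
  ultimately show ?thesis
    by (intro LIMSEQ_le_const2[of "\<lambda>J. \<bar>f (r J) - f s\<bar>"] tendsto_intros) auto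
qed

text \<open>\<open>5 ^ 24\<close> stems from the threshold \<open>x / 5\<close>, the factor 2 from a
  geometric series over the levels.\<close>

definition dev_const :: real where "dev_const = 2 * 5 ^ 24 * moment24"

lemma dev_const_pos: "0 < dev_const"
  by (simp add: dev_const_def moment24_pos)

text \<open>A union bound over increments and levels, uniform in \<open>J\<close>. By Brownian
  scaling only the ratio \<open>L / x\<^sup>2\<close> enters.\<close>

lemma brownian_dyadic_small:
  assumes bm: "brownian_motion M \<beta>" and s: "0 \<le> s" and L: "0 < L" and x: "0 < x"
  shows "measure M {\<omega> \<in> space M. \<not> (\<forall>j\<le>J. dyadic_small (\<lambda>t. \<beta> t \<omega>) s L x j)}
     \<le> dev_const * (L / x\<^sup>2) ^ 12"
proof -
  interpret prob_space M using bm by (simp add: brownian_motion_def)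
  have [measurable]: "0 \<le> t \<Longrightarrow> \<beta> t \<in> borel_measurable M" for t
    using bm by (auto simp: brownian_motion_def)
  define p where "p j l = s + real l * L / 2 ^ j" for j l :: nat
  define B where "B j l = {\<omega> \<in> space M. x / 5 * (4 / 5) ^ j < \<bar>\<beta> (p j (Suc l)) \<omega> - \<beta> (p j l) \<omega>\<bar>}" for j l
  have p: "0 \<le> p j l" "p j l < p j (Suc l)" "p j (Suc l) - p j l = L / 2 ^ j" for j l
    using s L by (auto simp: p_def field_simps)
  have [measurable]: "B j l \<in> sets M" for j l
    unfolding B_def using p(1) by measurable
  \<comment> \<open>Per level: twice as many increments, a 24th moment smaller by the factor
    \<open>(1 / 2) ^ 12\<close>, and a threshold smaller by the factor 4/5.\<close>
  define q :: real where "q = 2 * (1 / 2) ^ 12 * (5 / 4) ^ 24"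
  have q: "0 \<le> q" "q \<le> 1 / 2" by (simp_all add: q_def field_simps)
  have B: "prob (B j l) \<le> moment24 * 5 ^ 24 * (L / x\<^sup>2) ^ 12 * ((1 / 2) ^ 12 * (5 / 4) ^ 24) ^ j" for j l
  proof -
    have "prob (B j l) \<le> moment24 * (L / 2 ^ j) ^ 12 / (x / 5 * (4 / 5) ^ j) ^ 24"
      unfolding B_def using brownian_increment_tail[OF bm p(1,2), of "x / 5 * (4 / 5) ^ j" j l] x
      by (simp add: p(3))
    also have "\<dots> = moment24 * 5 ^ 24 * (L / x\<^sup>2) ^ 12 * ((1 / 2) ^ 12 * (5 / 4) ^ 24) ^ j"
    proof -
      have 1: "(L / 2 ^ j) ^ 12 = L ^ 12 * ((1 / 2) ^ 12) ^ j"
        unfolding power_mult[symmetric] mult.commute[of 12]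
        by (simp only: power_divide power_one power_mult[symmetric] times_divide_eq_right mult_1_right)
      have "(4 / 5 :: real) ^ 24 = inverse ((5 / 4) ^ 24)"
        unfolding power_inverse[symmetric] by simp
      hence "((4 / 5 :: real) ^ j) ^ 24 = inverse (((5 / 4) ^ 24) ^ j)"
        unfolding power_mult[symmetric] mult.commute[of j] by (simp only: power_mult power_inverse)
      hence 2: "(x / 5 * (4 / 5) ^ j) ^ 24 = x ^ 24 / 5 ^ 24 / ((5 / 4) ^ 24) ^ j"
        unfolding power_mult_distrib power_divide[of x] by (simp only: divide_inverse)
      have 3: "(L / x\<^sup>2) ^ 12 = L ^ 12 / x ^ 24"
        by (simp add: power_divide flip: power_mult)
      have "m * (l * a) / (X / F / G) = m * F * (l / X) * (a * G)"
        if "X \<noteq> 0" "F \<noteq> 0" "G \<noteq> 0" for m l a X F G :: real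
        using that by (simp add: field_simps)
      from this[of "x ^ 24" "5 ^ 24" "((5 / 4) ^ 24) ^ j"] show ?thesis
        unfolding 1 2 3 unfolding power_mult_distrib using x by (simp del: power_divide)
    qed
    finally show ?thesis .
  qed
  have "{\<omega> \<in> space M. \<not> (\<forall>j\<le>J. dyadic_small (\<lambda>t. \<beta> t \<omega>) s L x j)} = (\<Union>j\<in>{..J}. \<Union>l\<in>{..<2 ^ j}. B j l)"
    by (auto simp: dyadic_small_def B_def p_def not_le)
  hence "prob {\<omega> \<in> space M. \<not> (\<forall>j\<le>J. dyadic_small (\<lambda>t. \<beta> t \<omega>) s L x j)}
      \<le> (\<Sum>j\<le>J. prob (\<Union>l\<in>{..<2 ^ j}. B j l))"
    by (simp only:) (intro measure_UNION_le; measurable)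
  also have "\<dots> \<le> (\<Sum>j\<le>J. \<Sum>l<2 ^ j. prob (B j l))"
    by (intro sum_mono measure_UNION_le) auto
  also have "\<dots> \<le> (\<Sum>j\<le>J. \<Sum>l<(2::nat) ^ j. moment24 * 5 ^ 24 * (L / x\<^sup>2) ^ 12 * ((1 / 2) ^ 12 * (5 / 4) ^ 24) ^ j)"
    by (intro sum_mono B)
  also have "\<dots> = moment24 * 5 ^ 24 * (L / x\<^sup>2) ^ 12 * (\<Sum>j\<le>J. q ^ j)"
    unfolding q_def power_mult_distrib sum_distrib_left
    by (intro sum.cong refl) (simp add: mult_ac)
  also have "\<dots> \<le> moment24 * 5 ^ 24 * (L / x\<^sup>2) ^ 12 * 2"
  proof (rule mult_left_mono)
    have "(\<Sum>j\<le>J. q ^ j) \<le> (\<Sum>j\<le>J. (1 / 2) ^ j)"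
      using q by (intro sum_mono power_mono) auto
    also have "\<dots> = 2 * (1 - (1 / 2) ^ Suc J)" by (subst sum_gp0) simp
    also have "\<dots> \<le> 2" by simp
    finally show "(\<Sum>j\<le>J. q ^ j) \<le> 2" .
  qed (use L moment24_pos in simp)
  finally show ?thesis by (simp add: dev_const_def mult_ac)
qed

text \<open>On each of \<open>K\<close> blocks of length \<open>L\<close> the path oscillates by at most \<open>x\<close> and its increment
  differs by at most \<open>\<kappa>\<close> from that of \<open>t \<mapsto> a t\<close>; dyadic levels above \<open>J\<close> are not constrained.\<close>

definition block_ok :: "nat \<Rightarrow> real \<Rightarrow> real \<Rightarrow> real \<Rightarrow> real \<Rightarrow> nat \<Rightarrow> (real \<Rightarrow> real) \<Rightarrow> bool" where
  "block_ok J a L x \<kappa> i f \<longleftrightarrow> (\<forall>j\<le>J. dyadic_small f (real i * L) L x j)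
     \<and> \<bar>f (real (Suc i) * L) - f (real i * L) - a * L\<bar> \<le> \<kappa>"

definition tame_path :: "real \<Rightarrow> real \<Rightarrow> nat \<Rightarrow> real \<Rightarrow> real \<Rightarrow> (real \<Rightarrow> real) \<Rightarrow> bool" where
  "tame_path a L K x \<kappa> f \<longleftrightarrow> (\<forall>J. \<forall>i<K. block_ok J a L x \<kappa> i f)"

lemma tame_path_blocks:
  assumes g: "\<And>i. i < K \<Longrightarrow> \<bar>g (Suc i) - g i :: real\<bar> \<le> \<kappa>" and ij: "i \<le> j" "j \<le> K" and "0 \<le> \<kappa>"
  shows "\<bar>g j - g i\<bar> \<le> \<kappa> * real (j - i)"
  using ij
proof (induction j rule: dec_induct)
  case (step j)
  have "\<bar>g j - g i\<bar> \<le> \<kappa> * real (j - i)" using step by auto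
  moreover have "\<bar>g (Suc j) - g j\<bar> \<le> \<kappa>" using g[of j] step by auto
  moreover have "\<kappa> * real (Suc j - i) = \<kappa> * real (j - i) + \<kappa>"
    using step by (simp add: Suc_diff_le algebra_simps)
  ultimately show ?case by linarith
qed simp

text \<open>Rounding \<open>s\<close> and \<open>t\<close> down to block boundaries costs
  \<open>x + \<bar>a\<bar> * L\<close> each; the blocks in between, at most
  \<open>(t - s) / L + 1\<close> of them, cost \<open>\<kappa>\<close> each.\<close>

lemma tame_path_increment:
  assumes tame: "tame_path a L K x \<kappa> f" and f: "continuous_on {0..} f"
    and L: "0 < L" and x: "0 \<le> x" and \<kappa>: "0 \<le> \<kappa>" and st: "0 \<le> s" "s \<le> t" "t \<le> real K * L"
  shows "\<bar>(f t - a * t) - (f s - a * s)\<bar> \<le> 2 * (x + \<bar>a\<bar> * L) + \<kappa> + \<kappa> / L * (t - s)"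
proof -
  define g where "g i = f (real i * L) - a * (real i * L)" for i :: nat
  have near: "\<exists>i\<le>K. real i * L \<le> r \<and> r \<le> real i * L + L \<and> \<bar>(f r - a * r) - g i\<bar> \<le> x + \<bar>a\<bar> * L
      \<and> real i = of_int \<lfloor>r / L\<rfloor>"
    if r: "0 \<le> r" "r \<le> real K * L" for r
  proof -
    define i where "i = nat \<lfloor>r / L\<rfloor>"
    have "0 \<le> r / L" using r L by simp
    hence i: "real i = of_int \<lfloor>r / L\<rfloor>" by (simp add: i_def)
    have 1: "real i * L \<le> r" "r \<le> real i * L + L"
    proof -
      have "real i \<le> r / L" "r / L \<le> real i + 1" using i floor_correct[of "r / L"] by linarith+
      thus "real i * L \<le> r" "r \<le> real i * L + L" using L by (simp_all add: field_simps)
    qed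
    have "r / L \<le> real K" using r L by (simp add: field_simps)
    hence "i \<le> K" using i by linarith
    have "\<bar>f r - f (real i * L)\<bar> \<le> x"
    proof (cases "i = K")
      case True
      thus ?thesis using 1 r x by simp
    next
      case False
      hence "dyadic_small f (real i * L) L x j" for j
      proof -
        have "block_ok j a L x \<kappa> i f" using tame \<open>i \<le> K\<close> False by (auto simp: tame_path_def)
        thus ?thesis unfolding block_ok_def by blast
      qed
      moreover have "continuous_on {real i * L..real i * L + L} f"
        using L by (intro continuous_on_subset[OF f]) (auto intro: order_trans[of _ "real i * L"])
      ultimately show ?thesis using 1 by (intro dyadic_small_continuous[OF _ x L]) auto
    qed
    moreover have "\<bar>a * r - a * (real i * L)\<bar> \<le> \<bar>a\<bar> * L"
      using 1 by (simp add: abs_mult mult_left_mono flip: right_diff_distrib)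
    ultimately show ?thesis using i 1 \<open>i \<le> K\<close> unfolding g_def by (intro exI[of _ i]) linarith
  qed
  obtain i where i: "i \<le> K" "real i * L \<le> s" "s \<le> real i * L + L" "\<bar>(f s - a * s) - g i\<bar> \<le> x + \<bar>a\<bar> * L"
    "real i = of_int \<lfloor>s / L\<rfloor>"
    using near[of s] st by auto
  obtain j where j: "j \<le> K" "real j * L \<le> t" "t \<le> real j * L + L" "\<bar>(f t - a * t) - g j\<bar> \<le> x + \<bar>a\<bar> * L"
    "real j = of_int \<lfloor>t / L\<rfloor>"
    using near[of t] st by auto
  have "s / L \<le> t / L" using st L by (simp add: divide_right_mono)
  hence ij: "i \<le> j" using i(5) j(5) floor_mono[of "s / L" "t / L"] by linarith
  have "\<bar>g (Suc k) - g k\<bar> \<le> \<kappa>" if "k < K" for k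
  proof -
    have "g (Suc k) - g k = f (real (Suc k) * L) - f (real k * L) - a * L"
      by (simp add: g_def algebra_simps)
    thus ?thesis using tame that by (auto simp: tame_path_def block_ok_def)
  qed
  hence "\<bar>g j - g i\<bar> \<le> \<kappa> * real (j - i)" using ij j(1) \<kappa> by (rule tame_path_blocks)
  also have "real (j - i) * L \<le> t - s + L" using ij i j by (simp add: of_nat_diff left_diff_distrib)
  hence "real (j - i) \<le> (t - s) / L + 1" using L by (simp add: field_simps)
  hence "\<kappa> * real (j - i) \<le> \<kappa> * ((t - s) / L + 1)" using \<kappa> by (intro mult_left_mono)
  also have "\<dots> = \<kappa> + \<kappa> / L * (t - s)" by (simp add: algebra_simps)
  finally have "\<bar>g j - g i\<bar> \<le> \<kappa> + \<kappa> / L * (t - s)" .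
  moreover have "\<bar>p - q\<bar> \<le> 2 * y + w" if "\<bar>p - u\<bar> \<le> y" "\<bar>q - v\<bar> \<le> y" "\<bar>u - v\<bar> \<le> w"
    for p q u v y w :: real
    using that by linarith
  ultimately show ?thesis using i(4) j(4) unfolding add.assoc[of _ \<kappa>] by blast
qed

section \<open>Measurability and probability of tame paths\<close>

lemma measurable_block_ok:
  assumes "\<And>t. 0 \<le> t \<Longrightarrow> (\<lambda>\<omega>. \<beta> \<omega> t) \<in> borel_measurable M" "0 \<le> L"
  shows "Measurable.pred M (\<lambda>\<omega>. block_ok J a L x \<kappa> i (\<beta> \<omega>))"
proof -
  have [measurable]: "(\<lambda>\<omega>. \<beta> \<omega> (real i * L)) \<in> borel_measurable M"
    "(\<lambda>\<omega>. \<beta> \<omega> (real (Suc i) * L)) \<in> borel_measurable M"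
    "(\<lambda>\<omega>. \<beta> \<omega> (real i * L + real l * L / 2 ^ j)) \<in> borel_measurable M" for l j
    using assms by auto
  show ?thesis unfolding block_ok_def dyadic_small_def by measurable
qed

lemma measurable_tame_path:
  assumes "\<And>t. 0 \<le> t \<Longrightarrow> (\<lambda>\<omega>. \<beta> \<omega> t) \<in> borel_measurable M" "0 \<le> L"
  shows "Measurable.pred M (\<lambda>\<omega>. tame_path a L K x \<kappa> (\<beta> \<omega>))"
proof -
  note [measurable] = measurable_block_ok[OF assms]
  show ?thesis unfolding tame_path_def by measurable
qed

text \<open>The events for finite \<open>J\<close> decrease to the tame event, so a bound uniform in
  \<open>J\<close> passes to the limit.\<close>

lemma tame_path_prob_limit:
  assumes bm: "brownian_motion M \<beta>" and L: "0 \<le> L"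
    and p: "\<And>J. p \<le> measure M {\<omega> \<in> space M. \<forall>i<K. block_ok J a L x \<kappa> i (\<lambda>t. \<beta> t \<omega>)}"
  shows "p \<le> measure M {\<omega> \<in> space M. tame_path a L K x \<kappa> (\<lambda>t. \<beta> t \<omega>)}"
proof -
  interpret prob_space M using bm by (simp add: brownian_motion_def)
  define A where "A J = {\<omega> \<in> space M. \<forall>i<K. block_ok J a L x \<kappa> i (\<lambda>t. \<beta> t \<omega>)}" for J
  have [measurable]: "Measurable.pred M (\<lambda>\<omega>. block_ok J a L x \<kappa> i (\<lambda>t. \<beta> t \<omega>))" for J i
    using bm L by (intro measurable_block_ok) (auto simp: brownian_motion_def)
  have "A J \<in> sets M" for J unfolding A_def by measurable
  moreover have "decseq A" by (rule decseq_SucI) (auto simp: A_def block_ok_def)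
  ultimately have "(\<lambda>J. prob (A J)) \<longlonglongrightarrow> prob (\<Inter>J. A J)"
    by (intro finite_Lim_measure_decseq) auto
  moreover have "(\<Inter>J. A J) = {\<omega> \<in> space M. tame_path a L K x \<kappa> (\<lambda>t. \<beta> t \<omega>)}"
    by (auto simp: A_def tame_path_def)
  ultimately show ?thesis using p unfolding A_def[symmetric] by (auto intro: LIMSEQ_le_const)
qed

text \<open>Without drift and with \<open>\<kappa> = x\<close>, the condition on the block increment
  follows from dyadic level 0, and a union bound over the blocks remains.\<close>

lemma tame_path_prob_no_drift:
  assumes bm: "brownian_motion M \<beta>" and L: "0 < L" and x: "0 < x"
  shows "1 - real K * (dev_const * (L / x\<^sup>2) ^ 12)
    \<le> measure M {\<omega> \<in> space M. tame_path 0 L K x x (\<lambda>t. \<beta> t \<omega>)}"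
proof (rule tame_path_prob_limit[OF bm])
  interpret prob_space M using bm by (simp add: brownian_motion_def)
  fix J
  define B where "B i = {\<omega> \<in> space M. \<not> (\<forall>j\<le>J. dyadic_small (\<lambda>t. \<beta> t \<omega>) (real i * L) L x j)}" for i
  have [measurable]: "Measurable.pred M (\<lambda>\<omega>. block_ok J 0 L x x i (\<lambda>t. \<beta> t \<omega>))" for i
    using bm L by (intro measurable_block_ok) (auto simp: brownian_motion_def)
  have [measurable]: "(\<lambda>\<omega>. \<beta> (real i * L + real l * L / 2 ^ j) \<omega>) \<in> borel_measurable M" for i l j :: nat
    using bm L by (auto simp: brownian_motion_def)
  have [measurable]: "B i \<in> sets M" for i unfolding B_def dyadic_small_def by measurable
  have eq: "block_ok J 0 L x x i f \<longleftrightarrow> (\<forall>j\<le>J. dyadic_small f (real i * L) L x j)" for i f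
  proof -
    have "\<bar>f (real (Suc i) * L) - f (real i * L)\<bar> \<le> x" if "dyadic_small f (real i * L) L x 0"
      using that x by (auto simp: dyadic_small_def algebra_simps)
    thus ?thesis by (auto simp: block_ok_def)
  qed
  have "space M - {\<omega> \<in> space M. \<forall>i<K. block_ok J 0 L x x i (\<lambda>t. \<beta> t \<omega>)} = (\<Union>i<K. B i)"
    unfolding eq by (auto simp: B_def)
  moreover have "prob (\<Union>i<K. B i) \<le> (\<Sum>i<K. prob (B i))" by (intro measure_UNION_le) auto
  moreover have "(\<Sum>i<K. prob (B i)) \<le> (\<Sum>i<K. dev_const * (L / x\<^sup>2) ^ 12)"
    unfolding B_def using L x by (intro sum_mono brownian_dyadic_small[OF bm]) auto
  moreover have "prob (space M - {\<omega> \<in> space M. \<forall>i<K. block_ok J 0 L x x i (\<lambda>t. \<beta> t \<omega>)})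
      = 1 - prob {\<omega> \<in> space M. \<forall>i<K. block_ok J 0 L x x i (\<lambda>t. \<beta> t \<omega>)}"
    by (intro prob_compl) measurable
  ultimately show "1 - real K * (dev_const * (L / x\<^sup>2) ^ 12)
      \<le> prob {\<omega> \<in> space M. \<forall>i<K. block_ok J 0 L x x i (\<lambda>t. \<beta> t \<omega>)}"
    by simp
qed (use L in simp)

text \<open>At level \<open>J\<close> each block is a function of its own increments over a grid of mesh \<open>L / 2\<^sup>J\<close>, so
  that the blocks are independent.\<close>

lemma block_ok_indep:
  assumes bm: "brownian_motion M \<beta>" and L: "0 < L"
  shows "measure M {\<omega> \<in> space M. \<forall>i<K. block_ok J a L x \<kappa> i (\<lambda>t. \<beta> t \<omega>)}
    = (\<Prod>i<K. measure M {\<omega> \<in> space M. block_ok J a L x \<kappa> i (\<lambda>t. \<beta> t \<omega>)})"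
proof (cases "K = 0")
  case True
  interpret prob_space M using bm by (simp add: brownian_motion_def)
  show ?thesis using True prob_space by simp
next
  case False
  interpret prob_space M using bm by (simp add: brownian_motion_def)
  define G where "G = (2::nat) ^ J"
  define \<tau> where "\<tau> m = real m * L / 2 ^ J" for m :: nat
  define D where "D m \<omega> = \<beta> (\<tau> (Suc m)) \<omega> - \<beta> (\<tau> m) \<omega>" for m \<omega>
  define I where "I i = {i * G..<Suc i * G}" for i
  have G: "0 < G" by (simp add: G_def)
  have "mono \<tau>" using L by (auto simp: \<tau>_def mono_def divide_right_mono)
  moreover have "0 \<le> \<tau> 0" by (simp add: \<tau>_def)
  ultimately have ind: "indep_vars (\<lambda>_. borel) D {..<K * G}"
    using bm unfolding brownian_motion_def D_def by blast
  have Isub: "I i \<subseteq> {..<K * G}" if "i < K" for i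
  proof -
    have "Suc i * G \<le> K * G" using that by (intro mult_right_mono) auto
    thus ?thesis by (auto simp: I_def)
  qed
  have Idisj: "disjoint_family_on I {..<K}"
    unfolding disjoint_family_on_def
  proof (intro ballI impI)
    fix i j :: nat assume "i \<noteq> j"
    have "m div G = i" if "m \<in> I i" for m i
      using that G unfolding I_def by (intro div_nat_eqI) (auto simp: mult.commute)
    thus "I i \<inter> I j = {}" using \<open>i \<noteq> j\<close> by blast
  qed
  have ind2: "indep_vars (\<lambda>i. PiM (I i) (\<lambda>_. borel)) (\<lambda>i \<omega>. restrict (\<lambda>m. D m \<omega>) (I i)) {..<K}"
    by (rule indep_vars_restrict[OF ind Isub Idisj]) auto
  \<comment> \<open>Grid indices of the \<open>l\<close>-th interval of level \<open>j\<close>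
    inside block \<open>i\<close>; the grid increments over them telescope to the increment of that
    interval.\<close>
  define seg where "seg i j l = {i * G + l * 2 ^ (J - j)..<i * G + Suc l * 2 ^ (J - j)}" for i j l :: nat
  define B where "B i = {d \<in> space (PiM (I i) (\<lambda>_. borel :: real measure)).
      (\<forall>j\<le>J. \<forall>l<2 ^ j. \<bar>\<Sum>m\<in>seg i j l. d m\<bar> \<le> x / 5 * (4 / 5) ^ j) \<and> \<bar>(\<Sum>m\<in>I i. d m) - a * L\<bar> \<le> \<kappa>}" for i
  have seg_sub: "seg i j l \<subseteq> I i" if "j \<le> J" "l < 2 ^ j" for i j l
  proof -
    have "Suc l * 2 ^ (J - j) \<le> 2 ^ j * 2 ^ (J - j)" using that by (intro mult_right_mono) auto
    hence "Suc l * 2 ^ (J - j) \<le> G" using that by (simp add: G_def flip: power_add)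
    thus ?thesis by (auto simp: seg_def I_def)
  qed
  have B[measurable]: "B i \<in> sets (PiM (I i) (\<lambda>_. borel))" for i
  proof -
    have 1: "(\<lambda>d. \<Sum>m\<in>I i. d m) \<in> borel_measurable (PiM (I i) (\<lambda>_. borel :: real measure))"
      by (intro borel_measurable_sum measurable_component_singleton)
    have 2: "Measurable.pred (PiM (I i) (\<lambda>_. borel :: real measure))
        (\<lambda>d. l < 2 ^ j \<longrightarrow> \<bar>\<Sum>m\<in>seg i j l. d m\<bar> \<le> x / 5 * (4 / 5) ^ j)" if "j \<le> J" for j l
    proof (cases "l < 2 ^ j")
      case True
      have [measurable]: "(\<lambda>d. \<Sum>m\<in>seg i j l. d m) \<in> borel_measurable (PiM (I i) (\<lambda>_. borel :: real measure))"
        using seg_sub[OF that True] by (intro borel_measurable_sum measurable_component_singleton) auto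
      show ?thesis by measurable
    qed simp
    have 3: "Measurable.pred (PiM (I i) (\<lambda>_. borel :: real measure))
        (\<lambda>d. j \<le> J \<longrightarrow> (\<forall>l<2 ^ j. \<bar>\<Sum>m\<in>seg i j l. d m\<bar> \<le> x / 5 * (4 / 5) ^ j))" for j
    proof (cases "j \<le> J")
      case True
      have "Measurable.pred (PiM (I i) (\<lambda>_. borel :: real measure))
          (\<lambda>d. \<forall>l. l < 2 ^ j \<longrightarrow> \<bar>\<Sum>m\<in>seg i j l. d m\<bar> \<le> x / 5 * (4 / 5) ^ j)"
        by (rule pred_intros_countable(1)[OF 2[OF True]])
      thus ?thesis using True by (simp only: simp_thms)
    next
      case False
      thus ?thesis by (simp only: simp_thms) measurable
    qed
    have 4: "Measurable.pred (PiM (I i) (\<lambda>_. borel :: real measure)) (\<lambda>d. \<bar>(\<Sum>m\<in>I i. d m) - a * L\<bar> \<le> \<kappa>)"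
    proof -
      note [measurable] = 1
      show ?thesis by measurable
    qed
    show ?thesis unfolding B_def
      by (rule predE[OF pred_intros_logic(3)[OF pred_intros_countable(1)[OF 3] 4]])
  qed
  have tele: "(\<Sum>m\<in>{p..<q}. D m \<omega>) = \<beta> (\<tau> q) \<omega> - \<beta> (\<tau> p) \<omega>" if "p \<le> q" for p q \<omega>
    using sum_Suc_diff'[OF that, of "\<lambda>m. \<beta> (\<tau> m) \<omega>"] by (simp add: D_def)
  have \<tau>1: "\<tau> (i * G + l * 2 ^ (J - j)) = real i * L + real l * L / 2 ^ j" if "j \<le> J" for i l j
  proof -
    have "(2::real) ^ J = 2 ^ j * 2 ^ (J - j)" using that by (simp flip: power_add)
    thus ?thesis by (simp add: \<tau>_def G_def field_simps)
  qed
  have \<tau>2: "\<tau> (i * G) = real i * L" for i by (simp add: \<tau>_def G_def)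
  have iff: "restrict (\<lambda>m. D m \<omega>) (I i) \<in> B i \<longleftrightarrow> block_ok J a L x \<kappa> i (\<lambda>t. \<beta> t \<omega>)" for i \<omega>
  proof -
    have 1: "(\<Sum>m\<in>I i. restrict (\<lambda>m. D m \<omega>) (I i) m) = \<beta> (real (Suc i) * L) \<omega> - \<beta> (real i * L) \<omega>"
    proof -
      have "i * G \<le> Suc i * G" by simp
      from tele[OF this, of \<omega>] show ?thesis unfolding \<tau>2 I_def[symmetric] by simp
    qed
    have 2: "(\<Sum>m\<in>seg i j l. restrict (\<lambda>m. D m \<omega>) (I i) m)
        = \<beta> (real i * L + real (Suc l) * L / 2 ^ j) \<omega> - \<beta> (real i * L + real l * L / 2 ^ j) \<omega>"
      if "j \<le> J" "l < 2 ^ j" for j l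
    proof -
      have "(\<Sum>m\<in>seg i j l. restrict (\<lambda>m. D m \<omega>) (I i) m) = (\<Sum>m\<in>seg i j l. D m \<omega>)"
        using seg_sub[OF that] by (intro sum.cong) auto
      also have "\<dots> = \<beta> (\<tau> (i * G + Suc l * 2 ^ (J - j))) \<omega> - \<beta> (\<tau> (i * G + l * 2 ^ (J - j))) \<omega>"
        unfolding seg_def by (rule tele) auto
      finally show ?thesis unfolding \<tau>1[OF that(1)] .
    qed
    have 3: "restrict (\<lambda>m. D m \<omega>) (I i) \<in> space (PiM (I i) (\<lambda>_. borel :: real measure))"
      by (simp add: space_PiM)
    show ?thesis unfolding B_def block_ok_def dyadic_small_def using 1 2 3 by auto
  qed
  have "prob (\<Inter>i\<in>{..<K}. (\<lambda>\<omega>. restrict (\<lambda>m. D m \<omega>) (I i)) -` B i \<inter> space M)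
      = (\<Prod>i<K. prob ((\<lambda>\<omega>. restrict (\<lambda>m. D m \<omega>) (I i)) -` B i \<inter> space M))"
    using False by (intro indep_varsD[OF ind2]) auto
  moreover have "(\<lambda>\<omega>. restrict (\<lambda>m. D m \<omega>) (I i)) -` B i \<inter> space M
      = {\<omega> \<in> space M. block_ok J a L x \<kappa> i (\<lambda>t. \<beta> t \<omega>)}" for i
    using iff by auto
  moreover have "(\<Inter>i\<in>{..<K}. {\<omega> \<in> space M. block_ok J a L x \<kappa> i (\<lambda>t. \<beta> t \<omega>)})
      = {\<omega> \<in> space M. \<forall>i<K. block_ok J a L x \<kappa> i (\<lambda>t. \<beta> t \<omega>)}"
    using False by auto
  ultimately show ?thesis by simp
qed

text \<open>With \<open>K\<close> blocks, the increment of one block hits its window with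
  probability of order 1/K, while its dyadic control fails with probability of order K^-12. For
  large \<open>K\<close> a block succeeds with positive probability \<open>p\<close>, and
  independence of the blocks gives \<open>p ^ K\<close>.\<close>

lemma tame_path_prob_drift:
  assumes bm: "brownian_motion M \<beta>" and T: "0 < T" and \<eta>: "0 < \<eta>"
  obtains K L x \<kappa> where "0 < L" "0 \<le> x" "0 \<le> \<kappa>" "T = real K * L"
    "2 * (x + \<bar>a\<bar> * L) + \<kappa> + \<kappa> / L * T \<le> \<eta>"
    "0 < measure M {\<omega> \<in> space M. tame_path a L K x \<kappa> (\<lambda>t. \<beta> t \<omega>)}"
proof -
  interpret prob_space M using bm by (simp add: brownian_motion_def)
  define x where "x = \<eta> / 8"
  define D where "D = \<bar>a\<bar> + \<eta> / (4 * T)"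
  define c where "c = 2 * (\<eta> / 4) * (exp (- (D\<^sup>2 / 2)) / sqrt (2 * pi))"
  define C where "C = dev_const * (T / x\<^sup>2) ^ 12"
  have c: "0 < c" using \<eta> by (simp add: c_def)
  have C: "0 < C" using T \<eta> dev_const_pos by (simp add: C_def x_def)
  obtain K :: nat where K: "max (max 1 T) (max (8 * \<bar>a\<bar> * T / \<eta>) (2 * C / c)) < real K"
    using reals_Archimedean2 by blast
  hence K1: "1 < real K" "T \<le> real K" "8 * \<bar>a\<bar> * T / \<eta> \<le> real K" "2 * C / c < real K" by auto
  define L where "L = T / real K"
  \<comment> \<open>\<open>K + 1\<close> block errors add up to \<open>\<eta> / 4\<close>; the
    rounding terms take \<open>\<eta> / 2\<close>.\<close>
  define \<kappa> where "\<kappa> = \<eta> / (4 * (real K + 1))"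
  have L: "0 < L" "L \<le> 1" "T = real K * L" using T K1 by (auto simp: L_def)
  have \<kappa>: "0 < \<kappa>" using \<eta> K1 by (simp add: \<kappa>_def)
  have aL: "\<bar>a\<bar> * L \<le> \<eta> / 8" using K1 \<eta> by (simp add: L_def field_simps)
  have \<kappa>T: "\<kappa> / L * T = \<kappa> * real K" using L by simp
  have \<kappa>2: "\<kappa> + \<kappa> * real K = \<eta> / 4"
  proof -
    have "\<kappa> + \<kappa> * real K = \<kappa> * (real K + 1)" by (simp add: algebra_simps)
    also have "\<dots> = \<eta> / 4"
    proof -
      have "\<eta> / (4 * k) * k = \<eta> / 4" if "k \<noteq> 0" for k :: real using that by simp
      from this[of "real K + 1"] show ?thesis unfolding \<kappa>_def by linarith
    qed
    finally show ?thesis .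
  qed
  have x: "0 < x" using \<eta> by (simp add: x_def)
  have win: "\<bar>a * L\<bar> + \<kappa> \<le> D * L"
  proof -
    have "\<kappa> \<le> \<eta> / (4 * real K)" using \<eta> K1 unfolding \<kappa>_def by (intro divide_left_mono) auto
    also have "\<dots> = \<eta> / (4 * T) * L" using T K1 by (simp add: L_def)
    finally show ?thesis using L by (simp add: D_def abs_mult distrib_right)
  qed
  define p where "p = c / (real K + 1) - C / real K ^ 12"
  have "C * (real K + 1) < c * real K ^ 12"
  proof -
    have "C * (real K + 1) \<le> C * (2 * real K)" using C K1 by (intro mult_left_mono) auto
    also have "\<dots> < c * real K * real K" using K1 c by (simp add: field_simps)
    also have "\<dots> = c * real K ^ 2" by (simp add: power2_eq_square)
    also have "\<dots> \<le> c * real K ^ 12" using K1 c by (intro mult_left_mono power_increasing) auto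
    finally show ?thesis .
  qed
  hence p: "0 < p" using K1 by (simp add: p_def divide_simps mult.commute)
  have block: "p \<le> prob {\<omega> \<in> space M. block_ok J a L x \<kappa> i (\<lambda>t. \<beta> t \<omega>)}" for J i
  proof -
    let ?A = "{\<omega> \<in> space M. block_ok J a L x \<kappa> i (\<lambda>t. \<beta> t \<omega>)}"
    let ?W = "{\<omega> \<in> space M. \<bar>\<beta> (real (Suc i) * L) \<omega> - \<beta> (real i * L) \<omega> - a * L\<bar> \<le> \<kappa>}"
    let ?B = "{\<omega> \<in> space M. \<not> (\<forall>j\<le>J. dyadic_small (\<lambda>t. \<beta> t \<omega>) (real i * L) L x j)}"
    have [measurable]: "Measurable.pred M (\<lambda>\<omega>. block_ok J a L x \<kappa> i (\<lambda>t. \<beta> t \<omega>))"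
      using bm L by (intro measurable_block_ok) (auto simp: brownian_motion_def)
    have [measurable]: "(\<lambda>\<omega>. \<beta> (real i * L + real l * L / 2 ^ j) \<omega>) \<in> borel_measurable M" for l j :: nat
      using bm L by (auto simp: brownian_motion_def)
    have d: "real (Suc i) * L - real i * L = L" by (simp add: algebra_simps)
    have "2 * \<kappa> * (exp (- (D\<^sup>2 / 2)) / sqrt (2 * pi)) \<le> prob ?W"
      using L \<kappa> win by (intro brownian_increment_window[OF bm]) (simp_all only: d, auto)
    moreover have "2 * \<kappa> * (exp (- (D\<^sup>2 / 2)) / sqrt (2 * pi)) = c / (real K + 1)"
    proof -
      have "2 * (\<eta> / (4 * k)) * e = 2 * (\<eta> / 4) * e / k" for k e :: real by simp
      thus ?thesis unfolding c_def \<kappa>_def .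
    qed
    moreover have "prob ?B \<le> dev_const * (L / x\<^sup>2) ^ 12"
      using L x by (intro brownian_dyadic_small[OF bm]) auto
    moreover have "dev_const * (L / x\<^sup>2) ^ 12 = C / real K ^ 12"
    proof -
      have "L / x\<^sup>2 = T / x\<^sup>2 / real K" by (simp add: L_def)
      thus ?thesis by (simp only: C_def power_divide times_divide_eq_right)
    qed
    \<comment> \<open>Window and dyadic control of the same block are dependent, so the failure
      probability of the latter is subtracted.\<close>
    moreover have "prob ?W \<le> prob (?A \<union> ?B)"
    proof (rule finite_measure_mono)
      show "?W \<subseteq> ?A \<union> ?B" unfolding block_ok_def by blast
      show "?A \<union> ?B \<in> sets M" unfolding dyadic_small_def by measurable
    qed
    moreover have "prob (?A \<union> ?B) \<le> prob ?A + prob ?B"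
      unfolding dyadic_small_def by (rule measure_Un_le; measurable)
    ultimately show ?thesis by (simp add: p_def)
  qed
  have "p ^ K \<le> prob {\<omega> \<in> space M. tame_path a L K x \<kappa> (\<lambda>t. \<beta> t \<omega>)}"
  proof (rule tame_path_prob_limit[OF bm])
    fix J
    have "p ^ K = (\<Prod>i<K. p)" by simp
    also have "\<dots> \<le> (\<Prod>i<K. prob {\<omega> \<in> space M. block_ok J a L x \<kappa> i (\<lambda>t. \<beta> t \<omega>)})"
      using p block by (intro prod_mono) auto
    finally show "p ^ K \<le> prob {\<omega> \<in> space M. \<forall>i<K. block_ok J a L x \<kappa> i (\<lambda>t. \<beta> t \<omega>)}"
      unfolding block_ok_indep[OF bm L(1)] .
  qed (use L in simp)
  moreover have "0 < p ^ K" using p by simp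
  ultimately show ?thesis
    using that[of L x \<kappa> K] L x \<kappa> aL \<kappa>T \<kappa>2 by (simp add: x_def)
qed

section \<open>The stochastic convolution\<close>

text \<open>For \<open>w 0 = 0\<close> this is the convolution of \<open>exp (- \<mu> * t)\<close>
  with \<open>dw\<close>, integrated by parts so that it makes sense for every continuous
  path.\<close>

definition ou_path :: "real \<Rightarrow> (real \<Rightarrow> real) \<Rightarrow> real \<Rightarrow> real" where
  "ou_path \<mu> w t = w t - \<mu> * (exp (- \<mu> * t) * integral {0..t} (\<lambda>s. exp (\<mu> * s) * w s))"

lemma ou_path_continuous:
  assumes "continuous_on {0..T} w"
  shows "continuous_on {0..T} (ou_path \<mu> w)"
proof -
  have "continuous_on {0..T} (\<lambda>t. integral {0..t} (\<lambda>s. exp (\<mu> * s) * w s))"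
    by (intro indefinite_integral_continuous_1 integrable_continuous_real continuous_intros assms)
  thus ?thesis unfolding ou_path_def by (intro continuous_intros assms)
qed

text \<open>The convolution \<open>F\<close> of \<open>exp (- \<mu> * t)\<close> with
  \<open>w\<close> has derivative \<open>w - \<mu> * F\<close>, which is \<open>ou_path\<close>
  itself; hence \<open>F\<close> is the integral of \<open>ou_path\<close>.\<close>

lemma ou_path_eq:
  assumes w: "continuous_on {0..T} w" and t: "t \<in> {0..T}"
  shows "ou_path \<mu> w t = w t - \<mu> * (LINT s:{0..t}|lborel. ou_path \<mu> w s)"
proof -
  define F where "F t = exp (- \<mu> * t) * integral {0..t} (\<lambda>s. exp (\<mu> * s) * w s)" for t
  have ou: "ou_path \<mu> w s = w s - \<mu> * F s" for s by (simp add: ou_path_def F_def)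
  have "(F has_real_derivative ou_path \<mu> w s) (at s within {0..t})" if s: "s \<in> {0..t}" for s
  proof -
    have "((\<lambda>s. integral {0..s} (\<lambda>s. exp (\<mu> * s) * w s)) has_real_derivative exp (\<mu> * s) * w s)
        (at s within {0..t})"
      using t by (intro integral_has_real_derivative s continuous_intros continuous_on_subset[OF w]) auto
    hence "(F has_real_derivative
        (exp (- \<mu> * s) * (exp (\<mu> * s) * w s) + (- \<mu> * exp (- \<mu> * s)) * integral {0..s} (\<lambda>s. exp (\<mu> * s) * w s)))
        (at s within {0..t})"
      unfolding F_def by (auto intro!: derivative_eq_intros simp: algebra_simps)
    moreover have "exp (- \<mu> * s) * (exp (\<mu> * s) * w s) = w s"
    proof -
      have "exp (- \<mu> * s) * exp (\<mu> * s) = 1" by (simp flip: exp_add)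
      thus ?thesis unfolding mult.assoc[symmetric] by simp
    qed
    hence "exp (- \<mu> * s) * (exp (\<mu> * s) * w s) + (- \<mu> * exp (- \<mu> * s)) * integral {0..s} (\<lambda>s. exp (\<mu> * s) * w s)
        = ou_path \<mu> w s"
      unfolding ou F_def by (simp only: algebra_simps)
    ultimately show ?thesis by simp
  qed
  hence "(ou_path \<mu> w has_integral (F t - F 0)) {0..t}"
    using t by (intro fundamental_theorem_of_calculus)
       (auto simp flip: has_real_derivative_iff_has_vector_derivative)
  moreover have "set_integrable lborel {0..t} (ou_path \<mu> w)"
    using t by (intro borel_integrable_atLeastAtMost' continuous_on_subset[OF ou_path_continuous[OF w]]) auto
  ultimately have "(LINT s:{0..t}|lborel. ou_path \<mu> w s) = F t"
    by (simp add: set_borel_integral_eq_integral(2) integral_unique F_def)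
  thus ?thesis by (simp add: ou)
qed

text \<open>Oscillations may grow linearly on the relaxation scale \<open>1 / \<mu>\<close>: against
  the exponential weight they integrate to a constant, which makes the bound independent of
  \<open>\<mu>\<close> and \<open>T\<close>.\<close>

lemma ou_path_bound:
  assumes w: "continuous_on {0..T} w" and t: "t \<in> {0..T}" and w0: "w 0 = 0" and \<mu>: "0 \<le> \<mu>" and H: "0 \<le> H"
    and osc: "\<And>s t. 0 \<le> s \<Longrightarrow> s \<le> t \<Longrightarrow> t \<le> T \<Longrightarrow> \<bar>w t - w s\<bar> \<le> H * (1 + \<mu> * (t - s))"
  shows "\<bar>ou_path \<mu> w t\<bar> \<le> 2 * H"
proof -
  have wt: "continuous_on {0..t} w" using t by (auto intro: continuous_on_subset[OF w])
  have e1: "((\<lambda>s. \<mu> * exp (\<mu> * s)) has_integral (exp (\<mu> * t) - exp (\<mu> * 0))) {0..t}"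
    using t by (intro fundamental_theorem_of_calculus)
      (auto intro!: derivative_eq_intros simp flip: has_real_derivative_iff_has_vector_derivative)
  \<comment> \<open>The primitive is \<open>H * exp (\<mu> * s) * (2 + \<mu> * (t - s))\<close>. Its
    value at 0 is what absorbs \<open>\<bar>w t\<bar>\<close> below.\<close>
  have e2: "((\<lambda>s. \<mu> * exp (\<mu> * s) * (H * (1 + \<mu> * (t - s))))
      has_integral (H * exp (\<mu> * t) * (2 + \<mu> * (t - t)) - H * exp (\<mu> * 0) * (2 + \<mu> * (t - 0)))) {0..t}"
    using t by (intro fundamental_theorem_of_calculus)
      (auto intro!: derivative_eq_intros simp: algebra_simps simp flip: has_real_derivative_iff_has_vector_derivative)
  let ?R = "integral {0..t} (\<lambda>s. \<mu> * exp (\<mu> * s) * (w t - w s))"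
  have iw: "(\<lambda>s. exp (\<mu> * s) * w s) integrable_on {0..t}"
    by (intro integrable_continuous_real continuous_intros wt)
  have R: "?R = w t * (exp (\<mu> * t) - 1) - \<mu> * integral {0..t} (\<lambda>s. exp (\<mu> * s) * w s)"
  proof -
    have "((\<lambda>s. w t * (\<mu> * exp (\<mu> * s)) - \<mu> * (exp (\<mu> * s) * w s)) has_integral
       (w t * (exp (\<mu> * t) - exp (\<mu> * 0)) - \<mu> * integral {0..t} (\<lambda>s. exp (\<mu> * s) * w s))) {0..t}"
      by (intro has_integral_diff has_integral_mult_right e1 integrable_integral iw)
    hence "integral {0..t} (\<lambda>s. w t * (\<mu> * exp (\<mu> * s)) - \<mu> * (exp (\<mu> * s) * w s))
       = w t * (exp (\<mu> * t) - exp (\<mu> * 0)) - \<mu> * integral {0..t} (\<lambda>s. exp (\<mu> * s) * w s)"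
      by (rule integral_unique)
    thus ?thesis by (simp add: algebra_simps)
  qed
  have "norm ?R \<le> integral {0..t} (\<lambda>s. \<mu> * exp (\<mu> * s) * (H * (1 + \<mu> * (t - s))))"
  proof (rule integral_norm_bound_integral)
    show "(\<lambda>s. \<mu> * exp (\<mu> * s) * (w t - w s)) integrable_on {0..t}"
      by (intro integrable_continuous_real continuous_intros wt)
    show "(\<lambda>s. \<mu> * exp (\<mu> * s) * (H * (1 + \<mu> * (t - s)))) integrable_on {0..t}"
      using e2 by (rule has_integral_integrable)
    fix s assume "s \<in> {0..t}"
    thus "norm (\<mu> * exp (\<mu> * s) * (w t - w s)) \<le> \<mu> * exp (\<mu> * s) * (H * (1 + \<mu> * (t - s)))"
      using osc[of s t] t \<mu> by (simp add: abs_mult mult_left_mono)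
  qed
  also have "\<dots> = H * exp (\<mu> * t) * 2 - H * (2 + \<mu> * t)"
    using integral_unique[OF e2] by simp
  finally have R2: "\<bar>?R\<bar> \<le> H * exp (\<mu> * t) * 2 - H * (2 + \<mu> * t)" by simp
  have "\<bar>w t\<bar> \<le> H * (1 + \<mu> * t)" using osc[of 0 t] t w0 by simp
  also have "\<dots> \<le> H * (2 + \<mu> * t)" using H by (intro mult_left_mono) auto
  finally have wt': "\<bar>w t\<bar> \<le> H * (2 + \<mu> * t)" .
  have ex: "exp (- \<mu> * t) * exp (\<mu> * t) = 1" by (simp flip: exp_add)
  have "ou_path \<mu> w t = exp (- \<mu> * t) * (w t + ?R)"
    unfolding R ou_path_def using ex by (simp add: algebra_simps)
  hence "\<bar>ou_path \<mu> w t\<bar> = exp (- \<mu> * t) * \<bar>w t + ?R\<bar>" by (simp add: abs_mult)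
  also have "\<dots> \<le> exp (- \<mu> * t) * (H * exp (\<mu> * t) * 2)"
  proof (rule mult_left_mono)
    show "\<bar>w t + ?R\<bar> \<le> H * exp (\<mu> * t) * 2" using R2 wt' by linarith
  qed simp
  also have "\<dots> = 2 * H" using ex by (simp add: mult_ac)
  finally show ?thesis .
qed

section \<open>Independent modes and the noise event\<close>

lemma powr_quarter: "0 < k \<Longrightarrow> (k powr (-7/4)) ^ 2 = k powr (-7/2)" for k :: real
  by (simp add: powr_realpow[symmetric] powr_powr)

text \<open>The block length is the relaxation time, of order k^-4. With oscillation k^-7/4 the
  ratio \<open>L / x\<^sup>2\<close> is at most k^-1/2; its 12th power k^-6, times of order k^4
  blocks, leaves the summable k^-2.\<close>

lemma high_mode_prob:
  assumes bm: "brownian_motion M \<beta>" and k: "1 \<le> k" and T: "0 < T"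
    and \<mu>: "\<mu> = (real k * pi) ^ 4 / 2" and x: "x = real k powr (-7/4)" and K: "K = nat \<lceil>T * \<mu>\<rceil>"
  shows "1 - (T * pi ^ 4 + 1) * dev_const / (real k)\<^sup>2
    \<le> measure M {\<omega> \<in> space M. tame_path 0 (1 / \<mu>) K x x (\<lambda>t. \<beta> t \<omega>)}"
proof -
  have k0: "0 < real k" using k by simp
  have pi4: "2 \<le> pi ^ 4"
    using power_mono[OF less_imp_le[OF pi_gt3], of 4] by simp
  have \<mu>1: "real k ^ 4 \<le> \<mu>" using pi4 unfolding \<mu> power_mult_distrib by (simp add: mult_left_mono)
  hence \<mu>0: "0 < \<mu>" using k0 by (meson less_le_trans zero_less_power)
  have x0: "0 < x" using k0 by (simp add: x)
  have x2: "x\<^sup>2 = real k powr (-7/2)" unfolding x using powr_quarter[OF k0] .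
  have "1 / \<mu> / x\<^sup>2 \<le> 1 / real k ^ 4 / x\<^sup>2"
    using \<mu>1 k0 x0 by (intro divide_right_mono divide_left_mono) (auto simp: \<mu>0)
  also have "\<dots> = real k powr (-1/2)"
  proof -
    have "1 / real k ^ 4 / x\<^sup>2 = real k powr (-4 - (-7/2))"
      unfolding x2 powr_diff powr_minus_divide[of _ 4] using k0 by (simp add: powr_numeral)
    thus ?thesis by simp
  qed
  finally have r: "1 / \<mu> / x\<^sup>2 \<le> real k powr (-1/2)" .
  have "(1 / \<mu> / x\<^sup>2) ^ 12 \<le> (real k powr (-1/2)) ^ 12"
    using \<mu>0 by (intro power_mono r) auto
  also have "\<dots> = 1 / real k ^ 6"
  proof -
    have "(real k powr (-1/2)) ^ 12 = real k powr (real 12 * (-1/2))"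
      using k0 by (intro powr_power) simp
    also have "real 12 * (-1/2) = -6" by simp
    also have "real k powr (-6) = 1 / real k ^ 6"
      unfolding powr_minus_divide[of _ 6] using k0 by (simp add: powr_numeral)
    finally show ?thesis .
  qed
  finally have r12: "(1 / \<mu> / x\<^sup>2) ^ 12 \<le> 1 / real k ^ 6" .
  have "real K \<le> T * \<mu> + 1" unfolding K using T \<mu>0 by (simp add: of_nat_nat ceiling_correct)
  also have "\<dots> \<le> (T * pi ^ 4 + 1) * real k ^ 4"
  proof -
    have "T * \<mu> \<le> T * (pi ^ 4 * real k ^ 4)" using T unfolding \<mu> by (intro mult_left_mono) (auto simp: power_mult_distrib)
    moreover have "1 \<le> real k ^ 4" using k by simp
    ultimately show ?thesis by (simp add: algebra_simps)
  qed
  finally have K': "real K \<le> (T * pi ^ 4 + 1) * real k ^ 4" .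
  have "real K * (dev_const * (1 / \<mu> / x\<^sup>2) ^ 12) \<le> ((T * pi ^ 4 + 1) * real k ^ 4) * (dev_const * (1 / real k ^ 6))"
    using K' r12 T dev_const_pos by (intro mult_mono) auto
  also have "\<dots> = (T * pi ^ 4 + 1) * dev_const / (real k)\<^sup>2"
    using k0 by (simp add: divide_simps power_numeral_reduce)
  finally show ?thesis
    using tame_path_prob_no_drift[OF bm _ x0, of "1 / \<mu>" K] \<mu>0 by simp
qed

text \<open>Weierstrass's product inequality with the low factors kept as they are. The lower bound
  does not degenerate as \<open>m\<close> grows, provided the sums of \<open>q\<close> stay below a
  constant less than 1.\<close>

lemma prod_ge_one_minus_sum:
  fixes p q :: "nat \<Rightarrow> real"
  assumes "\<And>k. 0 \<le> p k" "\<And>k. K \<le> k \<Longrightarrow> 1 - q k \<le> p k" "\<And>k. K \<le> k \<Longrightarrow> 0 \<le> q k"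
    and "\<And>m. (\<Sum>k\<in>{K..<m}. q k) \<le> 1" and "K \<le> m"
  shows "(\<Prod>k<K. p k) * (1 - (\<Sum>k\<in>{K..<m}. q k)) \<le> (\<Prod>k<m. p k)"
  using \<open>K \<le> m\<close>
proof (induction m rule: dec_induct)
  case (step m)
  let ?c = "\<Prod>k<K. p k" and ?S = "\<Sum>k\<in>{K..<m}. q k"
  have c: "0 \<le> ?c" using assms(1) by (intro prod_nonneg) auto
  have S: "0 \<le> ?S" using assms(3) by (intro sum_nonneg) auto
  have "?c * (1 - (?S + q m)) \<le> ?c * ((1 - ?S) * (1 - q m))"
    using c S assms(3)[of m] step.hyps by (intro mult_left_mono) (simp_all add: algebra_simps)
  also have "\<dots> \<le> ?c * ((1 - ?S) * p m)"
    using c assms(2)[of m] assms(4)[of m] step.hyps by (intro mult_left_mono) auto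
  also have "\<dots> \<le> (\<Prod>k<m. p k) * p m"
    using mult_right_mono[OF step.IH assms(1)[of m]] by (simp add: mult.assoc)
  finally show ?case using step.hyps by (simp add: mult.commute)
qed simp

lemma finite_trace_summable:
  assumes "finite_trace (-1) (cov_sqrt b)" "\<And>k. 0 \<le> b k"
  shows "summable (\<lambda>k. b k / (real k * pi)\<^sup>2)"
proof -
  \<comment> \<open>At k = 0 both sides are 0, by \<open>0 powr (-1) = 0\<close> and by division by
    zero.\<close>
  have "cov_sqrt b (neg_laplace_power (-1) (cov_sqrt b (basis_vec k))) k = b k / (real k * pi)\<^sup>2" for k
    using assms(2)[of k]
    by (simp add: cov_sqrt_def neg_laplace_power_def diag_op_def basis_vec_def eigval_def powr_minus_divide)
  thus ?thesis using assms(1) by (simp add: finite_trace_def)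
qed

text \<open>The bound \<open>h\<close> is deterministic and summable, as the uniform estimate in
  space requires. Each of the finitely many low modes succeeds with positive probability, the high
  modes with probabilities whose product stays positive, and independence combines them.\<close>

lemma noise_event:
  assumes W: "cylindrical_wiener M W" and b: "\<And>k. 0 \<le> b k"
    and trace: "finite_trace (-1) (cov_sqrt b)"
    and a: "\<And>k. b k = 0 \<Longrightarrow> a k = 0" "\<And>k. N < k \<Longrightarrow> a k = 0" and T: "0 < T" and \<epsilon>: "0 < \<epsilon>"
  obtains A h where "A \<in> sets M" "0 < measure M A" "summable h" "\<And>k. 0 \<le> h k" "(\<Sum>k. h k) \<le> \<epsilon>"
    "AE \<omega> in M. \<omega> \<in> A \<longrightarrow> (\<exists>z. \<forall>k. continuous_on {0..T} (z k) \<and> (\<forall>t\<in>{0..T}. \<bar>z k t\<bar> \<le> h k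
        \<and> z k t = cov_sqrt b (W t \<omega>) k - a k * t - (eigval k)\<^sup>2 / 2 * (LINT s:{0..t}|lborel. z k s)))"
proof -
  interpret prob_space M using W by (simp add: cylindrical_wiener_def)
  have bm: "brownian_motion M (\<lambda>t \<omega>. W t \<omega> k)" for k using W by (simp add: cylindrical_wiener_def)
  define x where "x k = real k powr (-7/4)" for k
  define \<mu> where "\<mu> k = (real k * pi) ^ 4 / 2" for k
  define q where "q k = (T * pi ^ 4 + 1) * dev_const / (real k)\<^sup>2" for k
  \<comment> \<open>A tame path without drift oscillates by at most
    \<open>3 * x k * (1 + \<mu> k * (t - s))\<close>, and \<open>ou_path_bound\<close> doubles the
    constant.\<close>
  define hh where "hh k = 6 * (sqrt (b k) * x k)" for k
  have x0: "0 \<le> x k" for k by (simp add: x_def)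
  have q0: "0 \<le> q k" for k using T dev_const_pos by (simp add: q_def)
  have hh0: "0 \<le> hh k" for k using b x0 by (simp add: hh_def)
  have \<mu>0: "0 \<le> \<mu> k" for k by (simp add: \<mu>_def)

  have "summable (\<lambda>k. (T * pi ^ 4 + 1) * dev_const * inverse ((real k)\<^sup>2))"
    by (intro summable_mult inverse_power_summable) auto
  hence q_sum: "summable q" by (simp add: q_def[abs_def] divide_inverse)
  have hh_sum: "summable hh"
  proof (rule summable_comparison_test')
    have "summable (\<lambda>k. real k powr (-3/2))"
      by (subst summable_real_powr_iff) simp
    hence "summable (\<lambda>k. pi\<^sup>2 * real k powr (-3/2))" by (rule summable_mult)
    thus "summable (\<lambda>k. 6 * (b k / (real k * pi)\<^sup>2 + pi\<^sup>2 * real k powr (-3/2)))"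
      by (rule summable_mult[OF summable_add[OF finite_trace_summable[OF trace b]]])
    fix k :: nat assume "1 \<le> k"
    hence k: "0 < real k" by simp
    have "(real k)\<^sup>2 * (x k)\<^sup>2 = real k powr (-3/2)"
    proof -
      have "(real k)\<^sup>2 * real k powr (-7/2) = real k powr (2 + (-7/2))"
        unfolding powr_add using k by (simp add: powr_numeral)
      thus ?thesis unfolding x_def powr_quarter[OF k] by simp
    qed
    hence l: "(real k * pi * x k)\<^sup>2 = pi\<^sup>2 * real k powr (-3/2)"
      by (simp add: power_mult_distrib mult_ac)
    have "sqrt (b k) * x k = (sqrt (b k) / (real k * pi)) * (real k * pi * x k)" using k by simp
    \<comment> \<open>The product is split so that the trace condition controls the first square and
      an exponent below -1 the second.\<close>
    also have "\<dots> \<le> (sqrt (b k) / (real k * pi))\<^sup>2 + (real k * pi * x k)\<^sup>2"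
    proof -
      have "u * v \<le> u\<^sup>2 + v\<^sup>2" for u v :: real
        using sum_squares_bound[of u v] zero_le_power2[of u] zero_le_power2[of v] by linarith
      thus ?thesis .
    qed
    also have "\<dots> = b k / (real k * pi)\<^sup>2 + pi\<^sup>2 * real k powr (-3/2)"
      unfolding l using b by (simp add: power_divide)
    finally show "norm (hh k) \<le> 6 * (b k / (real k * pi)\<^sup>2 + pi\<^sup>2 * real k powr (-3/2))"
      using hh0[of k] by (simp add: hh_def)
  qed
  obtain N1 where N1: "\<And>n. n \<ge> N1 \<Longrightarrow> norm (\<Sum>i. hh (i + n)) < \<epsilon> / 2"
    using suminf_exist_split[OF _ hh_sum, of "\<epsilon> / 2"] \<epsilon> by auto
  obtain N2 where N2: "\<And>n. n \<ge> N2 \<Longrightarrow> norm (\<Sum>i. q (i + n)) < 1 / 2"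
    using suminf_exist_split[OF _ q_sum, of "1 / 2"] by auto
  \<comment> \<open>Beyond \<open>N\<close> the drift vanishes, from \<open>N1\<close> on the tail
    of \<open>hh\<close> is below \<open>\<epsilon> / 2\<close>, from \<open>N2\<close> on the tail
    of \<open>q\<close> is below 1/2.\<close>
  define K where "K = max (Suc N) (max N1 N2)"
  define h where "h k = (if k < K then \<epsilon> / (2 * real K) else hh k)" for k
  have K: "1 \<le> K" "N1 \<le> K" "N2 \<le> K" by (auto simp: K_def)
  have h0: "0 \<le> h k" for k using hh0 \<epsilon> by (simp add: h_def)
  have h_sum: "summable h"
    using hh_sum by (subst summable_iff_shift[of _ K, symmetric]) (simp add: h_def summable_ignore_initial_segment)
  have "(\<Sum>k. h k) = (\<Sum>k. h (k + K)) + (\<Sum>k<K. h k)"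
    by (rule suminf_split_initial_segment[OF h_sum])
  also have "(\<Sum>k<K. h k) = \<epsilon> / 2" using K by (simp add: h_def)
  also have "(\<Sum>k. h (k + K)) = (\<Sum>k. hh (k + K))" by (simp add: h_def)
  also have "\<dots> \<le> \<epsilon> / 2" using N1[OF K(2)] by simp
  finally have h_le: "(\<Sum>k. h k) \<le> \<epsilon>" by simp
  have q_le: "(\<Sum>k\<in>{K..<m}. q k) \<le> 1 / 2" for m
  proof -
    have "(\<Sum>k\<in>{K..<m}. q k) = (\<Sum>i<m - K. q (i + K))"
      by (rule sum.reindex_bij_witness[of _ "\<lambda>i. i + K" "\<lambda>k. k - K"]) auto
    also have "\<dots> \<le> (\<Sum>i. q (i + K))"
      using q0 q_sum by (intro sum_le_suminf) (auto simp: summable_ignore_initial_segment)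
    also have "\<dots> \<le> 1 / 2" using N2[OF K(3)] by simp
    finally show ?thesis .
  qed

  \<comment> \<open>Everything needed later from the parameters of mode \<open>k\<close>, bundled so
    that low and high modes can be chosen together.\<close>
  define R where "R k d L n y \<kappa> \<longleftrightarrow> 0 \<le> L \<and> 0 < measure M {\<omega> \<in> space M. tame_path d L n y \<kappa> (\<lambda>t. W t \<omega> k)}
     \<and> (K \<le> k \<longrightarrow> 1 - q k \<le> measure M {\<omega> \<in> space M. tame_path d L n y \<kappa> (\<lambda>t. W t \<omega> k)})
     \<and> (\<forall>f s t. tame_path d L n y \<kappa> f \<and> continuous_on {0..} f \<and> 0 \<le> s \<and> s \<le> t \<and> t \<le> T \<longrightarrow>
          \<bar>(sqrt (b k) * f t - a k * t) - (sqrt (b k) * f s - a k * s)\<bar> \<le> h k / 2 * (1 + \<mu> k * (t - s)))"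
    for k d L n y \<kappa>
  have "\<exists>d L n y \<kappa>. R k d L n y \<kappa>" for k
  proof (cases "K \<le> k")
    case True
    let ?L = "1 / \<mu> k" and ?n = "nat \<lceil>T * \<mu> k\<rceil>"
    let ?p = "measure M {\<omega> \<in> space M. tame_path 0 ?L ?n (x k) (x k) (\<lambda>t. W t \<omega> k)}"
    have k: "1 \<le> k" using True K by simp
    have \<mu>pos: "0 < \<mu> k" using k by (simp add: \<mu>_def)
    have p: "1 - q k \<le> ?p"
      unfolding q_def by (rule high_mode_prob[OF bm k T \<mu>_def x_def refl])
    have "q k \<le> (\<Sum>k\<in>{K..<Suc k}. q k)" using True q0 by (simp add: sum_nonneg)
    hence p0: "0 < ?p" using q_le[of "Suc k"] p by linarith
    have "\<bar>(sqrt (b k) * f t - a k * t) - (sqrt (b k) * f s - a k * s)\<bar> \<le> h k / 2 * (1 + \<mu> k * (t - s))"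
      if f: "tame_path 0 ?L ?n (x k) (x k) f" "continuous_on {0..} f" "0 \<le> s" "s \<le> t" "t \<le> T" for f s t
    proof -
      have "a k = 0" using True by (intro a(2)) (simp add: K_def)
      have "T * \<mu> k \<le> real ?n" by (rule real_nat_ceiling_ge)
      hence n: "T \<le> real ?n * ?L" using \<mu>pos by (simp add: field_simps)
      have "\<bar>(f t - 0 * t) - (f s - 0 * s)\<bar> \<le> 2 * (x k + \<bar>0\<bar> * ?L) + x k + x k / ?L * (t - s)"
        using f n x0[of k] \<mu>pos by (intro tame_path_increment[OF f(1,2)]) auto
      also have "\<dots> = 3 * x k * 1 + x k * (\<mu> k * (t - s))" by simp
      also have "\<dots> \<le> 3 * x k * 1 + 3 * x k * (\<mu> k * (t - s))"
        using x0[of k] \<mu>pos f by (intro add_mono mult_right_mono) auto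
      finally have "\<bar>f t - f s\<bar> \<le> 3 * x k * (1 + \<mu> k * (t - s))" by (simp add: distrib_left)
      hence "sqrt (b k) * \<bar>f t - f s\<bar> \<le> sqrt (b k) * (3 * x k * (1 + \<mu> k * (t - s)))"
        using b by (intro mult_left_mono) auto
      also have "\<dots> = h k / 2 * (1 + \<mu> k * (t - s))"
        using True by (simp add: h_def hh_def)
      also have "sqrt (b k) * \<bar>f t - f s\<bar> = \<bar>(sqrt (b k) * f t - a k * t) - (sqrt (b k) * f s - a k * s)\<bar>"
        using \<open>a k = 0\<close> b[of k] by (simp add: abs_mult flip: right_diff_distrib)
      finally show ?thesis .
    qed
    moreover have "0 \<le> ?L" using \<mu>0[of k] by simp
    ultimately have "R k 0 ?L ?n (x k) (x k)" unfolding R_def using p p0 by blast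
    thus ?thesis by blast
  next
    case False
    \<comment> \<open>The slope of the Brownian path itself. If \<open>b k = 0\<close>, the quotient
      is 0, and so is \<open>a k\<close>.\<close>
    define d where "d = a k / sqrt (b k)"
    define \<eta> where "\<eta> = \<epsilon> / (4 * real K * (sqrt (b k) + 1))"
    have \<eta>: "0 < \<eta>" using \<epsilon> K b[of k] by (simp add: \<eta>_def add_nonneg_pos)
    have ad: "a k = sqrt (b k) * d" using a(1)[of k] by (cases "b k = 0") (auto simp: d_def)
    obtain n L y \<kappa> where *: "0 < L" "0 \<le> y" "0 \<le> \<kappa>" "T = real n * L"
      "2 * (y + \<bar>d\<bar> * L) + \<kappa> + \<kappa> / L * T \<le> \<eta>"
      "0 < measure M {\<omega> \<in> space M. tame_path d L n y \<kappa> (\<lambda>t. W t \<omega> k)}"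
      by (rule tame_path_prob_drift[OF bm[of k] T \<eta>, of d])
    have "\<bar>(sqrt (b k) * f t - a k * t) - (sqrt (b k) * f s - a k * s)\<bar> \<le> h k / 2 * (1 + \<mu> k * (t - s))"
      if f: "tame_path d L n y \<kappa> f" "continuous_on {0..} f" "0 \<le> s" "s \<le> t" "t \<le> T" for f s t
    proof -
      have "\<bar>(f t - d * t) - (f s - d * s)\<bar> \<le> 2 * (y + \<bar>d\<bar> * L) + \<kappa> + \<kappa> / L * (t - s)"
        using f * by (intro tame_path_increment[OF f(1,2)]) auto
      also have "\<kappa> / L * (t - s) \<le> \<kappa> / L * T" using f * by (intro mult_left_mono) auto
      finally have "\<bar>(f t - d * t) - (f s - d * s)\<bar> \<le> \<eta>" using *(5) by linarith
      hence "sqrt (b k) * \<bar>(f t - d * t) - (f s - d * s)\<bar> \<le> sqrt (b k) * \<eta>" using b by (intro mult_left_mono) auto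
      also have "sqrt (b k) * \<bar>(f t - d * t) - (f s - d * s)\<bar>
          = \<bar>(sqrt (b k) * f t - a k * t) - (sqrt (b k) * f s - a k * s)\<bar>"
      proof -
        have "(sqrt (b k) * f t - a k * t) - (sqrt (b k) * f s - a k * s)
           = sqrt (b k) * ((f t - d * t) - (f s - d * s))" unfolding ad by (simp add: algebra_simps)
        thus ?thesis using b[of k] by (simp add: abs_mult)
      qed
      also have "sqrt (b k) * \<eta> \<le> (sqrt (b k) + 1) * \<eta>" using \<eta> by (simp add: distrib_right)
      also have "\<dots> = \<epsilon> / (4 * real K)"
      proof -
        have "g * (\<epsilon> / (4 * real K * g)) = \<epsilon> / (4 * real K)" if "g \<noteq> 0" for g using that by simp
        moreover have "sqrt (b k) + 1 \<noteq> 0" using b[of k] real_sqrt_ge_zero[of "b k"] by linarith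
        ultimately show ?thesis unfolding \<eta>_def by blast
      qed
      also have "\<dots> = h k / 2" using False by (simp add: h_def)
      also have "\<dots> \<le> h k / 2 * (1 + \<mu> k * (t - s))"
        using h0[of k] \<mu>0[of k] f by (simp add: distrib_left)
      finally show ?thesis by simp
    qed
    moreover have "0 \<le> L" using * by simp
    ultimately have "R k d L n y \<kappa>" unfolding R_def using *(6) False by blast
    thus ?thesis by blast
  qed
  then obtain d L n y \<kappa> where R: "\<And>k. R k (d k) (L k) (n k) (y k) (\<kappa> k)" by metis
  have L: "0 \<le> L k" for k using R[of k] unfolding R_def by blast
  have p_pos: "0 < measure M {\<omega> \<in> space M. tame_path (d k) (L k) (n k) (y k) (\<kappa> k) (\<lambda>t. W t \<omega> k)}" for k
    using R[of k] unfolding R_def by blast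
  have p_high: "1 - q k \<le> measure M {\<omega> \<in> space M. tame_path (d k) (L k) (n k) (y k) (\<kappa> k) (\<lambda>t. W t \<omega> k)}"
    if "K \<le> k" for k
    using R[of k] that unfolding R_def by blast
  have osc: "\<bar>(sqrt (b k) * f t - a k * t) - (sqrt (b k) * f s - a k * s)\<bar> \<le> h k / 2 * (1 + \<mu> k * (t - s))"
    if "tame_path (d k) (L k) (n k) (y k) (\<kappa> k) f" "continuous_on {0..} f" "0 \<le> s" "s \<le> t" "t \<le> T" for k f s t
    using R[of k] that unfolding R_def by blast
  define Q where "Q k = tame_path (d k) (L k) (n k) (y k) (\<kappa> k)" for k
  define p where "p k = prob {\<omega> \<in> space M. Q k (\<lambda>t. W t \<omega> k)}" for k
  define A where "A = {\<omega> \<in> space M. \<forall>k. Q k (\<lambda>t. W t \<omega> k)}"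
  define Am where "Am m = {\<omega> \<in> space M. \<forall>k<m. Q k (\<lambda>t. W t \<omega> k)}" for m
  have [measurable]: "Measurable.pred M (\<lambda>\<omega>. Q k (\<lambda>t. W t \<omega> k))" for k
    unfolding Q_def using bm[of k] L by (intro measurable_tame_path) (auto simp: brownian_motion_def)
  have A_sets: "A \<in> sets M" and Am_sets: "Am m \<in> sets M" for m
    unfolding A_def Am_def by measurable
  \<comment> \<open>Only times \<open>t \<ge> 0\<close> are inspected, so the condition is an event
    of the restricted paths, whose independence is part of
    \<open>cylindrical_wiener\<close>.\<close>
  have restr: "Q k (\<lambda>t\<in>{0..}. f t) \<longleftrightarrow> Q k f" for k f
    using L[of k] by (simp add: Q_def tame_path_def block_ok_def dyadic_small_def)
  have Am_prod: "prob (Am m) = (\<Prod>k<m. p k)" for m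
  proof (cases "m = 0")
    case True
    then show ?thesis using prob_space by (simp add: Am_def)
  next
    case False
    let ?X = "\<lambda>k \<omega>. \<lambda>t\<in>{0..}. W t \<omega> k" and ?S = "\<lambda>k. {f \<in> space (\<Pi>\<^sub>M t\<in>{0..}. borel). Q k f}"
    have ind: "indep_vars (\<lambda>_. \<Pi>\<^sub>M t\<in>{0..}. borel) ?X UNIV"
      using W by (simp add: cylindrical_wiener_def)
    have S: "?S k \<in> sets (\<Pi>\<^sub>M t\<in>{0::real..}. borel)" for k
    proof -
      have "Measurable.pred (\<Pi>\<^sub>M t\<in>{0::real..}. borel) (\<lambda>f. tame_path (d k) (L k) (n k) (y k) (\<kappa> k) f)"
        using L by (intro measurable_tame_path measurable_component_singleton) auto
      thus ?thesis unfolding Q_def by (rule predE)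
    qed
    have "prob (\<Inter>k\<in>{..<m}. ?X k -` ?S k \<inter> space M) = (\<Prod>k<m. prob (?X k -` ?S k \<inter> space M))"
      using False S by (intro indep_varsD[OF ind]) auto
    moreover have "?X k -` ?S k \<inter> space M = {\<omega> \<in> space M. Q k (\<lambda>t. W t \<omega> k)}" for k
      using restr by (auto simp: space_PiM)
    moreover have "(\<Inter>k\<in>{..<m}. {\<omega> \<in> space M. Q k (\<lambda>t. W t \<omega> k)}) = Am m"
      using False by (auto simp: Am_def)
    ultimately show ?thesis unfolding p_def by (simp only:)
  qed
  define c where "c = (\<Prod>k<K. p k) / 2"
  have c: "0 < c" using p_pos by (auto simp: c_def p_def Q_def intro!: prod_pos)
  have "c \<le> prob (Am m)" if "K \<le> m" for m
  proof -
    have "c \<le> (\<Prod>k<K. p k) * (1 - (\<Sum>k\<in>{K..<m}. q k))"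
      unfolding c_def using q_le[of m] mult_left_mono[of "1/2" "1 - (\<Sum>k\<in>{K..<m}. q k)" "\<Prod>k<K. p k"]
      by (simp add: prod_nonneg p_def)
    also have "\<dots> \<le> (\<Prod>k<m. p k)"
    proof (rule prod_ge_one_minus_sum[OF _ _ _ _ that])
      show "(\<Sum>k\<in>{K..<m}. q k) \<le> 1" for m using q_le[of m] by simp
    qed (use p_high q0 in \<open>auto simp: p_def Q_def\<close>)
    finally show ?thesis by (simp add: Am_prod)
  qed
  moreover have "(\<lambda>m. prob (Am m)) \<longlonglongrightarrow> prob (\<Inter>m. Am m)"
    using Am_sets by (intro finite_Lim_measure_decseq decseq_SucI) (auto simp: Am_def)
  ultimately have "c \<le> prob (\<Inter>m. Am m)" by (auto intro: LIMSEQ_le_const)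
  also have "(\<Inter>m. Am m) = A" by (auto simp: A_def Am_def)
  finally have A_pos: "0 < prob A" using c by simp
  show ?thesis
  proof (rule that[OF A_sets A_pos h_sum h0 h_le])
    have "AE \<omega> in M. \<forall>k. W 0 \<omega> k = 0 \<and> continuous_on {0..} (\<lambda>t. W t \<omega> k)"
      using bm by (simp add: AE_all_countable brownian_motion_def)
    thus "AE \<omega> in M. \<omega> \<in> A \<longrightarrow> (\<exists>z. \<forall>k. continuous_on {0..T} (z k) \<and> (\<forall>t\<in>{0..T}. \<bar>z k t\<bar> \<le> h k
        \<and> z k t = cov_sqrt b (W t \<omega>) k - a k * t - (eigval k)\<^sup>2 / 2 * (LINT s:{0..t}|lborel. z k s)))"
    proof eventually_elim
      case (elim \<omega>)
      define w where "w k t = sqrt (b k) * W t \<omega> k - a k * t" for k t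
      have w: "continuous_on {0..T} (w k)" for k
      proof -
        have "continuous_on {0..T} (\<lambda>t. W t \<omega> k)"
          using elim by (intro continuous_on_subset[of "{0..}" "\<lambda>t. W t \<omega> k" "{0..T}"]) auto
        thus ?thesis unfolding w_def by (intro continuous_intros)
      qed
      have eig: "(eigval k)\<^sup>2 / 2 = \<mu> k" for k by (simp add: eigval_def \<mu>_def)
      have cs: "cov_sqrt b (W t \<omega>) k = sqrt (b k) * W t \<omega> k" for t k
        by (simp add: cov_sqrt_def diag_op_def)
      show ?case
      proof (intro impI exI[of _ "\<lambda>k. ou_path (\<mu> k) (w k)"] allI conjI ballI)
        assume \<omega>: "\<omega> \<in> A"
        fix k
        show "continuous_on {0..T} (ou_path (\<mu> k) (w k))" by (rule ou_path_continuous[OF w])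
        fix t assume t: "t \<in> {0..T}"
        have "\<bar>ou_path (\<mu> k) (w k) t\<bar> \<le> 2 * (h k / 2)"
        proof (rule ou_path_bound[OF w t])
          show "w k 0 = 0" using elim by (simp add: w_def)
          show "\<bar>w k t - w k s\<bar> \<le> h k / 2 * (1 + \<mu> k * (t - s))" if "0 \<le> s" "s \<le> t" "t \<le> T" for s t
            unfolding w_def using \<omega> elim that by (intro osc) (auto simp: A_def Q_def)
        qed (use \<mu>0[of k] h0[of k] in auto)
        thus "\<bar>ou_path (\<mu> k) (w k) t\<bar> \<le> h k" by simp
        show "ou_path (\<mu> k) (w k) t = cov_sqrt b (W t \<omega>) k - a k * t
            - (eigval k)\<^sup>2 / 2 * (LINT s:{0..t}|lborel. ou_path (\<mu> k) (w k) s)"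
          unfolding eig cs using ou_path_eq[OF w t, of "\<mu> k" k] by (simp add: w_def)
      qed
    qed
  qed
qed

section \<open>Indefinite integrals\<close>

lemma set_integral_Icc_split:
  fixes f :: "real \<Rightarrow> real"
  assumes f: "set_integrable lborel {a..c} f" and "a \<le> b" "b \<le> c"
  shows "(LINT r:{a..c}|lborel. f r) = (LINT r:{a..b}|lborel. f r) + (LINT r:{b..c}|lborel. f r)"
proof -
  have 1: "set_integrable lborel {a..b} f" "set_integrable lborel {b<..c} f" "set_integrable lborel {b..c} f"
    using assms by (auto intro!: set_integrable_subset[OF f])
  have "{a..c} = {a..b} \<union> {b<..c}" using assms by auto
  hence "(LINT r:{a..c}|lborel. f r) = (LINT r:{a..b}|lborel. f r) + (LINT r:{b<..c}|lborel. f r)"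
    using 1 by (simp only:) (intro set_integral_Un, auto)
  also have "(LINT r:{b<..c}|lborel. f r) = (LINT r:{b..c}|lborel. f r)"
    unfolding set_lebesgue_integral_def
  proof (rule integral_cong_AE)
    show "AE r in lborel. indicator {b<..c} r *\<^sub>R f r = indicator {b..c} r *\<^sub>R f r"
      using AE_lborel_singleton[of b] by eventually_elim (auto simp: indicator_def)
  qed (use 1 in \<open>auto simp: set_integrable_def\<close>)
  finally show ?thesis .
qed

text \<open>\<open>g\<close> is merely integrable, so the chain rule comes from Fubini: the square
  of the total integral is twice the integral of \<open>h a * h b\<close> over the triangle
  \<open>a < b\<close>.\<close>

lemma indefinite_integral_square_from_0:
  fixes g :: "real \<Rightarrow> real"
  assumes g: "set_integrable lborel {0..t} g" and t: "0 \<le> t"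
  defines "G \<equiv> \<lambda>r. LINT s:{0..r}|lborel. g s"
  shows "(G t)\<^sup>2 = 2 * (LINT r:{0..t}|lborel. G r * g r)"
proof -
  define h where "h r = indicator {0..t} r * g r" for r
  have h: "integrable lborel h" using g by (simp add: set_integrable_def h_def[abs_def])
  have [measurable]: "h \<in> borel_measurable borel" using borel_measurable_integrable[OF h] by simp
  have hG: "(\<integral>a. h a * indicator {..r} a \<partial>lborel) = G r" if "r \<in> {0..t}" for r
    unfolding G_def set_lebesgue_integral_def h_def
    using that by (intro Bochner_Integration.integral_cong) (auto simp: indicator_def)
  have hG': "(\<integral>a. h a * indicator {..<r} a \<partial>lborel) = (\<integral>a. h a * indicator {..r} a \<partial>lborel)" for r
  proof (rule integral_cong_AE)
    show "AE a in lborel. h a * indicator {..<r} a = h a * indicator {..r} a"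
      using AE_lborel_singleton[of r] by eventually_elim (auto simp: indicator_def)
  qed measurable
  have i1: "integrable lborel (\<lambda>a. h a * indicator {..r} a)" "integrable lborel (\<lambda>a. h a * indicator {r<..} a)"
    "integrable lborel (\<lambda>a. h a * indicator {..<r} a)" for r
    using integrable_mult_indicator[OF _ h] by (simp_all add: mult.commute)
  define f where "f = (\<lambda>(a, b). h a * h b * indicator {(a, b). a < b} (a, b))"
  have [measurable]: "f \<in> borel_measurable (lborel \<Otimes>\<^sub>M lborel)"
    unfolding f_def by measurable
  have fb: "norm (f (a, b)) \<le> \<bar>h a\<bar> * \<bar>h b\<bar>" for a b
    by (auto simp: f_def indicator_def abs_mult)
  have fint: "integrable lborel (\<lambda>b. f (a, b))" for a
    by (rule Bochner_Integration.integrable_bound[where f = "\<lambda>b. h a * h b"])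
       (use h fb in \<open>auto simp: abs_mult intro!: AE_I2\<close>)
  have f: "integrable (lborel \<Otimes>\<^sub>M lborel) f"
  proof (rule lborel_pair.Fubini_integrable)
    show "integrable lborel (\<lambda>a. \<integral>b. norm (f (a, b)) \<partial>lborel)"
    proof (rule Bochner_Integration.integrable_bound[where f = "\<lambda>a. h a * (\<integral>b. \<bar>h b\<bar> \<partial>lborel)"])
      show "AE a in lborel. norm (\<integral>b. norm (f (a, b)) \<partial>lborel) \<le> norm (h a * (\<integral>b. \<bar>h b\<bar> \<partial>lborel))"
      proof (rule AE_I2)
        fix a
        have "(\<integral>b. norm (f (a, b)) \<partial>lborel) \<le> (\<integral>b. \<bar>h a\<bar> * \<bar>h b\<bar> \<partial>lborel)"
          using fint[of a] h fb by (intro integral_mono) auto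
        thus "norm (\<integral>b. norm (f (a, b)) \<partial>lborel) \<le> norm (h a * (\<integral>b. \<bar>h b\<bar> \<partial>lborel))"
          by (simp add: abs_mult)
      qed
    qed (use h in auto)
  qed (use fint in auto)
  have swap: "(\<integral>b. \<integral>a. f (a, b) \<partial>lborel \<partial>lborel) = (\<integral>a. \<integral>b. f (a, b) \<partial>lborel \<partial>lborel)"
    using lborel_pair.Fubini_integral[of "\<lambda>a b. f (a, b)"] f by simp
  have inner1: "(\<integral>a. f (a, b) \<partial>lborel) = h b * (\<integral>a. h a * indicator {..<b} a \<partial>lborel)" for b
  proof -
    have "f (a, b) = h b * (h a * indicator {..<b} a)" for a by (auto simp: f_def indicator_def)
    thus ?thesis by simp
  qed
  have inner2: "(\<integral>b. f (a, b) \<partial>lborel) = h a * (\<integral>b. h b * indicator {a<..} b \<partial>lborel)" for a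
  proof -
    have "f (a, b) = h a * (h b * indicator {a<..} b)" for b by (auto simp: f_def indicator_def)
    thus ?thesis by simp
  qed
  have X: "h r * (\<integral>a. h a * indicator {..r} a \<partial>lborel) = indicator {0..t} r *\<^sub>R (G r * g r)" for r
    using hG[of r] by (auto simp: h_def indicator_def)
  have if1: "integrable lborel (\<lambda>b. \<integral>a. f (a, b) \<partial>lborel)"
    using lborel_pair.integrable_snd[of "\<lambda>a b. f (a, b)"] f by simp
  have if2: "integrable lborel (\<lambda>a. \<integral>b. f (a, b) \<partial>lborel)"
    using lborel_pair.integrable_fst[of "\<lambda>a b. f (a, b)"] f by simp
  have I: "(\<integral>b. \<integral>a. f (a, b) \<partial>lborel \<partial>lborel) = (LINT r:{0..t}|lborel. G r * g r)"
    unfolding inner1 hG' X set_lebesgue_integral_def ..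
  have "(\<integral>r. h r \<partial>lborel) * (\<integral>r. h r \<partial>lborel)
      = (\<integral>r. (\<integral>a. f (a, r) \<partial>lborel) + (\<integral>b. f (r, b) \<partial>lborel) \<partial>lborel)"
  proof -
    have "h r * (\<integral>r. h r \<partial>lborel) = (\<integral>a. f (a, r) \<partial>lborel) + (\<integral>b. f (r, b) \<partial>lborel)" for r
    proof -
      have "(\<integral>a. h a \<partial>lborel) = (\<integral>a. h a * indicator {..r} a + h a * indicator {r<..} a \<partial>lborel)"
        by (intro Bochner_Integration.integral_cong) (auto simp: indicator_def)
      also have "\<dots> = (\<integral>a. h a * indicator {..r} a \<partial>lborel) + (\<integral>a. h a * indicator {r<..} a \<partial>lborel)"
        by (intro Bochner_Integration.integral_add i1)
      finally show ?thesis unfolding inner1 inner2 hG' by (simp add: distrib_left)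
    qed
    hence "(\<integral>r. h r * (\<integral>r. h r \<partial>lborel) \<partial>lborel)
      = (\<integral>r. (\<integral>a. f (a, r) \<partial>lborel) + (\<integral>b. f (r, b) \<partial>lborel) \<partial>lborel)" by simp
    thus ?thesis by simp
  qed
  also have "\<dots> = 2 * (\<integral>b. \<integral>a. f (a, b) \<partial>lborel \<partial>lborel)"
    using if1 if2 swap by simp
  finally have "(\<integral>r. h r \<partial>lborel) * (\<integral>r. h r \<partial>lborel) = 2 * (LINT r:{0..t}|lborel. G r * g r)"
    unfolding I .
  moreover have "(\<integral>r. h r \<partial>lborel) = G t"
    by (simp add: G_def set_lebesgue_integral_def h_def)
  ultimately show ?thesis by (simp add: power2_eq_square)
qed

lemma indefinite_integral_square:
  fixes g Y :: "real \<Rightarrow> real"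
  assumes g: "set_integrable lborel {0..T} g"
    and Y: "\<And>t. t \<in> {0..T} \<Longrightarrow> Y t = y + (LINT s:{0..t}|lborel. g s)"
    and Yg: "set_integrable lborel {0..T} (\<lambda>r. Y r * g r)"
    and st: "0 \<le> s" "s \<le> t" "t \<le> T"
  shows "(Y t)\<^sup>2 - (Y s)\<^sup>2 = 2 * (LINT r:{s..t}|lborel. Y r * g r)"
proof -
  have *: "(Y t)\<^sup>2 = y\<^sup>2 + 2 * (LINT r:{0..t}|lborel. Y r * g r)" if t: "t \<in> {0..T}" for t
  proof -
    define G where "G r = (LINT s:{0..r}|lborel. g s)" for r
    have gt: "set_integrable lborel {0..t} g" and Ygt: "set_integrable lborel {0..t} (\<lambda>r. Y r * g r)"
      using t by (auto intro!: set_integrable_subset[OF g] set_integrable_subset[OF Yg])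
    have "(LINT r:{0..t}|lborel. G r * g r) = (LINT r:{0..t}|lborel. Y r * g r - y * g r)"
      using t by (intro set_lebesgue_integral_cong) (auto simp: Y G_def algebra_simps)
    also have "\<dots> = (LINT r:{0..t}|lborel. Y r * g r) - y * G t"
      using gt Ygt by (subst set_integral_diff) (auto simp: G_def)
    finally have "(G t)\<^sup>2 = 2 * ((LINT r:{0..t}|lborel. Y r * g r) - y * G t)"
      using indefinite_integral_square_from_0[OF gt] t unfolding G_def by simp
    moreover have "Y t = y + G t" using Y[OF t] by (simp add: G_def)
    ultimately show ?thesis by (simp add: power2_sum algebra_simps)
  qed
  have "set_integrable lborel {0..t} (\<lambda>r. Y r * g r)"
    using st by (auto intro!: set_integrable_subset[OF Yg])
  hence "(LINT r:{0..t}|lborel. Y r * g r)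
      = (LINT r:{0..s}|lborel. Y r * g r) + (LINT r:{s..t}|lborel. Y r * g r)"
    by (rule set_integral_Icc_split) (use st in auto)
  thus ?thesis using *[of s] *[of t] st by simp
qed

section \<open>The monotone part of the nonlinearity\<close>

text \<open>A Taylor polynomial of artanh; twice the polynomial approximates ln((1 + u) / (1 - u)),
  which is singular at 1 and -1.\<close>

definition artanh_poly :: "nat \<Rightarrow> real \<Rightarrow> real" where
  "artanh_poly n u = (\<Sum>k=0..n. u ^ (2 * k + 1) / real (2 * k + 1))"

lemma f_approx_eq: "f_approx lam n u = - 2 * artanh_poly n u + lam * u"
  by (simp add: f_approx_def artanh_poly_def)

lemma continuous_artanh_poly [continuous_intros]: "continuous_on A (artanh_poly n)"
  unfolding artanh_poly_def by (intro continuous_intros) auto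

lemma borel_measurable_artanh_poly [measurable]: "artanh_poly n \<in> borel_measurable borel"
  by (intro borel_measurable_continuous_onI continuous_artanh_poly)

text \<open>The linear term alone has slope 1, and the higher odd powers are increasing.\<close>

lemma artanh_poly_mono_diff:
  assumes "b \<le> a"
  shows "a - b \<le> artanh_poly n a - artanh_poly n b"
proof -
  have "(a - b) = (\<Sum>k=0..n. if k = 0 then a - b else 0)" by simp
  also have "\<dots> \<le> (\<Sum>k=0..n. a ^ (2 * k + 1) / real (2 * k + 1) - b ^ (2 * k + 1) / real (2 * k + 1))"
  proof (rule sum_mono)
    fix k
    have "b ^ (2 * k + 1) \<le> a ^ (2 * k + 1)" using assms by (intro power_mono_odd) auto
    thus "(if k = 0 then a - b else 0) \<le> a ^ (2 * k + 1) / real (2 * k + 1) - b ^ (2 * k + 1) / real (2 * k + 1)"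
      by (auto simp: divide_right_mono)
  qed
  finally show ?thesis by (simp add: artanh_poly_def sum_subtractf)
qed

lemma artanh_poly_monotone: "(a - b)\<^sup>2 \<le> (a - b) * (artanh_poly n a - artanh_poly n b)"
proof (cases "b \<le> a")
  case True
  then show ?thesis
    using mult_left_mono[OF artanh_poly_mono_diff[OF True, of n], of "a - b"] by (simp add: power2_eq_square)
next
  case False
  then show ?thesis
    using mult_left_mono[OF artanh_poly_mono_diff[of a b n], of "b - a"]
    by (simp add: power2_eq_square algebra_simps)
qed

lemma abs_power_diff_le:
  fixes a b r :: real
  assumes "\<bar>a\<bar> \<le> r" "\<bar>b\<bar> \<le> r"
  shows "\<bar>a ^ Suc m - b ^ Suc m\<bar> \<le> real (Suc m) * r ^ m * \<bar>a - b\<bar>"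
proof -
  have "\<bar>\<Sum>p<Suc m. a ^ p * b ^ (m - p)\<bar> \<le> (\<Sum>p<Suc m. r ^ p * r ^ (m - p))"
    by (rule order_trans[OF sum_abs sum_mono])
       (use assms in \<open>auto simp: abs_mult power_abs intro!: mult_mono power_mono\<close>)
  also have "\<dots> = real (Suc m) * r ^ m" by (simp flip: power_add)
  finally show ?thesis
    unfolding power_diff_sumr2 abs_mult
    by (simp add: mult.commute mult_left_mono del: sum.lessThan_Suc of_nat_Suc)
qed

text \<open>The difference quotients of the summands are bounded by even powers of
  \<open>1 - \<delta>\<close>, and the geometric series gives a constant independent of
  \<open>n\<close>.\<close>

lemma artanh_poly_lipschitz:
  assumes "\<bar>a\<bar> \<le> 1 - \<delta>" "\<bar>b\<bar> \<le> 1 - \<delta>" "0 < \<delta>"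
  shows "\<bar>artanh_poly n a - artanh_poly n b\<bar> \<le> \<bar>a - b\<bar> / \<delta>"
proof -
  define r where "r = 1 - \<delta>"
  have r: "0 \<le> r" "r < 1" using assms by (auto simp: r_def)
  have "artanh_poly n a - artanh_poly n b
      = (\<Sum>k=0..n. (a ^ (2 * k + 1) - b ^ (2 * k + 1)) / real (2 * k + 1))"
    by (simp add: artanh_poly_def sum_subtractf diff_divide_distrib)
  also have "\<bar>\<dots>\<bar> \<le> (\<Sum>k=0..n. r ^ k * \<bar>a - b\<bar>)"
  proof (rule order_trans[OF sum_abs sum_mono])
    fix k
    have "\<bar>a ^ (2 * k + 1) - b ^ (2 * k + 1)\<bar> \<le> real (2 * k + 1) * r ^ (2 * k) * \<bar>a - b\<bar>"
      using abs_power_diff_le[of a r b "2 * k"] assms by (simp add: r_def)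
    hence "\<bar>(a ^ (2 * k + 1) - b ^ (2 * k + 1)) / real (2 * k + 1)\<bar> \<le> r ^ (2 * k) * \<bar>a - b\<bar>"
      by (simp add: field_simps)
    also have "\<dots> \<le> r ^ k * \<bar>a - b\<bar>" using r by (intro mult_right_mono power_decreasing) auto
    finally show "\<bar>(a ^ (2 * k + 1) - b ^ (2 * k + 1)) / real (2 * k + 1)\<bar> \<le> r ^ k * \<bar>a - b\<bar>" .
  qed
  also have "\<dots> = (\<Sum>k<Suc n. r ^ k) * \<bar>a - b\<bar>"
    by (simp add: sum_distrib_right atLeast0AtMost lessThan_Suc_atMost del: sum.lessThan_Suc)
  also have "\<dots> \<le> 1 / \<delta> * \<bar>a - b\<bar>"
  proof (rule mult_right_mono)
    have "(\<Sum>k<Suc n. r ^ k) = (1 - r ^ Suc n) / (1 - r)" using r by (subst sum_gp_strict) auto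
    also have "\<dots> \<le> 1 / (1 - r)" using r by (intro divide_right_mono) auto
    finally show "(\<Sum>k<Suc n. r ^ k) \<le> 1 / \<delta>" by (simp add: r_def)
  qed simp
  finally show ?thesis by simp
qed

lemma artanh_poly_0 [simp]: "artanh_poly n 0 = 0"
  by (simp add: artanh_poly_def)

lemma artanh_poly_bound:
  assumes "\<bar>a\<bar> \<le> 1 - \<delta>" "0 < \<delta>"
  shows "\<bar>artanh_poly n a\<bar> \<le> 1 / \<delta>"
proof -
  have "\<bar>artanh_poly n a\<bar> \<le> \<bar>a\<bar> / \<delta>" using artanh_poly_lipschitz[of a \<delta> 0 n] assms by simp
  also have "\<dots> \<le> 1 / \<delta>" using assms by (intro divide_right_mono) auto
  finally show ?thesis .
qed

text \<open>Controls the size of the nonlinearity by the dissipation, with constants independent of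
  \<open>n\<close>. Near \<open>b\<close> the argument stays away from 1 and -1; at distance at
  least \<open>\<delta>\<close> the increment is at most the product divided by
  \<open>\<delta>\<close>.\<close>

lemma artanh_poly_coercive:
  assumes b: "\<bar>b\<bar> \<le> 1 - 2 * \<delta>" and \<delta>: "0 < \<delta>"
  shows "\<bar>artanh_poly n a\<bar> \<le> 1 / \<delta> + (a - b) * (artanh_poly n a - artanh_poly n b) / \<delta>"
proof -
  have nn: "0 \<le> (a - b) * (artanh_poly n a - artanh_poly n b)"
    using artanh_poly_monotone[of a b n] zero_le_power2[of "a - b"] by linarith
  show ?thesis
  proof (cases "\<bar>a - b\<bar> < \<delta>")
    case True
    hence "\<bar>artanh_poly n a\<bar> \<le> 1 / \<delta>" using b \<delta> by (intro artanh_poly_bound) auto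
    thus ?thesis using nn \<delta> by (smt (verit) divide_nonneg_pos)
  next
    case False
    have "\<delta> * \<bar>artanh_poly n a - artanh_poly n b\<bar> \<le> \<bar>a - b\<bar> * \<bar>artanh_poly n a - artanh_poly n b\<bar>"
      using False by (intro mult_right_mono) auto
    also have "\<dots> = (a - b) * (artanh_poly n a - artanh_poly n b)"
      using nn by (simp flip: abs_mult)
    finally have "\<bar>artanh_poly n a - artanh_poly n b\<bar> \<le> (a - b) * (artanh_poly n a - artanh_poly n b) / \<delta>"
      using \<delta> by (simp add: field_simps)
    moreover have "\<bar>artanh_poly n b\<bar> \<le> 1 / \<delta>" using b \<delta> by (intro artanh_poly_bound) auto
    ultimately show ?thesis by linarith
  qed
qed

text \<open>The constant depends on \<open>n\<close> and serves integrability and limits; the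
  uniform estimates rest on \<open>artanh_poly_coercive\<close> and
  \<open>artanh_poly_lipschitz\<close>.\<close>

lemma artanh_poly_growth: "\<bar>artanh_poly n u\<bar> \<le> real (Suc n) * (1 + \<bar>u\<bar> ^ (2 * n + 1))"
proof -
  have "\<bar>artanh_poly n u\<bar> \<le> (\<Sum>k=0..n. 1 + \<bar>u\<bar> ^ (2 * n + 1))"
    unfolding artanh_poly_def
  proof (rule order_trans[OF sum_abs sum_mono])
    fix k assume k: "k \<in> {0..n}"
    have "\<bar>u ^ (2 * k + 1) / real (2 * k + 1)\<bar> \<le> \<bar>u\<bar> ^ (2 * k + 1) / 1"
      unfolding abs_divide power_abs by (intro frac_le) auto
    also have "\<dots> \<le> 1 + \<bar>u\<bar> ^ (2 * n + 1)"
    proof (cases "\<bar>u\<bar> \<le> 1")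
      case True
      hence "\<bar>u\<bar> ^ (2 * k + 1) \<le> 1" by (intro power_le_one) auto
      moreover have "0 \<le> \<bar>u\<bar> ^ (2 * n + 1)" by (rule zero_le_power) simp
      ultimately show ?thesis by linarith
    next
      case False
      hence "\<bar>u\<bar> ^ (2 * k + 1) \<le> \<bar>u\<bar> ^ (2 * n + 1)" using k by (intro power_increasing) auto
      thus ?thesis by simp
    qed
    finally show "\<bar>u ^ (2 * k + 1) / real (2 * k + 1)\<bar> \<le> 1 + \<bar>u\<bar> ^ (2 * n + 1)" .
  qed
  thus ?thesis by simp
qed

section \<open>Spatial estimates at a fixed time\<close>

lemma sum_eigfun_bound:
  assumes "\<And>k. \<bar>z k\<bar> \<le> h k" "summable h" "sqrt 2 * (\<Sum>k. h k) \<le> \<epsilon>"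
  shows "summable (\<lambda>k. z k * eigfun k \<theta>)" "\<bar>\<Sum>k. z k * eigfun k \<theta>\<bar> \<le> \<epsilon>"
proof -
  have le: "norm (z k * eigfun k \<theta>) \<le> sqrt 2 * h k" for k
    using mult_mono[OF assms(1)[of k] abs_eigfun_le[of k \<theta>]] abs_ge_zero[of "z k"] assms(1)[of k]
    by (simp add: abs_mult mult.commute)
  have sh: "summable (\<lambda>k. sqrt 2 * h k)" using assms(2) by (rule summable_mult)
  have sn: "summable (\<lambda>k. norm (z k * eigfun k \<theta>))"
    using le by (intro summable_comparison_test'[OF sh]) auto
  show "summable (\<lambda>k. z k * eigfun k \<theta>)" by (rule summable_norm_cancel[OF sn])
  have "\<bar>\<Sum>k. z k * eigfun k \<theta>\<bar> \<le> (\<Sum>k. norm (z k * eigfun k \<theta>))"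
    using summable_norm[OF sn] by simp
  also have "\<dots> \<le> (\<Sum>k. sqrt 2 * h k)" by (intro suminf_le le sn sh)
  also have "\<dots> = sqrt 2 * (\<Sum>k. h k)" using assms(2) by (rule suminf_mult)
  finally show "\<bar>\<Sum>k. z k * eigfun k \<theta>\<bar> \<le> \<epsilon>" using assms(3) by linarith
qed

lemma coeffs_sum_eigfun:
  assumes "\<And>k. \<bar>z k\<bar> \<le> h k" "summable h"
  shows "coeffs (\<lambda>\<theta>. \<Sum>k. z k * eigfun k \<theta>) j = z j"
proof -
  let ?t = "\<lambda>k \<theta>. z k * (eigfun k \<theta> * eigfun j \<theta>)"
  have ei: "integrable unit_lborel (\<lambda>\<theta>. eigfun k \<theta> * eigfun j \<theta>)" for k
    by (intro integrable_bounded_mult_eigfun integrable_continuous_unit[OF continuous_eigfun abs_eigfun_le])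
  have le: "norm (?t k \<theta>) \<le> 2 * h k" for k \<theta>
  proof -
    have "\<bar>eigfun k \<theta>\<bar> * \<bar>eigfun j \<theta>\<bar> \<le> sqrt 2 * sqrt 2"
      by (intro mult_mono abs_eigfun_le) auto
    hence "\<bar>z k\<bar> * (\<bar>eigfun k \<theta>\<bar> * \<bar>eigfun j \<theta>\<bar>) \<le> h k * 2"
      using assms(1)[of k] by (intro mult_mono) auto
    thus ?thesis by (simp add: abs_mult mult.commute)
  qed
  have sh: "summable (\<lambda>k. 2 * h k)" using assms(2) by (rule summable_mult)
  have sn: "summable (\<lambda>k. norm (?t k \<theta>))" for \<theta>
    using le by (intro summable_comparison_test'[OF sh]) auto
  have si: "summable (\<lambda>k. \<integral>\<theta>. norm (?t k \<theta>) \<partial>unit_lborel)"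
  proof (rule summable_comparison_test'[OF sh])
    fix k
    have "(\<integral>\<theta>. norm (?t k \<theta>) \<partial>unit_lborel) \<le> (\<integral>\<theta>. 2 * h k \<partial>unit_lborel)"
      using le[of k] ei by (intro integral_mono integrable_norm) auto
    thus "norm (\<integral>\<theta>. norm (?t k \<theta>) \<partial>unit_lborel) \<le> 2 * h k"
      using unit_lborel.prob_space by simp
  qed
  have "(\<integral>\<theta>. (\<Sum>k. ?t k \<theta>) \<partial>unit_lborel) = (\<Sum>k. \<integral>\<theta>. ?t k \<theta> \<partial>unit_lborel)"
    using sn si ei by (intro integral_suminf) auto
  also have "(\<lambda>k. \<integral>\<theta>. ?t k \<theta> \<partial>unit_lborel) = (\<lambda>k. if k = j then z j else 0)"
    using coeffs_eigfun by (auto simp: coeffs_eq)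
  also have "(\<Sum>k. if k = j then z j else 0) = z j" by (rule suminf_split_initial_segment[THEN trans, of _ "Suc j"]) auto
  also have "(\<lambda>\<theta>. \<Sum>k. ?t k \<theta>) = (\<lambda>\<theta>. (\<Sum>k. z k * eigfun k \<theta>) * eigfun j \<theta>)"
  proof
    fix \<theta>
    have "summable (\<lambda>k. z k * eigfun k \<theta>)"
      by (rule sum_eigfun_bound(1)[OF assms, of "sqrt 2 * (\<Sum>k. h k)"]) simp
    from suminf_mult2[OF this, of "eigfun j \<theta>"]
    show "(\<Sum>k. ?t k \<theta>) = (\<Sum>k. z k * eigfun k \<theta>) * eigfun j \<theta>" by (simp add: mult.assoc)
  qed
  finally show ?thesis by (simp add: coeffs_eq)
qed

text \<open>A slice \<open>U\<close> of the solution, compared with \<open>c + zhat\<close>, which stays away from \<open>\<plusminus>1\<close>.\<close>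

locale slice =
  fixes n :: nat and U zhat :: "real \<Rightarrow> real" and c \<delta> \<epsilon> :: real
  assumes U [measurable]: "U \<in> borel_measurable unit_lborel"
    and zhat [measurable]: "zhat \<in> borel_measurable unit_lborel"
    and Up: "integrable unit_lborel (\<lambda>\<theta>. \<bar>U \<theta>\<bar> ^ Suc (2 * n + 1))"
    and zb: "\<And>\<theta>. \<bar>zhat \<theta>\<bar> \<le> \<epsilon>" and \<delta>: "0 < \<delta>" "\<bar>c\<bar> + \<epsilon> \<le> 1 - 2 * \<delta>"
    and U0: "coeffs U 0 = c" and z0: "coeffs zhat 0 = 0"
begin

definition v :: "real \<Rightarrow> real" where "v \<theta> = U \<theta> - (c + zhat \<theta>)"

definition diss :: "real \<Rightarrow> real" where
  "diss \<theta> = (U \<theta> - (c + zhat \<theta>)) * (artanh_poly n (U \<theta>) - artanh_poly n (c + zhat \<theta>))"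

lemma v_measurable [measurable]: "v \<in> borel_measurable unit_lborel"
  unfolding v_def by measurable

lemma diss_measurable [measurable]: "diss \<in> borel_measurable unit_lborel"
  unfolding diss_def by measurable

lemma eps_nonneg: "0 \<le> \<epsilon>" and base_bound: "\<bar>c + zhat \<theta>\<bar> \<le> 1 - 2 * \<delta>"
  using \<delta> zb[of \<theta>] by auto

sublocale dual_pair "2 * n + 1" U "\<lambda>\<theta>. artanh_poly n (U \<theta>)" "real (Suc n)"
  by standard (use U Up artanh_poly_growth in \<open>auto simp del: power_Suc of_nat_Suc\<close>)

lemma v_power_le: "\<bar>v \<theta>\<bar> ^ Suc (2 * n + 1) \<le> 2 ^ Suc (2 * n + 1) * (1 + \<bar>U \<theta>\<bar> ^ Suc (2 * n + 1))"
proof -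
  have "\<bar>v \<theta>\<bar> \<le> \<bar>U \<theta>\<bar> + 1" using base_bound[of \<theta>] \<delta> by (auto simp: v_def)
  also have "\<dots> \<le> 2 * max 1 \<bar>U \<theta>\<bar>" by auto
  finally have "\<bar>v \<theta>\<bar> ^ Suc (2 * n + 1) \<le> (2 * max 1 \<bar>U \<theta>\<bar>) ^ Suc (2 * n + 1)"
    by (intro power_mono) auto
  also have "\<dots> = 2 ^ Suc (2 * n + 1) * (max 1 \<bar>U \<theta>\<bar>) ^ Suc (2 * n + 1)"
    by (rule power_mult_distrib)
  also have "(max 1 \<bar>U \<theta>\<bar>) ^ Suc (2 * n + 1) \<le> 1 + \<bar>U \<theta>\<bar> ^ Suc (2 * n + 1)"
    by (cases "1 \<le> \<bar>U \<theta>\<bar>") (auto simp: max_def simp del: power_Suc)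
  finally show ?thesis by simp
qed

lemma v_integrable_power: "integrable unit_lborel (\<lambda>\<theta>. \<bar>v \<theta>\<bar> ^ Suc (2 * n + 1))"
  by (rule Bochner_Integration.integrable_bound[where f = "\<lambda>\<theta>. 2 ^ Suc (2 * n + 1) * (1 + \<bar>U \<theta>\<bar> ^ Suc (2 * n + 1))"])
     (use Up v_power_le order_trans[OF v_power_le abs_ge_self] in \<open>auto simp del: power_Suc intro!: AE_I2\<close>)

lemma U_integrable': "integrable unit_lborel U"
  by (rule integrable_if_power[OF U Up])

lemma zhat_integrable: "integrable unit_lborel zhat"
  using zb by (intro unit_lborel.integrable_const_bound[of _ \<epsilon>]) auto

lemma v_integrable: "integrable unit_lborel v"
  unfolding v_def using U_integrable' zhat_integrable by auto

lemma coeffs_v: "coeffs v k = (if k = 0 then 0 else coeffs U k - coeffs zhat k)"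
proof -
  have "coeffs v k = coeffs U k - (coeffs (\<lambda>_. c) k + coeffs zhat k)"
    unfolding v_def using U_integrable' zhat_integrable
    by (subst coeffs_diff) (auto simp: coeffs_add)
  thus ?thesis using U0 z0 by (auto simp: coeffs_const)
qed

lemma vG_integrable: "integrable unit_lborel (\<lambda>\<theta>. v \<theta> * artanh_poly n (U \<theta>))"
  by (rule mult_integrable_bound(1)[OF v_measurable v_integrable_power, of 1]) simp

lemma v_base_integrable: "integrable unit_lborel (\<lambda>\<theta>. v \<theta> * artanh_poly n (c + zhat \<theta>))"
proof (rule Bochner_Integration.integrable_bound[where f = "\<lambda>\<theta>. v \<theta> * (1 / \<delta>)"])
  have "\<bar>artanh_poly n (c + zhat \<theta>)\<bar> \<le> 1 / \<delta>" for \<theta>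
    using base_bound[of \<theta>] \<delta> by (intro artanh_poly_bound) auto
  hence "\<bar>v \<theta>\<bar> * \<bar>artanh_poly n (c + zhat \<theta>)\<bar> \<le> \<bar>v \<theta>\<bar> * (1 / \<delta>)" for \<theta>
    by (intro mult_left_mono) auto
  thus "AE \<theta> in unit_lborel. norm (v \<theta> * artanh_poly n (c + zhat \<theta>)) \<le> norm (v \<theta> * (1 / \<delta>))"
    using \<delta> by (intro AE_I2) (simp add: abs_mult)
qed (use v_integrable in auto)

lemma diss_integrable: "integrable unit_lborel diss"
proof -
  have "diss = (\<lambda>\<theta>. v \<theta> * artanh_poly n (U \<theta>) - v \<theta> * artanh_poly n (c + zhat \<theta>))"
    by (auto simp: diss_def v_def algebra_simps)
  thus ?thesis using vG_integrable v_base_integrable by auto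
qed

lemma diss_ge: "(v \<theta>)\<^sup>2 \<le> diss \<theta>"
  unfolding diss_def v_def by (rule artanh_poly_monotone)

lemma integral_v: "(\<integral>\<theta>. v \<theta> \<partial>unit_lborel) = 0"
  using coeffs_v[of 0] by (simp add: coeffs_eq)

text \<open>The nonlinearity at \<open>U\<close> is split at \<open>c + zhat\<close> and at
  \<open>c\<close>. The first difference gives twice \<open>diss\<close>; the second has size
  \<open>\<epsilon> / \<delta>\<close>, and its pairing with \<open>v\<close> costs one copy of
  \<open>diss\<close>; the constant drops out because \<open>v\<close> has mean zero, that is,
  because the average is conserved.\<close>

lemma integral_vG_ge:
  "- 2 * (\<integral>\<theta>. v \<theta> * artanh_poly n (U \<theta>) \<partial>unit_lborel) \<le> - (\<integral>\<theta>. diss \<theta> \<partial>unit_lborel) + \<epsilon>\<^sup>2 / \<delta>\<^sup>2"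
proof -
  have "(\<integral>\<theta>. - 2 * (v \<theta> * artanh_poly n (U \<theta>)) \<partial>unit_lborel)
      \<le> (\<integral>\<theta>. - diss \<theta> - 2 * artanh_poly n c * v \<theta> + \<epsilon>\<^sup>2 / \<delta>\<^sup>2 \<partial>unit_lborel)"
  proof (rule integral_mono)
    fix \<theta>
    have "\<bar>artanh_poly n (c + zhat \<theta>) - artanh_poly n c\<bar> \<le> \<bar>(c + zhat \<theta>) - c\<bar> / \<delta>"
      using base_bound[of \<theta>] \<delta> eps_nonneg by (intro artanh_poly_lipschitz) auto
    also have "\<dots> \<le> \<epsilon> / \<delta>" using zb[of \<theta>] \<delta> by (intro divide_right_mono) auto
    finally have w: "\<bar>artanh_poly n (c + zhat \<theta>) - artanh_poly n c\<bar> \<le> \<epsilon> / \<delta>" .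
    define w where "w = artanh_poly n (c + zhat \<theta>) - artanh_poly n c"
    have "0 \<le> (v \<theta> + w)\<^sup>2" by simp
    hence "- 2 * (v \<theta> * w) \<le> (v \<theta>)\<^sup>2 + w\<^sup>2" by (simp add: power2_sum)
    moreover have "\<bar>w\<bar>\<^sup>2 \<le> (\<epsilon> / \<delta>)\<^sup>2" using w by (intro power_mono) (auto simp: w_def)
    ultimately have "- 2 * (v \<theta> * w) \<le> diss \<theta> + \<epsilon>\<^sup>2 / \<delta>\<^sup>2"
      using diss_ge[of \<theta>] by (simp add: power_divide)
    moreover have "- 2 * (v \<theta> * artanh_poly n (U \<theta>)) = - 2 * diss \<theta> - 2 * artanh_poly n c * v \<theta> - 2 * (v \<theta> * w)"
      by (simp add: diss_def v_def w_def algebra_simps)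
    ultimately show "- 2 * (v \<theta> * artanh_poly n (U \<theta>)) \<le> - diss \<theta> - 2 * artanh_poly n c * v \<theta> + \<epsilon>\<^sup>2 / \<delta>\<^sup>2"
      by linarith
  qed (use vG_integrable diss_integrable v_integrable in auto)
  also have "\<dots> = - (\<integral>\<theta>. diss \<theta> \<partial>unit_lborel) + \<epsilon>\<^sup>2 / \<delta>\<^sup>2"
    using diss_integrable v_integrable integral_v unit_lborel.prob_space by simp
  finally show ?thesis using vG_integrable by simp
qed

text \<open>The equations of the low modes need a bound of the nonlinear term that does not depend
  on \<open>n\<close>; the dissipation provides it.\<close>

lemma coeffs_G_bound:
  "\<bar>coeffs (\<lambda>\<theta>. artanh_poly n (U \<theta>)) k\<bar> \<le> 2 / \<delta> * (1 + (\<integral>\<theta>. diss \<theta> \<partial>unit_lborel))"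
proof -
  have "\<bar>coeffs (\<lambda>\<theta>. artanh_poly n (U \<theta>)) k\<bar> \<le> (\<integral>\<theta>. 2 / \<delta> * (1 + diss \<theta>) \<partial>unit_lborel)"
    unfolding coeffs_eq
  proof (rule order_trans[OF integral_abs_bound integral_mono])
    fix \<theta>
    have "\<bar>artanh_poly n (U \<theta>)\<bar> \<le> 1 / \<delta> + diss \<theta> / \<delta>"
      unfolding diss_def using base_bound \<delta> by (intro artanh_poly_coercive) auto
    moreover have "\<bar>eigfun k \<theta>\<bar> \<le> 2"
      using abs_eigfun_le[of k \<theta>] real_sqrt_le_mono[of 2 4] by simp
    ultimately have "\<bar>artanh_poly n (U \<theta>)\<bar> * \<bar>eigfun k \<theta>\<bar> \<le> (1 / \<delta> + diss \<theta> / \<delta>) * 2"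
      by (intro mult_mono) auto
    thus "\<bar>artanh_poly n (U \<theta>) * eigfun k \<theta>\<bar> \<le> 2 / \<delta> * (1 + diss \<theta>)"
      using \<delta> by (simp add: abs_mult field_simps)
  qed (use diss_integrable integrable_bounded_mult_eigfun[OF g_integrable] in auto)
  also have "\<dots> = 2 / \<delta> * (1 + (\<integral>\<theta>. diss \<theta> \<partial>unit_lborel))"
    using diss_integrable unit_lborel.prob_space by simp
  finally show ?thesis .
qed

text \<open>Index 0 may be left out because \<open>v\<close> has mean zero.\<close>

lemma galerkin_sum_eq:
  "(\<Sum>k\<in>{1..<m}. fejer_weight m k * ((coeffs U k - coeffs zhat k) * coeffs (\<lambda>\<theta>. artanh_poly n (U \<theta>)) k))
    = fejer_form m v (\<lambda>\<theta>. artanh_poly n (U \<theta>))"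
proof (cases "m = 0")
  case True
  then show ?thesis by (simp add: fejer_form_def)
next
  case False
  hence "{..<m} = insert 0 {1..<m}" by auto
  thus ?thesis unfolding fejer_form_def by (simp add: coeffs_v)
qed

lemma galerkin_sum_tendsto:
  "(\<lambda>m. \<Sum>k\<in>{1..<m}. fejer_weight m k * ((coeffs U k - coeffs zhat k) * coeffs (\<lambda>\<theta>. artanh_poly n (U \<theta>)) k))
    \<longlonglongrightarrow> (\<integral>\<theta>. v \<theta> * artanh_poly n (U \<theta>) \<partial>unit_lborel)"
  unfolding galerkin_sum_eq by (rule fejer_form_tendsto[OF v_measurable v_integrable_power])

text \<open>Uniform in \<open>m\<close>: this is the domination for the limit under the time
  integral.\<close>

lemma galerkin_sum_bound:
  "\<bar>\<Sum>k\<in>{1..<m}. fejer_weight m k * ((coeffs U k - coeffs zhat k) * coeffs (\<lambda>\<theta>. artanh_poly n (U \<theta>)) k)\<bar>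
    \<le> real (Suc n) * (1 + 2 * 2 ^ Suc (2 * n + 1)) * (1 + (\<integral>\<theta>. \<bar>U \<theta>\<bar> ^ Suc (2 * n + 1) \<partial>unit_lborel))"
proof (cases "m = 0")
  case True
  have "0 \<le> (\<integral>\<theta>. \<bar>U \<theta>\<bar> ^ Suc (2 * n + 1) \<partial>unit_lborel)" by (intro integral_nonneg_AE) auto
  then show ?thesis using True by simp
next
  case False
  have mass: "mass = 1 + (\<integral>\<theta>. \<bar>U \<theta>\<bar> ^ Suc (2 * n + 1) \<partial>unit_lborel)"
    unfolding mass_def using Up unit_lborel.prob_space by (simp del: power_Suc)
  have "(\<integral>\<theta>. \<bar>v \<theta>\<bar> ^ Suc (2 * n + 1) \<partial>unit_lborel)
      \<le> (\<integral>\<theta>. 2 ^ Suc (2 * n + 1) * (1 + \<bar>U \<theta>\<bar> ^ Suc (2 * n + 1)) \<partial>unit_lborel)"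
    using v_integrable_power Up v_power_le by (intro integral_mono) (auto simp del: power_Suc)
  also have "\<dots> = 2 ^ Suc (2 * n + 1) * mass"
    unfolding mass_def by simp
  finally have v: "(\<integral>\<theta>. \<bar>v \<theta>\<bar> ^ Suc (2 * n + 1) \<partial>unit_lborel) \<le> 2 ^ Suc (2 * n + 1) * mass" .
  have "\<bar>fejer_form m v (\<lambda>\<theta>. artanh_poly n (U \<theta>))\<bar>
     \<le> real (Suc n) * (mass / 1 + 2 * 1 ^ (2 * n + 1) * (\<integral>\<theta>. \<bar>v \<theta>\<bar> ^ Suc (2 * n + 1) \<partial>unit_lborel))"
    by (rule fejer_form_bound[OF v_measurable v_integrable_power]) (use False in auto)
  also have "\<dots> \<le> real (Suc n) * (mass / 1 + 2 * 1 ^ (2 * n + 1) * (2 ^ Suc (2 * n + 1) * mass))"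
    using v by (intro mult_left_mono add_left_mono) auto
  also have "\<dots> = real (Suc n) * (1 + 2 * 2 ^ Suc (2 * n + 1)) * mass"
    by (simp add: algebra_simps)
  finally show ?thesis unfolding galerkin_sum_eq mass .
qed

end

section \<open>The energy decay\<close>

text \<open>The real-variable core. \<open>E\<close> stands for the squared dual norm of the
  remainder, \<open>D\<close> for the dissipation, \<open>q\<close> for the squared displacement of
  the low modes from their start, \<open>\<kappa>\<close> for the noise error. As \<open>D\<close>
  is only integrable, the balance is in integrated form.\<close>

locale energy_balance =
  fixes E D q :: "real \<Rightarrow> real" and \<tau> \<kappa> \<Lambda> :: real
  assumes \<tau>: "0 < \<tau>" "\<tau> \<le> 1 / 4" and \<Lambda>: "0 \<le> \<Lambda>" and \<kappa>: "0 \<le> \<kappa>" "\<kappa> \<le> \<tau>"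
    and E_nonneg: "\<And>t. 0 \<le> E t" and D_nonneg: "\<And>t. 0 \<le> D t"
    and E_int: "set_integrable lborel {0..\<tau>} E" and D_int: "set_integrable lborel {0..\<tau>} D"
    and q_int: "set_integrable lborel {0..\<tau>} q"
    and balance: "\<And>s t. 0 \<le> s \<Longrightarrow> s \<le> t \<Longrightarrow> t \<le> \<tau> \<Longrightarrow>
      E t - E s \<le> (LINT r:{s..t}|lborel. - (1/2) * E r - D r + \<kappa> + \<Lambda> * q r)"
begin

lemma subint:
  assumes "0 \<le> s" "t \<le> \<tau>"
  shows "set_integrable lborel {s..t} E" "set_integrable lborel {s..t} D" "set_integrable lborel {s..t} q"
    "set_integrable lborel {s..t} (\<lambda>_. a :: real)"
  using assms
  by (auto intro: set_integrable_subset[OF E_int] set_integrable_subset[OF D_int]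
      set_integrable_subset[OF q_int] simp: borel_integrable_atLeastAtMost')

lemma integral_const_Icc: "s \<le> t \<Longrightarrow> (LINT r:{s..t}|lborel. a) = a * (t - s)" for a :: real
  by (simp add: set_lebesgue_integral_def measure_lborel_Icc)

lemma increment_le:
  assumes st: "0 \<le> s" "s \<le> t" "t \<le> \<tau>" and Q: "\<And>r. r \<in> {s..t} \<Longrightarrow> q r \<le> Q"
  shows "E t + (1/2) * (LINT r:{s..t}|lborel. E r) + (LINT r:{s..t}|lborel. D r) \<le> E s + (\<kappa> + \<Lambda> * Q) * (t - s)"
proof -
  note i = subint[OF st(1) st(3)]
  have "E t - E s \<le> (LINT r:{s..t}|lborel. - (1/2) * E r - D r + \<kappa> + \<Lambda> * q r)"
    by (rule balance[OF st])
  also have "\<dots> \<le> (LINT r:{s..t}|lborel. - (1/2) * E r - D r + (\<kappa> + \<Lambda> * Q))"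
  proof (rule set_integral_mono)
    show "set_integrable lborel {s..t} (\<lambda>r. - (1/2) * E r - D r + \<kappa> + \<Lambda> * q r)"
      by (intro set_integral_add set_integral_diff set_integrable_mult_right i)
    show "set_integrable lborel {s..t} (\<lambda>r. - (1/2) * E r - D r + (\<kappa> + \<Lambda> * Q))"
      by (intro set_integral_add set_integral_diff set_integrable_mult_right i)
    fix r assume "r \<in> {s..t}"
    hence "\<Lambda> * q r \<le> \<Lambda> * Q" using Q \<Lambda> by (intro mult_left_mono) auto
    thus "- (1/2) * E r - D r + \<kappa> + \<Lambda> * q r \<le> - (1/2) * E r - D r + (\<kappa> + \<Lambda> * Q)" by linarith
  qed
  also have "\<dots> = - (1/2) * (LINT r:{s..t}|lborel. E r) - (LINT r:{s..t}|lborel. D r) + (\<kappa> + \<Lambda> * Q) * (t - s)"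
  proof -
    have i1: "set_integrable lborel {s..t} (\<lambda>r. - (1/2) * E r)" by (intro set_integrable_mult_right i)
    show ?thesis
      unfolding set_integral_add(2)[OF set_integral_diff(1)[OF i1 i(2)] i(4)] set_integral_diff(2)[OF i1 i(2)]
        set_integral_mult_right integral_const_Icc[OF st(2)] ..
  qed
  finally show ?thesis by simp
qed

lemma set_integral_nonneg': "(\<And>r. 0 \<le> f r) \<Longrightarrow> 0 \<le> (LINT r:{s..t}|lborel. f r)" for f :: "real \<Rightarrow> real"
  unfolding set_lebesgue_integral_def by (intro integral_nonneg_AE) auto

lemma E_int_nonneg: "0 \<le> (LINT r:{s..t}|lborel. E r)" and D_int_nonneg: "0 \<le> (LINT r:{s..t}|lborel. D r)"
  by (rule set_integral_nonneg', rule E_nonneg) (rule set_integral_nonneg', rule D_nonneg)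

lemma energy_decay:
  assumes E0: "E 0 \<le> R" and bdd: "\<And>t. t \<in> {0..\<tau>} \<Longrightarrow> E t \<le> B" and L: "0 \<le> L" "0 \<le> L'"
    and q1: "\<And>t. t \<in> {0..\<tau>} \<Longrightarrow> q t \<le> L * (E t + E 0)"
    and q2: "\<And>t. (\<And>r. r \<in> {0..\<tau>} \<Longrightarrow> E r \<le> 2 * R + 2) \<Longrightarrow> t \<in> {0..\<tau>} \<Longrightarrow>
        q t \<le> L' * (\<tau> + (LINT r:{0..\<tau>}|lborel. D r))\<^sup>2"
    and small1: "\<tau> * (\<Lambda> * L) \<le> 1 / 4" and small2: "\<tau> * (\<Lambda> * L') * (4 * R + 4) \<le> 1"
    and small3: "2 * (\<tau> * (\<Lambda> * L')) \<le> 1"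
  shows "(1 + \<tau> / 2) * E \<tau> \<le> E 0 + (2 + (1 + \<Lambda> * L * (3 * R + 2)) / 2) * \<tau>\<^sup>2"
proof -
  have R: "0 \<le> R" using E0 E_nonneg[of 0] by linarith
  define S where "S = (SUP t\<in>{0..\<tau>}. E t)"
  have bdd': "bdd_above (E ` {0..\<tau>})" using bdd by (auto intro!: bdd_aboveI[where M = B])
  have S: "E t \<le> S" if "t \<in> {0..\<tau>}" for t
    unfolding S_def by (rule cSUP_upper[OF that bdd'])
  have S0: "0 \<le> S" using S[of 0] E_nonneg[of 0] \<tau> by simp
  have SL: "\<tau> * (\<Lambda> * (L * (S + R))) \<le> (S + R) / 4"
    using mult_right_mono[OF small1, of "S + R"] S0 R by (simp add: mult_ac)
  have step: "E t + (1/2) * (LINT r:{0..t}|lborel. E r) + (LINT r:{0..t}|lborel. D r) \<le> R + \<tau> + (S + R) / 4"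
    if t: "t \<in> {0..\<tau>}" for t
  proof -
    have "E t + (1/2) * (LINT r:{0..t}|lborel. E r) + (LINT r:{0..t}|lborel. D r)
        \<le> E 0 + (\<kappa> + \<Lambda> * (L * (S + R))) * (t - 0)"
    proof (rule increment_le)
      show "q r \<le> L * (S + R)" if "r \<in> {0..t}" for r
        using q1[of r] S[of r] that t E0 L by (intro order_trans[OF q1] mult_left_mono) auto
    qed (use t in auto)
    also have "\<dots> \<le> E 0 + (\<kappa> + \<Lambda> * (L * (S + R))) * \<tau>"
      using t \<kappa> \<Lambda> L S0 R by (intro add_left_mono mult_left_mono) auto
    also have "\<dots> \<le> R + \<tau> + (S + R) / 4"
    proof -
      have "\<kappa> * \<tau> \<le> 1 * \<tau>" using \<kappa> \<tau> by (intro mult_right_mono) auto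
      moreover have "(\<kappa> + \<Lambda> * (L * (S + R))) * \<tau> = \<kappa> * \<tau> + \<tau> * (\<Lambda> * (L * (S + R)))"
        by (simp add: algebra_simps)
      ultimately show ?thesis using E0 SL by linarith
    qed
    finally show ?thesis .
  qed
  have "E t \<le> R + \<tau> + (S + R) / 4" if t: "t \<in> {0..\<tau>}" for t
    using step[OF t] E_int_nonneg[of 0 t] D_int_nonneg[of 0 t] by linarith
  \<comment> \<open>Self-bounding: the factor 1/4 in front of \<open>S\<close> allows moving it to
    the left, where it is finite by \<open>bdd\<close>.\<close>
  hence "S \<le> R + \<tau> + (S + R) / 4" unfolding S_def using \<tau> by (intro cSUP_least) auto
  hence S2: "S \<le> 2 * R + 2" using R \<tau> by argo
  define Dbar where "Dbar = (LINT r:{0..\<tau>}|lborel. D r)"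
  have Dbar: "0 \<le> Dbar" unfolding Dbar_def by (rule D_int_nonneg)
  have "Dbar \<le> R + \<tau> + (S + R) / 4"
    using step[of \<tau>] E_int_nonneg[of 0 \<tau>] E_nonneg[of \<tau>] \<tau> unfolding Dbar_def by auto
  hence Dbar2: "Dbar \<le> 2 * R + 2" using R \<tau> S2 by argo
  have Ele: "E r \<le> 2 * R + 2" if "r \<in> {0..\<tau>}" for r using S[OF that] S2 by linarith
  have qD: "q t \<le> L' * (\<tau> + Dbar)\<^sup>2" if "t \<in> {0..\<tau>}" for t
    unfolding Dbar_def by (rule q2[OF Ele that])
  \<comment> \<open>The dissipation enters the balance linearly and cannot absorb its own square;
    the a priori bound on \<open>Dbar\<close> makes the square linear.\<close>
  have "(\<tau> + Dbar)\<^sup>2 \<le> 2 * \<tau>\<^sup>2 + 2 * Dbar\<^sup>2"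
    using zero_le_power2[of "\<tau> - Dbar"] by (simp add: power2_sum power2_diff)
  also have "Dbar\<^sup>2 \<le> (2 * R + 2) * Dbar" using Dbar Dbar2 by (simp add: power2_eq_square mult_right_mono)
  finally have "\<Lambda> * L' * \<tau> * (\<tau> + Dbar)\<^sup>2 \<le> \<Lambda> * L' * \<tau> * (2 * \<tau>\<^sup>2 + 2 * ((2 * R + 2) * Dbar))"
    using \<Lambda> L \<tau> by (intro mult_left_mono) auto
  also have "\<dots> = 2 * (\<tau> * (\<Lambda> * L')) * \<tau>\<^sup>2 + \<tau> * (\<Lambda> * L') * (4 * R + 4) * Dbar" by (simp add: algebra_simps)
  also have "\<dots> \<le> 1 * \<tau>\<^sup>2 + 1 * Dbar"
    using small2 small3 Dbar by (intro add_mono mult_right_mono) auto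
  finally have absorb: "\<Lambda> * L' * \<tau> * (\<tau> + Dbar)\<^sup>2 \<le> \<tau>\<^sup>2 + Dbar" by simp
  have "E \<tau> + (1/2) * (LINT r:{0..\<tau>}|lborel. E r) + Dbar \<le> E 0 + (\<kappa> + \<Lambda> * (L' * (\<tau> + Dbar)\<^sup>2)) * (\<tau> - 0)"
    unfolding Dbar_def using \<tau> qD[unfolded Dbar_def] by (intro increment_le) auto
  hence main: "E \<tau> + (1/2) * (LINT r:{0..\<tau>}|lborel. E r) \<le> E 0 + 2 * \<tau>\<^sup>2"
  proof -
    have "\<kappa> * \<tau> \<le> \<tau> * \<tau>" using \<kappa> \<tau> by (intro mult_right_mono) auto
    moreover have "(\<kappa> + \<Lambda> * (L' * (\<tau> + Dbar)\<^sup>2)) * (\<tau> - 0) = \<kappa> * \<tau> + \<Lambda> * L' * \<tau> * (\<tau> + Dbar)\<^sup>2"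
      by (simp add: algebra_simps)
    moreover have "e + i \<le> e' + 2 * w" if "e + i + d \<le> e' + k" "a \<le> w" "k = a + b" "b \<le> w + d"
      for e i d e' k a b w :: real
      using that by linarith
    ultimately show ?thesis
      using absorb \<open>E \<tau> + _ + Dbar \<le> _\<close> unfolding power2_eq_square[of \<tau>] by blast
  qed
  define C where "C = 1 + \<Lambda> * L * (3 * R + 2)"
  \<comment> \<open>The growth in the remaining time is at most \<open>C * \<tau>\<close>, so the
    integral of \<open>E\<close> is \<open>\<tau> * E \<tau>\<close> from below up to order
    \<open>\<tau>\<^sup>2\<close>. This produces the factor \<open>1 + \<tau> / 2\<close>.\<close>
  have "E \<tau> - C * \<tau> \<le> E t" if t: "t \<in> {0..\<tau>}" for t
  proof -
    have "E \<tau> + (1/2) * (LINT r:{t..\<tau>}|lborel. E r) + (LINT r:{t..\<tau>}|lborel. D r)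
        \<le> E t + (\<kappa> + \<Lambda> * (L * (3 * R + 2))) * (\<tau> - t)"
    proof (rule increment_le)
      show "q r \<le> L * (3 * R + 2)" if "r \<in> {t..\<tau>}" for r
        using Ele[of r] that t E0 L by (intro order_trans[OF q1] mult_left_mono) auto
    qed (use t in auto)
    also have "(\<kappa> + \<Lambda> * (L * (3 * R + 2))) * (\<tau> - t) \<le> C * \<tau>"
      using t \<kappa> \<tau> \<Lambda> L R by (intro mult_mono) (auto simp: C_def mult_ac)
    finally show ?thesis
      using E_int_nonneg[of t \<tau>] D_int_nonneg[of t \<tau>] by linarith
  qed
  hence "(LINT r:{0..\<tau>}|lborel. E \<tau> - C * \<tau>) \<le> (LINT r:{0..\<tau>}|lborel. E r)"
    using \<tau> by (intro set_integral_mono subint) auto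
  hence "(E \<tau> - C * \<tau>) * \<tau> \<le> (LINT r:{0..\<tau>}|lborel. E r)"
    using \<tau> by (simp add: integral_const_Icc)
  hence "\<tau> * E \<tau> - C * \<tau>\<^sup>2 \<le> (LINT r:{0..\<tau>}|lborel. E r)"
    by (simp add: algebra_simps power2_eq_square)
  moreover have "(1 + \<tau> / 2) * E \<tau> = E \<tau> + (\<tau> * E \<tau>) / 2"
    "(2 + (1 + \<Lambda> * L * (3 * R + 2)) / 2) * \<tau>\<^sup>2 = 2 * \<tau>\<^sup>2 + (C * \<tau>\<^sup>2) / 2"
    by (simp_all add: C_def algebra_simps add_divide_distrib)
  moreover have "e + te / 2 \<le> e' + (2 * w + cw / 2)" if "te - cw \<le> i" "e + (1/2) * i \<le> e' + 2 * w"
    for e te e' w cw i :: real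
    using that by linarith
  ultimately show ?thesis using main by metis
qed

end

section \<open>The state space\<close>

definition ell :: "nat \<Rightarrow> real" where "ell k = (real k * pi)\<^sup>2"

lemma ell_0 [simp]: "ell 0 = 0"
  by (simp add: ell_def)

lemma eigval_ell: "eigval k = - ell k"
  by (simp add: eigval_def ell_def)

lemma ell_mono: "j \<le> k \<Longrightarrow> ell j \<le> ell k"
  unfolding ell_def by (intro power_mono mult_right_mono) auto

lemma ell_ge: "9 * (real k)\<^sup>2 \<le> ell k"
proof -
  have "3\<^sup>2 \<le> pi\<^sup>2" using pi_gt3 by (intro power_mono) auto
  thus ?thesis unfolding ell_def power_mult_distrib using mult_left_mono[of 9 "pi\<^sup>2" "(real k)\<^sup>2"] by (simp add: mult.commute)
qed

lemma ell_ge_9: "1 \<le> k \<Longrightarrow> 9 \<le> ell k"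
proof -
  assume "1 \<le> k"
  hence "1\<^sup>2 \<le> (real k)\<^sup>2" by (intro power_mono) auto
  thus ?thesis using ell_ge[of k] by simp
qed

lemma ell_nonneg [simp]: "0 \<le> ell k"
  by (simp add: ell_def)

lemma ell_powr: "(- eigval (Suc i)) powr (-1) = 1 / ell (Suc i)"
  by (simp add: eigval_ell powr_minus_divide)

lemma abs_eigval [simp]: "\<bar>eigval k\<bar> = ell k"
  by (simp add: eigval_ell)

lemma summable_coord: "summable (\<lambda>i. (coord x (Suc i))\<^sup>2 / ell (Suc i))"
  using coord_V[of x] by (simp add: V_def ell_powr)

lemma norm_H_square: "(norm x)\<^sup>2 = (\<Sum>i. (coord x (Suc i))\<^sup>2 / ell (Suc i)) + (coord x 0)\<^sup>2"
proof -
  have "0 \<le> (\<Sum>i. (coord x (Suc i))\<^sup>2 / ell (Suc i))"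
    by (intro suminf_nonneg summable_coord) simp
  thus ?thesis by (simp add: norm_H_eq V_norm_def V_seminorm_def ell_powr)
qed

lemma coord_square_le: "(coord x k)\<^sup>2 \<le> (1 + ell k) * (norm x)\<^sup>2"
proof (cases k)
  case 0
  have "0 \<le> (\<Sum>i. (coord x (Suc i))\<^sup>2 / ell (Suc i))"
    by (intro suminf_nonneg summable_coord) simp
  then show ?thesis using 0 by (simp add: norm_H_square)
next
  case (Suc i)
  have pos: "0 < ell k" using ell_ge_9[of k] Suc by simp
  have "(coord x (Suc i))\<^sup>2 / ell (Suc i) \<le> (\<Sum>i. (coord x (Suc i))\<^sup>2 / ell (Suc i))"
    using sum_le_suminf[OF summable_coord, of "{i}" x] by simp
  also have "\<dots> \<le> (norm x)\<^sup>2" unfolding norm_H_square by simp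
  finally have "(coord x k)\<^sup>2 \<le> ell k * (norm x)\<^sup>2" using pos Suc by (simp add: field_simps)
  also have "\<dots> \<le> (1 + ell k) * (norm x)\<^sup>2" by (intro mult_right_mono) auto
  finally show ?thesis .
qed

lemma bounded_linear_coord: "bounded_linear (\<lambda>x. coord x k)"
proof (rule bounded_linear_intro)
  fix x
  have "\<bar>coord x k\<bar> = sqrt ((coord x k)\<^sup>2)" by simp
  also have "\<dots> \<le> sqrt ((1 + ell k) * (norm x)\<^sup>2)" by (rule real_sqrt_le_mono[OF coord_square_le])
  also have "\<dots> = norm x * sqrt (1 + ell k)" by (simp add: real_sqrt_mult)
  finally show "norm (coord x k) \<le> norm x * sqrt (1 + ell k)" by simp
qed (simp_all add: coord_add coord_scaleR)

text \<open>The constant depends on \<open>n\<close>; the purpose is that the dissipation is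
  integrable in time.\<close>

lemma (in slice) integral_diss_le:
  "(\<integral>\<theta>. diss \<theta> \<partial>unit_lborel)
    \<le> (real (Suc n) * (1 + 2 * 2 ^ Suc (2 * n + 1)) + (1 + 2 ^ Suc (2 * n + 1)) / \<delta>)
      * (1 + (\<integral>\<theta>. \<bar>U \<theta>\<bar> ^ Suc (2 * n + 1) \<partial>unit_lborel))"
proof -
  let ?A = "real (Suc n)" and ?P = "2 ^ Suc (2 * n + 1) :: real"
  let ?C = "?A * (1 + 2 * ?P) + (1 + ?P) / \<delta>"
  have "(\<integral>\<theta>. diss \<theta> \<partial>unit_lborel) \<le> (\<integral>\<theta>. ?C * (1 + \<bar>U \<theta>\<bar> ^ Suc (2 * n + 1)) \<partial>unit_lborel)"
  proof (rule integral_mono)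
    fix \<theta>
    define w where "w = 1 + \<bar>U \<theta>\<bar> ^ Suc (2 * n + 1)"
    have w: "1 \<le> w" by (simp add: w_def)
    have vw: "\<bar>v \<theta>\<bar> ^ Suc (2 * n + 1) \<le> ?P * w" unfolding w_def by (rule v_power_le)
    have "\<bar>artanh_poly n (U \<theta>)\<bar> * \<bar>v \<theta>\<bar> \<le> ?A * (1 + \<bar>U \<theta>\<bar> ^ (2 * n + 1)) * \<bar>v \<theta>\<bar>"
      by (intro mult_right_mono artanh_poly_growth) auto
    also have "\<dots> = ?A * ((1 + \<bar>U \<theta>\<bar> ^ (2 * n + 1)) * \<bar>v \<theta>\<bar>)" by (simp only: mult.assoc)
    also have "\<dots> \<le> ?A * (w + 2 * (?P * w))"
    proof (rule mult_left_mono)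
      have "(1 + \<bar>U \<theta>\<bar> ^ (2 * n + 1)) * \<bar>v \<theta>\<bar> \<le> w / 1 + 2 * 1 ^ (2 * n + 1) * \<bar>v \<theta>\<bar> ^ Suc (2 * n + 1)"
        unfolding w_def by (rule young_power_1) auto
      thus "(1 + \<bar>U \<theta>\<bar> ^ (2 * n + 1)) * \<bar>v \<theta>\<bar> \<le> w + 2 * (?P * w)" using vw by (simp del: power_Suc)
    qed simp
    finally have 1: "\<bar>artanh_poly n (U \<theta>)\<bar> * \<bar>v \<theta>\<bar> \<le> ?A * (1 + 2 * ?P) * w" by (simp add: algebra_simps)
    have "\<bar>v \<theta>\<bar> \<le> w + ?P * w"
      using young_power[of 1 "\<bar>v \<theta>\<bar>" 1 "2 * n + 1"] vw w by (simp del: power_Suc)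
    hence "\<bar>v \<theta>\<bar> * (1 / \<delta>) \<le> (w + ?P * w) * (1 / \<delta>)" using \<delta> by (intro mult_right_mono) auto
    moreover have "\<bar>v \<theta>\<bar> * \<bar>artanh_poly n (c + zhat \<theta>)\<bar> \<le> \<bar>v \<theta>\<bar> * (1 / \<delta>)"
      using base_bound[of \<theta>] \<delta> by (intro mult_left_mono artanh_poly_bound) auto
    ultimately have 2: "\<bar>v \<theta>\<bar> * \<bar>artanh_poly n (c + zhat \<theta>)\<bar> \<le> (1 + ?P) / \<delta> * w" by (simp add: algebra_simps add_divide_distrib)
    have "diss \<theta> = v \<theta> * artanh_poly n (U \<theta>) - v \<theta> * artanh_poly n (c + zhat \<theta>)"
      by (simp add: diss_def v_def algebra_simps)
    also have "\<dots> \<le> \<bar>artanh_poly n (U \<theta>)\<bar> * \<bar>v \<theta>\<bar> + \<bar>v \<theta>\<bar> * \<bar>artanh_poly n (c + zhat \<theta>)\<bar>"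
      unfolding abs_mult[symmetric] mult.commute[of "artanh_poly n (U \<theta>)"] by linarith
    also have "\<dots> \<le> ?C * w" using 1 2 unfolding distrib_right by linarith
    finally show "diss \<theta> \<le> ?C * (1 + \<bar>U \<theta>\<bar> ^ Suc (2 * n + 1))" by (simp only: w_def)
  qed (use diss_integrable Up in \<open>auto simp del: power_Suc\<close>)
  also have "\<dots> = ?C * (1 + (\<integral>\<theta>. \<bar>U \<theta>\<bar> ^ Suc (2 * n + 1) \<partial>unit_lborel))"
    using Up unit_lborel.prob_space by (simp del: power_Suc)
  finally show ?thesis .
qed

text \<open>Tannery's theorem with the series itself as majorant. The shift by one matches the
  seminorm, which starts at mode 1.\<close>

lemma fejer_weighted_sum_tendsto:
  assumes c: "summable c" "\<And>i. 0 \<le> c i"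
  shows "(\<lambda>m. \<Sum>k\<in>{1..<m}. fejer_weight m k * c (k - 1)) \<longlonglongrightarrow> (\<Sum>i. c i)"
    and "(\<Sum>k\<in>{1..<m}. fejer_weight m k * c (k - 1)) \<le> (\<Sum>i. c i)"
proof -
  have eq: "(\<Sum>k\<in>{1..<m}. fejer_weight m k * c (k - 1)) = (\<Sum>i. fejer_weight m (Suc i) * c i)" for m
  proof -
    have "(\<Sum>k\<in>{1..<m}. fejer_weight m k * c (k - 1)) = (\<Sum>i<m - 1. fejer_weight m (Suc i) * c i)"
      by (rule sum.reindex_bij_witness[of _ Suc "\<lambda>k. k - 1"]) auto
    also have "\<dots> = (\<Sum>i. fejer_weight m (Suc i) * c i)"
      by (rule suminf_finite[symmetric]) (auto simp: fejer_weight_def)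
    finally show ?thesis .
  qed
  have le: "norm (fejer_weight m (Suc i) * c i) \<le> c i" for m i
    using mult_right_mono[OF fejer_weight_le_1[of m "Suc i"] c(2)[of i]] c(2)[of i] fejer_weight_nonneg[of m "Suc i"]
    by (simp add: abs_mult)
  have s: "summable (\<lambda>i. fejer_weight m (Suc i) * c i)" for m
    using le by (intro summable_comparison_test'[OF c(1)]) auto
  show "(\<Sum>k\<in>{1..<m}. fejer_weight m k * c (k - 1)) \<le> (\<Sum>i. c i)"
    unfolding eq by (intro suminf_le s c(1)) (use le[of m] in \<open>auto intro: order_trans[OF abs_ge_self]\<close>)
  have "(\<lambda>m. \<Sum>i. fejer_weight m (Suc i) * c i) \<longlonglongrightarrow> (\<Sum>i. c i)"
  proof -
    have "(\<lambda>m. fejer_weight m (Suc i) * c i) \<longlonglongrightarrow> c i" for i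
      using tendsto_mult[OF fejer_weight_tendsto tendsto_const, of "Suc i" "c i"] by simp
    moreover have "\<forall>\<^sub>F (i, m) in at_top \<times>\<^sub>F sequentially. norm (fejer_weight m (Suc i) * c i) \<le> c i"
      using le by (intro always_eventually) auto
    ultimately show ?thesis
      using tannerys_theorem[of "\<lambda>i m. fejer_weight m (Suc i) * c i" c sequentially c] c(1) by auto
  qed
  thus "(\<lambda>m. \<Sum>k\<in>{1..<m}. fejer_weight m k * c (k - 1)) \<longlonglongrightarrow> (\<Sum>i. c i)" unfolding eq .
qed

text \<open>The drift \<open>a\<^sub>k\<close> of the low modes cancels the destabilising part of the linear term; the high modes
  are stable by themselves.\<close>

lemma mode_dissipation:
  fixes Y Z y lam a :: real
  assumes l: "9 \<le> l" and a: "low \<Longrightarrow> a = - \<bar>lam\<bar> * l * y" "\<not> low \<Longrightarrow> a = 0" and high: "\<not> low \<Longrightarrow> 2 * lam \<le> l"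
  shows "2 * Y / l * (- (l\<^sup>2 / 2) * Y + l / 2 * (lam * (Y + Z)) + a)
    \<le> - (1/2) * (Y\<^sup>2 / l) + (if low then \<bar>lam\<bar> * (Y - y)\<^sup>2 else 0) + lam\<^sup>2 * Z\<^sup>2"
proof -
  have l0: "0 < l" using l by simp
  have split: "2 * Y / l * (- (l\<^sup>2 / 2) * Y + l / 2 * (lam * (Y + Z)) + a)
     = - l * Y\<^sup>2 + lam * Y\<^sup>2 + lam * Y * Z + 2 * Y * a / l"
    using l0 by (simp add: field_simps power2_eq_square)
  have "0 \<le> (Y / 2 - lam * Z)\<^sup>2" by simp
  hence YZ: "lam * Y * Z \<le> Y\<^sup>2 / 4 + lam\<^sup>2 * Z\<^sup>2" by (simp add: power2_diff power_divide power_mult_distrib algebra_simps)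
  have "Y\<^sup>2 / l \<le> Y\<^sup>2 / 1" using l by (intro divide_left_mono) auto
  hence Yl: "(1/2) * (Y\<^sup>2 / l) \<le> Y\<^sup>2 / 2" by simp
  have lY: "9 * Y\<^sup>2 \<le> l * Y\<^sup>2" using l by (intro mult_right_mono) auto
  have Y2: "0 \<le> Y\<^sup>2" by simp
  show ?thesis
  proof (cases low)
    case True
    \<comment> \<open>The slope is proportional to the initial value \<open>y\<close>, not to
      \<open>Y\<close>. Completing the square, it acts like
      \<open>- \<bar>lam\<bar> * Y\<^sup>2\<close> at the price of
      \<open>\<bar>lam\<bar> * (Y - y)\<^sup>2\<close>.\<close>
    have "2 * Y * a / l = - 2 * \<bar>lam\<bar> * (Y * y)" using a(1)[OF True] l0 by simp
    also have "\<dots> \<le> \<bar>lam\<bar> * ((Y - y)\<^sup>2 - Y\<^sup>2)"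
    proof -
      have "- 2 * (Y * y) \<le> (Y - y)\<^sup>2 - Y\<^sup>2" by (simp add: power2_diff)
      from mult_left_mono[OF this, of "\<bar>lam\<bar>"] show ?thesis by (simp add: mult_ac)
    qed
    finally have ya: "2 * Y * a / l \<le> \<bar>lam\<bar> * (Y - y)\<^sup>2 - \<bar>lam\<bar> * Y\<^sup>2" by (simp add: right_diff_distrib)
    have lamY: "lam * Y\<^sup>2 \<le> \<bar>lam\<bar> * Y\<^sup>2" by (intro mult_right_mono) auto
    show ?thesis unfolding split if_P[OF True] using ya lamY YZ Yl lY Y2 by linarith
  next
    case False
    have "lam * Y\<^sup>2 \<le> (l / 2) * Y\<^sup>2" using high[OF False] by (intro mult_right_mono) auto
    moreover have "l / 2 * Y\<^sup>2 = l * Y\<^sup>2 / 2" "2 * Y * a / l = 0" using a(2)[OF False] by simp_all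
    ultimately show ?thesis unfolding split if_not_P[OF False] using YZ Yl lY Y2 by linarith
  qed
qed

section \<open>A solution path driven by nearly straight noise\<close>

lemma measurable_pair_unit [measurable (raw)]:
  assumes "f \<in> borel_measurable (borel :: (real \<times> real) measure)"
  shows "f \<in> borel_measurable (borel \<Otimes>\<^sub>M unit_lborel)"
proof -
  have [measurable]: "(\<lambda>x. x) \<in> unit_lborel \<rightarrow>\<^sub>M borel" by (rule measurable_unit_lborel) simp
  have "(\<lambda>x. (fst x, snd x)) \<in> borel \<Otimes>\<^sub>M unit_lborel \<rightarrow>\<^sub>M (borel \<Otimes>\<^sub>M borel :: (real \<times> real) measure)"
    by measurable
  hence "(\<lambda>x. x) \<in> borel \<Otimes>\<^sub>M unit_lborel \<rightarrow>\<^sub>M (borel :: (real \<times> real) measure)" by (simp add: borel_prod)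
  from measurable_compose[OF this assms] show ?thesis by simp
qed

text \<open>A deterministic setting: one solution path with its representative \<open>u\<close>, the
  path \<open>w\<close> of the noise, and the convolution \<open>z\<close> that is left of
  \<open>w\<close> after removing the straight line of slope \<open>a\<close>.\<close>

locale controlled_path =
  fixes lam c \<delta> \<epsilon> \<tau> :: real and n N :: nat and y :: H and \<xi> :: "real \<Rightarrow> H"
    and w :: "real \<Rightarrow> nat \<Rightarrow> real" and z :: "nat \<Rightarrow> real \<Rightarrow> real" and h a :: "nat \<Rightarrow> real"
    and u :: "real \<times> real \<Rightarrow> real"
  assumes \<xi>_cont: "continuous_on {0..} \<xi>"
    and u_meas [measurable]: "u \<in> borel_measurable borel"
    and u_int: "\<And>T. T > 0 \<Longrightarrow> set_integrable lborel ({0<..<T} \<times> {0<..<1}) (\<lambda>z. \<bar>u z\<bar> ^ (2 * n + 2))"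
    and u_coeffs: "AE s in lborel. 0 < s \<longrightarrow> coord (\<xi> s) = coeffs (\<lambda>\<theta>. u (s, \<theta>))"
    and eqn: "\<And>t k. 0 \<le> t \<Longrightarrow> coord (\<xi> t) k = coord y k
            - 1/2 * (LINT s:{0..t}|lborel. laplace (laplace (coord (\<xi> s))) k
                       + laplace (coeffs (\<lambda>\<theta>. f_approx lam n (u (s, \<theta>)))) k)
            + w t k"
    and y_avg: "coord y 0 = c" and w_0: "\<And>t. t \<in> {0..\<tau>} \<Longrightarrow> w t 0 = 0"
    and \<tau>: "0 < \<tau>" "\<tau> \<le> 1 / 4"
    and h: "summable h" "\<And>k. 0 \<le> h k" "sqrt 2 * (\<Sum>k. h k) \<le> \<epsilon>"
    and z_cont: "\<And>k. continuous_on {0..\<tau>} (z k)"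
    and z_bound: "\<And>k t. t \<in> {0..\<tau>} \<Longrightarrow> \<bar>z k t\<bar> \<le> h k"
    and z_eq: "\<And>k t. t \<in> {0..\<tau>} \<Longrightarrow>
        z k t = w t k - a k * t - (eigval k)\<^sup>2 / 2 * (LINT s:{0..t}|lborel. z k s)"
    and a_def: "\<And>k. a k = (if 1 \<le> k \<and> k \<le> N then - \<bar>lam\<bar> * ell k * coord y k else 0)"
    and high: "\<And>k. N < k \<Longrightarrow> 2 * lam \<le> ell k"
    and \<delta>: "0 < \<delta>" "\<bar>c\<bar> + \<epsilon> \<le> 1 - 2 * \<delta>"
begin

text \<open>Clamping the time to \<open>[0, \<tau>]\<close> makes the coefficients continuous on the whole line.\<close>

definition clamp :: "real \<Rightarrow> real" where "clamp s = max 0 (min \<tau> s)"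
definition Z :: "nat \<Rightarrow> real \<Rightarrow> real" where "Z k s = (if k = 0 then 0 else z k (clamp s))"
text \<open>The remainder after subtracting the constant and the convolution; its equation contains
  no noise.\<close>

definition Y :: "nat \<Rightarrow> real \<Rightarrow> real" where "Y k s = coord (\<xi> (clamp s)) k - (if k = 0 then c else Z k s)"
definition zhat :: "real \<Rightarrow> real \<Rightarrow> real" where "zhat s \<theta> = (\<Sum>k. Z k s * eigfun k \<theta>)"
definition G :: "nat \<Rightarrow> real \<Rightarrow> real" where "G k s = coeffs (\<lambda>\<theta>. artanh_poly n (u (s, \<theta>))) k"
definition D :: "real \<Rightarrow> real" where
  "D s = (\<integral>\<theta>. (u (s, \<theta>) - (c + zhat s \<theta>)) * (artanh_poly n (u (s, \<theta>)) - artanh_poly n (c + zhat s \<theta>)) \<partial>unit_lborel)"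
definition F :: "real \<Rightarrow> real" where "F s = (\<integral>\<theta>. \<bar>u (s, \<theta>)\<bar> ^ Suc (2 * n + 1) \<partial>unit_lborel)"
text \<open>The full pairing of the remainder with the nonlinearity, as opposed to its weighted
  finite sums. Inside the locale the name hides the space \<open>V\<close>.\<close>

definition V :: "real \<Rightarrow> real" where
  "V s = (\<integral>\<theta>. (u (s, \<theta>) - (c + zhat s \<theta>)) * artanh_poly n (u (s, \<theta>)) \<partial>unit_lborel)"
definition E :: "real \<Rightarrow> real" where "E s = (\<Sum>i. (Y (Suc i) s)\<^sup>2 / ell (Suc i))"
definition q :: "real \<Rightarrow> real" where "q s = (\<Sum>k\<in>{1..N}. (Y k s - coord y k)\<^sup>2)"
text \<open>The density whose integral is \<open>Y k\<close>: the convolution has taken over the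
  noise except for its straight part, which leaves the slope \<open>a k\<close>.\<close>

definition g :: "nat \<Rightarrow> real \<Rightarrow> real" where
  "g k s = - ((ell k)\<^sup>2 / 2) * Y k s + ell k / 2 * (- 2 * G k s + lam * (Y k s + Z k s)) + a k"

lemma clamp_in: "clamp s \<in> {0..\<tau>}" using \<tau> by (auto simp: clamp_def)
lemma clamp_id: "s \<in> {0..\<tau>} \<Longrightarrow> clamp s = s" by (auto simp: clamp_def)
lemma clamp_cont: "continuous_on A clamp" unfolding clamp_def by (intro continuous_intros)

lemma eps: "0 \<le> \<epsilon>" "\<epsilon> < 1"
proof -
  have "0 \<le> sqrt 2 * (\<Sum>k. h k)" using suminf_nonneg[OF h(1,2)] by simp
  thus "0 \<le> \<epsilon>" using h(3) by linarith
  show "\<epsilon> < 1" using \<delta> by linarith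
qed

lemma Z_cont: "continuous_on UNIV (Z k)"
proof (cases "k = 0")
  case False
  have "continuous_on UNIV (\<lambda>s. z k (clamp s))"
    using clamp_in by (intro continuous_on_compose2[OF z_cont[of k] clamp_cont]) auto
  thus ?thesis using False by (simp add: Z_def[abs_def])
qed (simp add: Z_def[abs_def])

lemma Z_bound: "\<bar>Z k s\<bar> \<le> h k"
  using z_bound[OF clamp_in, of k s] h(2)[of k] by (auto simp: Z_def)

lemma Y_cont: "continuous_on UNIV (Y k)"
proof -
  have "continuous_on UNIV (\<lambda>s. \<xi> (clamp s))"
    using clamp_in by (intro continuous_on_compose2[OF \<xi>_cont clamp_cont]) auto
  hence "continuous_on UNIV (\<lambda>s. coord (\<xi> (clamp s)) k)"
    by (rule bounded_linear.continuous_on[OF bounded_linear_coord])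
  thus ?thesis unfolding Y_def by (cases "k = 0") (auto intro!: continuous_intros Z_cont)
qed

lemma measurable_YZ [measurable]: "Y k \<in> borel_measurable borel" "Z k \<in> borel_measurable borel"
  by (intro borel_measurable_continuous_onI Y_cont Z_cont)+

lemma zhat_measurable [measurable]: "(\<lambda>x. zhat (fst x) (snd x)) \<in> borel_measurable borel"
proof -
  have "(\<lambda>x. zhat (fst x) (snd x)) \<in> borel_measurable (borel \<Otimes>\<^sub>M borel :: (real \<times> real) measure)"
    unfolding zhat_def by measurable
  thus ?thesis by (simp add: borel_prod)
qed

lemma zhat_slice_measurable: "zhat s \<in> borel_measurable borel"
  unfolding zhat_def by measurable

lemma zhat_bound: "\<bar>zhat s \<theta>\<bar> \<le> \<epsilon>"
  unfolding zhat_def by (rule sum_eigfun_bound(2)[OF Z_bound h(1,3)])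

lemma coeffs_zhat: "coeffs (zhat s) k = Z k s"
  unfolding zhat_def[abs_def] by (rule coeffs_sum_eigfun[OF Z_bound h(1)])

lemma Z_square_sum: "(\<Sum>k\<in>{1..<m}. (Z k s)\<^sup>2) \<le> \<epsilon>\<^sup>2"
proof -
  have nn: "0 \<le> (\<Sum>k. h k)" by (rule suminf_nonneg[OF h(1,2)])
  have hk: "h k \<le> (\<Sum>k. h k)" for k using sum_le_suminf[OF h(1), of "{k}"] h(2) by simp
  have "(\<Sum>k\<in>{1..<m}. (Z k s)\<^sup>2) \<le> (\<Sum>k\<in>{1..<m}. h k * (\<Sum>k. h k))"
  proof (rule sum_mono)
    fix k
    have "(Z k s)\<^sup>2 = \<bar>Z k s\<bar> * \<bar>Z k s\<bar>" by (simp add: power2_eq_square)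
    also have "\<dots> \<le> h k * (\<Sum>k. h k)"
      using Z_bound[of k s] hk[of k] h(2)[of k] by (intro mult_mono) auto
    finally show "(Z k s)\<^sup>2 \<le> h k * (\<Sum>k. h k)" .
  qed
  also have "\<dots> = (\<Sum>k\<in>{1..<m}. h k) * (\<Sum>k. h k)" by (simp add: sum_distrib_right)
  also have "\<dots> \<le> (\<Sum>k. h k) * (\<Sum>k. h k)"
    using nn h by (intro mult_right_mono sum_le_suminf) auto
  also have "\<dots> \<le> \<epsilon> * \<epsilon>"
  proof -
    have "(\<Sum>k. h k) \<le> sqrt 2 * (\<Sum>k. h k)" using nn by (simp add: mult_le_cancel_right1)
    hence "(\<Sum>k. h k) \<le> \<epsilon>" using h(3) by linarith
    thus ?thesis using nn by (intro mult_mono) auto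
  qed
  finally show ?thesis by (simp add: power2_eq_square)
qed

lemma measurable_DGFV [measurable]:
  "D \<in> borel_measurable borel" "G k \<in> borel_measurable borel" "F \<in> borel_measurable borel"
proof -
  have zu[measurable]: "(\<lambda>x. zhat (fst x) (snd x)) \<in> borel_measurable (borel \<Otimes>\<^sub>M unit_lborel)"
    "(\<lambda>x. u (fst x, snd x)) \<in> borel_measurable (borel \<Otimes>\<^sub>M unit_lborel)"
    using measurable_pair_unit[OF zhat_measurable] measurable_pair_unit[OF u_meas] by simp_all
  have e[measurable]: "(\<lambda>x. eigfun k (snd x)) \<in> borel_measurable (borel \<Otimes>\<^sub>M unit_lborel)" for k
    by (rule measurable_compose[OF measurable_snd measurable_unit_lborel[OF borel_measurable_eigfun]])
  show "D \<in> borel_measurable borel"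
    unfolding D_def
    by (rule unit_lborel.borel_measurable_lebesgue_integral) (simp add: case_prod_beta')
  show "G k \<in> borel_measurable borel"
    unfolding G_def coeffs_eq
    by (rule unit_lborel.borel_measurable_lebesgue_integral) (simp add: case_prod_beta')
  show "F \<in> borel_measurable borel"
    unfolding F_def
    by (rule unit_lborel.borel_measurable_lebesgue_integral) (simp add: case_prod_beta')
qed

lemma AE_slice:
  "AE s in lborel. s \<in> {0..\<tau>} \<longrightarrow> slice n (\<lambda>\<theta>. u (s, \<theta>)) (zhat s) c \<delta> \<epsilon>
      \<and> (\<forall>k. coeffs (\<lambda>\<theta>. u (s, \<theta>)) k = coord (\<xi> s) k)"
  and F_integrable: "set_integrable lborel {0..\<tau>} F"
proof -
  \<comment> \<open>The time interval (0, 1) suffices because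
    \<open>\<tau> \<le> 1 / 4\<close>.\<close>
  have int: "integrable (lborel \<Otimes>\<^sub>M lborel) (\<lambda>z. indicator ({0<..<1} \<times> {0<..<1}) z *\<^sub>R \<bar>u z\<bar> ^ (2 * n + 2))"
    using u_int[of 1] by (simp add: set_integrable_def lborel_prod)
  have split: "indicator ({0<..<1} \<times> {0<..<1}) (s, \<theta>) = (indicator {0<..<1} s * indicator {0<..<1} \<theta> :: real)" for s \<theta> :: real
    by (auto simp: indicator_def)
  have AE1: "AE s in lborel. integrable lborel (\<lambda>\<theta>. (indicator {0<..<1} s * indicator {0<..<1} \<theta>) *\<^sub>R \<bar>u (s, \<theta>)\<bar> ^ (2 * n + 2))"
    using lborel_pair.AE_integrable_fst'[OF int] unfolding split .
  have pos: "AE s in lborel. s \<in> {0..\<tau>} \<longrightarrow> s \<in> {0<..<1::real}"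
    using AE_lborel_singleton[of 0] by eventually_elim (use \<tau> in auto)
  \<comment> \<open>Mode 0 has eigenvalue 0 and no noise, so the average is conserved.\<close>
  have c0: "coord (\<xi> s) 0 = c" if "s \<in> {0..\<tau>}" for s
    using eqn[of s 0] w_0[OF that] that y_avg
    by (simp add: laplace_def diag_op_def eigval_def)
  show "AE s in lborel. s \<in> {0..\<tau>} \<longrightarrow> slice n (\<lambda>\<theta>. u (s, \<theta>)) (zhat s) c \<delta> \<epsilon>
      \<and> (\<forall>k. coeffs (\<lambda>\<theta>. u (s, \<theta>)) k = coord (\<xi> s) k)"
    using AE1 pos u_coeffs
  proof eventually_elim
    case (elim s)
    show ?case
    proof
      assume s: "s \<in> {0..\<tau>}"
      hence s1: "0 < s" "s < 1" using elim(2) by auto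
      have co: "coord (\<xi> s) = coeffs (\<lambda>\<theta>. u (s, \<theta>))" using elim(3) s1 by simp
      have "slice n (\<lambda>\<theta>. u (s, \<theta>)) (zhat s) c \<delta> \<epsilon>"
      proof
        show "(\<lambda>\<theta>. u (s, \<theta>)) \<in> borel_measurable unit_lborel"
          by (intro measurable_unit_lborel) measurable
        show "zhat s \<in> borel_measurable unit_lborel"
          by (intro measurable_unit_lborel zhat_slice_measurable)
        show "integrable unit_lborel (\<lambda>\<theta>. \<bar>u (s, \<theta>)\<bar> ^ Suc (2 * n + 1))"
          using elim(1) s1 by (simp add: integrable_unit_lborel set_integrable_def)
        show "coeffs (\<lambda>\<theta>. u (s, \<theta>)) 0 = c" using c0[OF s] co by simp
        show "coeffs (zhat s) 0 = 0" by (simp add: coeffs_zhat Z_def)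
      qed (use zhat_bound \<delta> in auto)
      thus "slice n (\<lambda>\<theta>. u (s, \<theta>)) (zhat s) c \<delta> \<epsilon> \<and> (\<forall>k. coeffs (\<lambda>\<theta>. u (s, \<theta>)) k = coord (\<xi> s) k)"
        using co by simp
    qed
  qed
  have "integrable lborel (\<lambda>s. \<integral>\<theta>. (indicator {0<..<1} s * indicator {0<..<1} \<theta>) *\<^sub>R \<bar>u (s, \<theta>)\<bar> ^ (2 * n + 2) \<partial>lborel)"
    using lborel_pair.integrable_fst'[OF int] unfolding split .
  moreover have "(\<integral>\<theta>. (indicator {0<..<1} s * indicator {0<..<1} \<theta>) *\<^sub>R \<bar>u (s, \<theta>)\<bar> ^ (2 * n + 2) \<partial>lborel)
      = indicator {0<..<1} s *\<^sub>R F s" for s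
    by (simp add: F_def integral_unit_lborel set_lebesgue_integral_def mult.assoc)
  ultimately have F1: "set_integrable lborel {0<..<1} F" by (simp add: set_integrable_def)
  have F2: "set_integrable lborel {0<..\<tau>} F" using \<tau> by (intro set_integrable_subset[OF F1]) auto
  have "set_integrable lborel ({0} \<union> {0<..\<tau>}) F"
  proof (rule set_integrable_Un[OF _ F2])
    have "AE x in lborel. indicator {0} x *\<^sub>R F x = 0"
      using AE_lborel_singleton[of "0::real"] by eventually_elim auto
    thus "set_integrable lborel {0} F"
      unfolding set_integrable_def by (subst integrable_cong_AE[where g = "\<lambda>_. 0"]) (auto intro!: borel_measurable_scaleR)
  qed auto
  moreover have "{0} \<union> {0<..\<tau>} = {0..\<tau>}" using \<tau> by auto
  ultimately show "set_integrable lborel {0..\<tau>} F" by simp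
qed

lemma D_nonneg: "0 \<le> D s"
  unfolding D_def
proof (intro integral_nonneg_AE AE_I2)
  fix \<theta>
  show "0 \<le> (u (s, \<theta>) - (c + zhat s \<theta>)) * (artanh_poly n (u (s, \<theta>)) - artanh_poly n (c + zhat s \<theta>))"
    using artanh_poly_monotone[of "u (s, \<theta>)" "c + zhat s \<theta>" n] zero_le_power2[of "u (s, \<theta>) - (c + zhat s \<theta>)"]
    by linarith
qed

lemma F_nonneg: "0 \<le> F s"
  unfolding F_def by (intro integral_nonneg_AE) auto

lemma set_integrable_bounded_by:
  fixes f b :: "real \<Rightarrow> real"
  assumes "set_integrable lborel {0..\<tau>} b" "f \<in> borel_measurable borel"
    and "AE s in lborel. s \<in> {0..\<tau>} \<longrightarrow> \<bar>f s\<bar> \<le> b s"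
  shows "set_integrable lborel {0..\<tau>} f"
  using assms unfolding set_integrable_def
  by (elim Bochner_Integration.integrable_bound) (auto elim!: eventually_mono simp: indicator_def)

lemma const_integrable: "set_integrable lborel {0..\<tau>} (\<lambda>_. r :: real)"
  by (intro borel_integrable_atLeastAtMost') auto

text \<open>\<open>C\<close> depends on \<open>n\<close> and is used for integrability and
  domination only. The bounds on \<open>G\<close> and on \<open>V\<close>, which enter the
  estimates, are free of \<open>n\<close>.\<close>

lemma AE_bounds:
  obtains C where "0 \<le> C"
    "AE s in lborel. s \<in> {0..\<tau>} \<longrightarrow> D s \<le> C * (1 + F s)"
    "AE s in lborel. s \<in> {0..\<tau>} \<longrightarrow> (\<forall>m. \<bar>\<Sum>k\<in>{1..<m}. fejer_weight m k * (Y k s * G k s)\<bar> \<le> C * (1 + F s))"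
    "AE s in lborel. s \<in> {0..\<tau>} \<longrightarrow> (\<forall>k. \<bar>G k s\<bar> \<le> 2 / \<delta> * (1 + D s))"
    "AE s in lborel. s \<in> {0..\<tau>} \<longrightarrow> (\<lambda>m. \<Sum>k\<in>{1..<m}. fejer_weight m k * (Y k s * G k s)) \<longlonglongrightarrow> V s"
    "AE s in lborel. s \<in> {0..\<tau>} \<longrightarrow> - 2 * V s \<le> - D s + \<epsilon>\<^sup>2 / \<delta>\<^sup>2"
proof -
  define P where "P = (2 ^ Suc (2 * n + 1) :: real)"
  define C where "C = real (Suc n) * (1 + 2 * P) + (1 + P) / \<delta>"
  have P0: "0 \<le> P" by (simp add: P_def)
  have C0: "0 \<le> C" and C1: "real (Suc n) * (1 + 2 * P) \<le> C" using P0 \<delta> by (auto simp: C_def)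
  have sl: "D s \<le> C * (1 + F s)
      \<and> (\<forall>m. \<bar>\<Sum>k\<in>{1..<m}. fejer_weight m k * (Y k s * G k s)\<bar> \<le> C * (1 + F s))
      \<and> (\<forall>k. \<bar>G k s\<bar> \<le> 2 / \<delta> * (1 + D s))
      \<and> (\<lambda>m. \<Sum>k\<in>{1..<m}. fejer_weight m k * (Y k s * G k s)) \<longlonglongrightarrow> V s
      \<and> - 2 * V s \<le> - D s + \<epsilon>\<^sup>2 / \<delta>\<^sup>2"
    if s: "s \<in> {0..\<tau>}" and "slice n (\<lambda>\<theta>. u (s, \<theta>)) (zhat s) c \<delta> \<epsilon>"
      and co: "\<And>k. coeffs (\<lambda>\<theta>. u (s, \<theta>)) k = coord (\<xi> s) k" for s
  proof -
    interpret sl: slice n "\<lambda>\<theta>. u (s, \<theta>)" "zhat s" c \<delta> \<epsilon> by fact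
    have D: "D s = (\<integral>\<theta>. sl.diss \<theta> \<partial>unit_lborel)" by (simp add: D_def sl.diss_def)
    have Vs: "V s = (\<integral>\<theta>. sl.v \<theta> * artanh_poly n (u (s, \<theta>)) \<partial>unit_lborel)" by (simp add: V_def sl.v_def)
    have sums: "(\<Sum>k\<in>{1..<m}. fejer_weight m k * (Y k s * G k s))
       = (\<Sum>k\<in>{1..<m}. fejer_weight m k * ((coeffs (\<lambda>\<theta>. u (s, \<theta>)) k - coeffs (zhat s) k)
            * coeffs (\<lambda>\<theta>. artanh_poly n (u (s, \<theta>))) k))" for m
      by (intro sum.cong refl) (simp add: Y_def G_def co coeffs_zhat clamp_id[OF s])
    have F1: "0 \<le> 1 + F s" using F_nonneg[of s] by linarith
    show ?thesis
    proof (intro conjI allI)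
      show "D s \<le> C * (1 + F s)" using sl.integral_diss_le unfolding D F_def C_def P_def .
      show "\<bar>\<Sum>k\<in>{1..<m}. fejer_weight m k * (Y k s * G k s)\<bar> \<le> C * (1 + F s)" for m
        unfolding sums
        by (rule order_trans[OF sl.galerkin_sum_bound])
           (use mult_right_mono[OF C1 F1] in \<open>simp only: F_def P_def\<close>)
      show "\<bar>G k s\<bar> \<le> 2 / \<delta> * (1 + D s)" for k unfolding G_def D by (rule sl.coeffs_G_bound)
      show "(\<lambda>m. \<Sum>k\<in>{1..<m}. fejer_weight m k * (Y k s * G k s)) \<longlonglongrightarrow> V s"
        unfolding sums Vs by (rule sl.galerkin_sum_tendsto)
      show "- 2 * V s \<le> - D s + \<epsilon>\<^sup>2 / \<delta>\<^sup>2" unfolding D Vs by (rule sl.integral_vG_ge)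
    qed
  qed
  show ?thesis
    by (rule that[OF C0]; use AE_slice in eventually_elim; use sl in blast)
qed

lemma D_integrable: "set_integrable lborel {0..\<tau>} D"
proof -
  obtain C where C: "AE s in lborel. s \<in> {0..\<tau>} \<longrightarrow> D s \<le> C * (1 + F s)" using AE_bounds by blast
  have "set_integrable lborel {0..\<tau>} (\<lambda>s. C * (1 + F s))"
    by (intro set_integrable_mult_right set_integral_add const_integrable F_integrable)
  thus ?thesis
  proof (rule set_integrable_bounded_by)
    show "AE s in lborel. s \<in> {0..\<tau>} \<longrightarrow> \<bar>D s\<bar> \<le> C * (1 + F s)"
      using C by eventually_elim (simp add: D_nonneg)
  qed measurable
qed

lemma G_integrable: "set_integrable lborel {0..\<tau>} (G k)"
proof -
  obtain C where C: "AE s in lborel. s \<in> {0..\<tau>} \<longrightarrow> (\<forall>k. \<bar>G k s\<bar> \<le> 2 / \<delta> * (1 + D s))"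
    using AE_bounds by blast
  have "set_integrable lborel {0..\<tau>} (\<lambda>s. 2 / \<delta> * (1 + D s))"
    by (intro set_integrable_mult_right set_integral_add const_integrable D_integrable)
  thus ?thesis
  proof (rule set_integrable_bounded_by)
    show "AE s in lborel. s \<in> {0..\<tau>} \<longrightarrow> \<bar>G k s\<bar> \<le> 2 / \<delta> * (1 + D s)"
      using C by eventually_elim blast
  qed measurable
qed

lemma continuous_integrable:
  "continuous_on UNIV f \<Longrightarrow> set_integrable lborel {0..\<tau>} f" for f :: "real \<Rightarrow> real"
  by (intro borel_integrable_atLeastAtMost') (auto elim: continuous_on_subset)

lemma g_integrable: "set_integrable lborel {0..\<tau>} (g k)"
  unfolding g_def
  by (intro set_integral_add set_integrable_mult_right continuous_integrable[OF Y_cont]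
      continuous_integrable[OF Z_cont] G_integrable const_integrable)

text \<open>Subtracting the equation of \<open>z\<close> from that of the coefficient cancels
  \<open>w\<close>. Under the time integral the coefficients of \<open>u\<close> are replaced by
  those of \<open>\<xi>\<close>, with which they agree at almost every time.\<close>

lemma Y_eq:
  assumes t: "t \<in> {0..\<tau>}" and k: "1 \<le> k"
  shows "Y k t = coord y k + (LINT s:{0..t}|lborel. g k s)"
proof -
  have sub: "set_integrable lborel {0..t} f" if "set_integrable lborel {0..\<tau>} f" for f :: "real \<Rightarrow> real"
    using t that by (auto intro: set_integrable_subset)
  define f where "f s = (ell k)\<^sup>2 * (Y k s + Z k s) - ell k * (- 2 * G k s + lam * (Y k s + Z k s))" for s
  have fi: "set_integrable lborel {0..t} f"
    unfolding f_def
    by (intro sub set_integral_diff set_integral_add set_integrable_mult_right continuous_integrable[OF Y_cont]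
      continuous_integrable[OF Z_cont] G_integrable)
  have Zi: "set_integrable lborel {0..t} (Z k)" by (intro sub continuous_integrable[OF Z_cont])
  have ci: "set_integrable lborel {0..t} (\<lambda>_. a k)" by (intro sub const_integrable)
  have \<xi>: "coord (\<xi> s) k = Y k s + Z k s" if "s \<in> {0..\<tau>}" for s
    using k that by (simp add: Y_def clamp_id)
  have zZ: "(LINT s:{0..t}|lborel. z k s) = (LINT s:{0..t}|lborel. Z k s)"
    using t k by (intro set_lebesgue_integral_cong) (auto simp: Z_def clamp_id)
  have "(LINT s:{0..t}|lborel. laplace (laplace (coord (\<xi> s))) k
                       + laplace (coeffs (\<lambda>\<theta>. f_approx lam n (u (s, \<theta>)))) k) = (LINT s:{0..t}|lborel. f s)"
    unfolding set_lebesgue_integral_def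
  proof (rule integral_cong_AE)
    have AE: "AE s in lborel. indicator {0..t} s *\<^sub>R (laplace (laplace (coord (\<xi> s))) k
         + laplace (coeffs (\<lambda>\<theta>. f_approx lam n (u (s, \<theta>)))) k) = indicator {0..t} s *\<^sub>R f s"
      using AE_slice
    proof eventually_elim
      case (elim s)
      show ?case
      proof (cases "s \<in> {0..t}")
        case True
        hence s: "s \<in> {0..\<tau>}" using t by auto
        then interpret sl: slice n "\<lambda>\<theta>. u (s, \<theta>)" "zhat s" c \<delta> \<epsilon> using elim by blast
        have "coeffs (\<lambda>\<theta>. f_approx lam n (u (s, \<theta>))) k = - 2 * G k s + lam * coord (\<xi> s) k"
        proof -
          have "coeffs (\<lambda>\<theta>. u (s, \<theta>)) k = coord (\<xi> s) k" using elim(1) s by blast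
          thus ?thesis
            unfolding f_approx_eq G_def
              coeffs_add[OF integrable_mult_right[OF sl.g_integrable] integrable_mult_right[OF sl.U_integrable']]
              coeffs_scale by (simp only:)
        qed
        thus ?thesis
          by (simp add: f_def \<xi>[OF s] laplace_def diag_op_def eigval_ell power2_eq_square mult.assoc)
      qed simp
    qed
    show "AE s in lborel. indicator {0..t} s *\<^sub>R (laplace (laplace (coord (\<xi> s))) k
         + laplace (coeffs (\<lambda>\<theta>. f_approx lam n (u (s, \<theta>)))) k) = indicator {0..t} s *\<^sub>R f s" by (rule AE)
    show "(\<lambda>s. indicator {0..t} s *\<^sub>R f s) \<in> borel_measurable lborel" unfolding f_def by measurable
    have "(\<lambda>s. indicator {0..t} s *\<^sub>R ((ell k)\<^sup>2 * (Y k s + Z k s)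
         + laplace (coeffs (\<lambda>\<theta>. f_approx lam n (u (s, \<theta>)))) k)) \<in> borel_measurable lborel"
    proof -
      have [measurable]: "f_approx lam n \<in> borel_measurable borel" unfolding f_approx_eq[abs_def] by measurable
      have [measurable]: "(\<lambda>x. u (fst x, snd x)) \<in> borel_measurable (borel \<Otimes>\<^sub>M unit_lborel)"
        by (simp add: measurable_pair_unit)
      have [measurable]: "(\<lambda>x. eigfun k (snd x)) \<in> borel_measurable (borel \<Otimes>\<^sub>M unit_lborel)"
        by (rule measurable_compose[OF measurable_snd measurable_unit_lborel[OF borel_measurable_eigfun]])
      have [measurable]: "(\<lambda>s. coeffs (\<lambda>\<theta>. f_approx lam n (u (s, \<theta>))) k) \<in> borel_measurable borel"
        unfolding coeffs_eq
        by (rule unit_lborel.borel_measurable_lebesgue_integral) (simp add: case_prod_beta')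
      show ?thesis unfolding laplace_def diag_op_def by measurable
    qed
    moreover have "indicator {0..t} s *\<^sub>R ((ell k)\<^sup>2 * (Y k s + Z k s)
         + laplace (coeffs (\<lambda>\<theta>. f_approx lam n (u (s, \<theta>)))) k)
       = indicator {0..t} s *\<^sub>R (laplace (laplace (coord (\<xi> s))) k
         + laplace (coeffs (\<lambda>\<theta>. f_approx lam n (u (s, \<theta>)))) k)" for s
      using \<xi>[of s] t
      by (auto simp: indicator_def laplace_def diag_op_def eigval_ell power2_eq_square mult.assoc)
    ultimately show "(\<lambda>s. indicator {0..t} s *\<^sub>R (laplace (laplace (coord (\<xi> s))) k
         + laplace (coeffs (\<lambda>\<theta>. f_approx lam n (u (s, \<theta>)))) k)) \<in> borel_measurable lborel"
      by (simp only:)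
  qed
  hence "coord (\<xi> t) k = coord y k - 1/2 * (LINT s:{0..t}|lborel. f s) + w t k"
    using eqn[of t k] t by simp
  moreover have "w t k = z k t + a k * t + (ell k)\<^sup>2 / 2 * (LINT s:{0..t}|lborel. Z k s)"
    using z_eq[OF t, of k] by (simp add: zZ eigval_ell)
  moreover have "z k t = Z k t" using k t by (simp add: Z_def clamp_id)
  moreover have "a k * t = (LINT s:{0..t}|lborel. a k)"
    using t by (simp add: set_lebesgue_integral_def measure_lborel_Icc)
  ultimately have "Y k t = coord y k + (- 1/2 * (LINT s:{0..t}|lborel. f s)
     + (ell k)\<^sup>2 / 2 * (LINT s:{0..t}|lborel. Z k s) + (LINT s:{0..t}|lborel. a k))"
    using \<xi>[OF t] by simp
  also have "- 1/2 * (LINT s:{0..t}|lborel. f s) + (ell k)\<^sup>2 / 2 * (LINT s:{0..t}|lborel. Z k s)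
      + (LINT s:{0..t}|lborel. a k) = (LINT s:{0..t}|lborel. - 1/2 * f s + (ell k)\<^sup>2 / 2 * Z k s + a k)"
  proof -
    have i1: "set_integrable lborel {0..t} (\<lambda>s. - 1/2 * f s)"
      "set_integrable lborel {0..t} (\<lambda>s. (ell k)\<^sup>2 / 2 * Z k s)"
      by (intro set_integrable_mult_right fi Zi)+
    show ?thesis
      unfolding set_integral_add(2)[OF set_integral_add(1)[OF i1] ci] set_integral_add(2)[OF i1]
        set_integral_mult_right ..
  qed
  also have "(\<lambda>s. - 1/2 * f s + (ell k)\<^sup>2 / 2 * Z k s + a k) = g k"
    by (rule ext) (simp add: f_def g_def field_simps)
  finally show ?thesis .
qed

lemma Y_square_eq:
  assumes st: "0 \<le> s" "s \<le> t" "t \<le> \<tau>" and k: "1 \<le> k"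
  shows "(Y k t)\<^sup>2 - (Y k s)\<^sup>2 = 2 * (LINT r:{s..t}|lborel. Y k r * g k r)"
    and "set_integrable lborel {0..\<tau>} (\<lambda>r. Y k r * g k r)"
proof -
  have "compact (Y k ` {0..\<tau>})"
    using continuous_on_subset[OF Y_cont] by (intro compact_continuous_image) auto
  then obtain B where "\<forall>x\<in>Y k ` {0..\<tau>}. norm x \<le> B"
    using compact_imp_bounded bounded_iff by metis
  hence B: "\<bar>Y k r\<bar> \<le> B" if "r \<in> {0..\<tau>}" for r using that by auto
  have [measurable]: "g k \<in> borel_measurable borel" unfolding g_def by measurable
  show Yg: "set_integrable lborel {0..\<tau>} (\<lambda>r. Y k r * g k r)"
  proof (rule set_integrable_bounded_by)
    show "set_integrable lborel {0..\<tau>} (\<lambda>r. B * \<bar>g k r\<bar>)"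
      by (intro set_integrable_mult_right set_integrable_abs g_integrable)
    show "AE s in lborel. s \<in> {0..\<tau>} \<longrightarrow> \<bar>Y k s * g k s\<bar> \<le> B * \<bar>g k s\<bar>"
      using B by (auto simp: abs_mult intro!: mult_right_mono)
  qed measurable
  show "(Y k t)\<^sup>2 - (Y k s)\<^sup>2 = 2 * (LINT r:{s..t}|lborel. Y k r * g k r)"
    by (rule indefinite_integral_square[OF g_integrable Y_eq[OF _ k] Yg st])
qed

lemma Y_0: "1 \<le> k \<Longrightarrow> Y k 0 = coord y k"
proof -
  assume k: "1 \<le> k"
  have "set_integrable lborel {0..0} (g k)"
    using \<tau> by (intro set_integrable_subset[OF g_integrable]) auto
  \<comment> \<open>Split at 0, the integral over the degenerate interval is twice itself, hence
    zero.\<close>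
  from set_integral_Icc_split[OF this, of 0] have "(LINT s:{0..0}|lborel. g k s) = 0" by simp
  thus ?thesis using Y_eq[of 0 k] \<tau> k by simp
qed

section \<open>The energy of the remainder and its inequality\<close>

definition dev :: "real \<Rightarrow> H" where "dev s = \<xi> (clamp s)"

lemma summable_Z: "summable (\<lambda>i. (Z (Suc i) s)\<^sup>2 / ell (Suc i))"
  and Z_sum_le: "(\<Sum>i. (Z (Suc i) s)\<^sup>2 / ell (Suc i)) \<le> \<epsilon>\<^sup>2"
proof -
  have le: "(\<Sum>i<m. (Z (Suc i) s)\<^sup>2) \<le> \<epsilon>\<^sup>2" for m
  proof -
    have "(\<Sum>i<m. (Z (Suc i) s)\<^sup>2) = (\<Sum>k\<in>{1..<Suc m}. (Z k s)\<^sup>2)"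
      by (rule sum.reindex_bij_witness[of _ "\<lambda>k. k - 1" Suc]) auto
    thus ?thesis using Z_square_sum[of s "Suc m"] by simp
  qed
  have s2: "summable (\<lambda>i. (Z (Suc i) s)\<^sup>2)"
    by (rule bounded_imp_summable[of _ "\<epsilon>\<^sup>2"]) (use le[of "Suc _"] in \<open>auto simp: lessThan_Suc_atMost\<close>)
  have le1: "(Z (Suc i) s)\<^sup>2 / ell (Suc i) \<le> (Z (Suc i) s)\<^sup>2" for i
    using ell_ge_9[of "Suc i"] divide_left_mono[of 1 "ell (Suc i)" "(Z (Suc i) s)\<^sup>2"] by simp
  show s1: "summable (\<lambda>i. (Z (Suc i) s)\<^sup>2 / ell (Suc i))"
    by (rule summable_comparison_test'[OF s2]) (use le1 in auto)
  have "(\<Sum>i. (Z (Suc i) s)\<^sup>2 / ell (Suc i)) \<le> (\<Sum>i. (Z (Suc i) s)\<^sup>2)"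
    by (intro suminf_le le1 s1 s2)
  also have "\<dots> \<le> \<epsilon>\<^sup>2" by (intro suminf_le_const s2 le)
  finally show "(\<Sum>i. (Z (Suc i) s)\<^sup>2 / ell (Suc i)) \<le> \<epsilon>\<^sup>2" .
qed

lemma square_diff_le: "(p - r)\<^sup>2 \<le> 2 * p\<^sup>2 + 2 * r\<^sup>2" for p r :: real
  using zero_le_power2[of "p + r"] by (simp add: power2_diff power2_sum)

lemma summable_Y: "summable (\<lambda>i. (Y (Suc i) s)\<^sup>2 / ell (Suc i))"
  and E_le_norm: "E s \<le> 2 * (norm (dev s))\<^sup>2 + 2 * \<epsilon>\<^sup>2"
proof -
  let ?x = "\<lambda>i. (coord (dev s) (Suc i))\<^sup>2 / ell (Suc i)" and ?z = "\<lambda>i. (Z (Suc i) s)\<^sup>2 / ell (Suc i)"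
  have le: "(Y (Suc i) s)\<^sup>2 / ell (Suc i) \<le> 2 * ?x i + 2 * ?z i" for i
    using divide_right_mono[OF square_diff_le, of "ell (Suc i)" "coord (dev s) (Suc i)" "Z (Suc i) s"]
    by (simp add: Y_def dev_def add_divide_distrib)
  have sm: "summable (\<lambda>i. 2 * ?x i + 2 * ?z i)"
    by (intro summable_add summable_mult summable_coord summable_Z)
  show sY: "summable (\<lambda>i. (Y (Suc i) s)\<^sup>2 / ell (Suc i))"
    by (rule summable_comparison_test'[OF sm]) (use le in auto)
  have "E s \<le> (\<Sum>i. 2 * ?x i + 2 * ?z i)" unfolding E_def by (intro suminf_le le sY sm)
  also have "\<dots> = 2 * (\<Sum>i. ?x i) + 2 * (\<Sum>i. ?z i)"
    unfolding suminf_add[OF summable_mult[OF summable_coord] summable_mult[OF summable_Z], symmetric]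
      suminf_mult[OF summable_coord] suminf_mult[OF summable_Z] ..
  also have "\<dots> \<le> 2 * (norm (dev s))\<^sup>2 + 2 * \<epsilon>\<^sup>2"
    using Z_sum_le[of s] by (intro add_mono mult_left_mono) (auto simp: norm_H_square)
  finally show "E s \<le> 2 * (norm (dev s))\<^sup>2 + 2 * \<epsilon>\<^sup>2" .
qed

lemma E_nonneg: "0 \<le> E s"
  unfolding E_def by (intro suminf_nonneg summable_Y) simp

lemma E_bounded: "\<exists>B. \<forall>s. E s \<le> B"
proof -
  have "compact (\<xi> ` {0..\<tau>})"
    by (intro compact_continuous_image continuous_on_subset[OF \<xi>_cont]) auto
  then obtain K where "\<forall>x\<in>\<xi> ` {0..\<tau>}. norm x \<le> K"
    using compact_imp_bounded bounded_iff by metis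
  hence K: "norm (dev s) \<le> K" for s using clamp_in[of s] by (auto simp: dev_def)
  have "E s \<le> 2 * K\<^sup>2 + 2 * \<epsilon>\<^sup>2" for s
    using E_le_norm[of s] power_mono[OF K[of s], of 2] by simp
  thus ?thesis by blast
qed

lemma E_measurable [measurable]: "E \<in> borel_measurable borel"
  unfolding E_def by measurable

lemma E_integrable: "set_integrable lborel {0..\<tau>} E"
proof -
  obtain B where "\<And>s. E s \<le> B" using E_bounded by blast
  thus ?thesis by (intro set_integrable_bounded_by[OF const_integrable[of B]]) (auto simp: E_nonneg)
qed

lemma q_integrable: "set_integrable lborel {0..\<tau>} q"
  unfolding q_def by (intro continuous_integrable continuous_intros Y_cont)

lemma Y_square_le_E: "1 \<le> k \<Longrightarrow> (Y k s)\<^sup>2 \<le> ell k * E s"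
proof -
  assume k: "1 \<le> k"
  have "(Y (Suc (k - 1)) s)\<^sup>2 / ell (Suc (k - 1)) \<le> E s"
    unfolding E_def using sum_le_suminf[OF summable_Y, of "{k - 1}" s] by simp
  thus ?thesis using ell_ge_9[OF k] k by (simp add: field_simps)
qed

text \<open>On modes up to \<open>N\<close> the dual norm controls the coefficients with the
  constant \<open>ell N\<close>. This is the crude bound for the first pass of
  \<open>energy_decay\<close>.\<close>

lemma q_le_E: "q s \<le> 2 * ell N * (E s + E 0)"
proof -
  have part: "(\<Sum>k\<in>{1..N}. (Y k s)\<^sup>2) \<le> ell N * E s" for s
  proof -
    have "(\<Sum>k\<in>{1..N}. (Y k s)\<^sup>2) \<le> (\<Sum>k\<in>{1..N}. ell N * ((Y k s)\<^sup>2 / ell k))"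
    proof (rule sum_mono)
      fix k assume k: "k \<in> {1..N}"
      hence "ell k \<le> ell N" "9 \<le> ell k" by (auto intro: ell_mono ell_ge_9)
      thus "(Y k s)\<^sup>2 \<le> ell N * ((Y k s)\<^sup>2 / ell k)" by (simp add: field_simps mult_right_mono)
    qed
    also have "\<dots> = ell N * (\<Sum>i<N. (Y (Suc i) s)\<^sup>2 / ell (Suc i))"
      unfolding sum_distrib_left[symmetric]
      by (intro arg_cong[of _ _ "(*) (ell N)"] sum.reindex_bij_witness[of _ Suc "\<lambda>k. k - 1"]) auto
    also have "\<dots> \<le> ell N * E s"
      unfolding E_def by (intro mult_left_mono sum_le_suminf summable_Y) auto
    finally show ?thesis .
  qed
  have "q s \<le> (\<Sum>k\<in>{1..N}. 2 * (Y k s)\<^sup>2 + 2 * (Y k 0)\<^sup>2)"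
    unfolding q_def by (intro sum_mono) (simp add: Y_0[symmetric] square_diff_le)
  also have "\<dots> = 2 * (\<Sum>k\<in>{1..N}. (Y k s)\<^sup>2) + 2 * (\<Sum>k\<in>{1..N}. (Y k 0)\<^sup>2)"
    by (simp add: sum.distrib sum_distrib_left)
  also have "\<dots> \<le> 2 * (ell N * E s) + 2 * (ell N * E 0)"
    using part[of s] part[of 0] by linarith
  finally show ?thesis by (simp add: algebra_simps)
qed

text \<open>The first summand comes from the linear term acting on the convolution, the second from
  comparing the nonlinearity at \<open>c + zhat\<close> with that at \<open>c\<close>.\<close>

definition \<kappa> :: real where "\<kappa> = (lam\<^sup>2 + 1 / \<delta>\<^sup>2) * \<epsilon>\<^sup>2"

text \<open>The chain rule is applied to finitely many modes, with the same Cesaro weights in the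
  energy and in the nonlinear sum. As \<open>m\<close> grows the former tends to \<open>E\<close>
  and the latter to the pairing \<open>V\<close>; only then does pointwise monotonicity
  apply.\<close>

lemma energy_inequality:
  assumes st: "0 \<le> s" "s \<le> t" "t \<le> \<tau>"
  shows "E t - E s \<le> (LINT r:{s..t}|lborel. - (1/2) * E r - D r + \<kappa> + \<bar>lam\<bar> * q r)"
proof -
  obtain C where C: "0 \<le> C"
    and "AE s in lborel. s \<in> {0..\<tau>} \<longrightarrow> D s \<le> C * (1 + F s)"
    and Sb: "AE s in lborel. s \<in> {0..\<tau>} \<longrightarrow> (\<forall>m. \<bar>\<Sum>k\<in>{1..<m}. fejer_weight m k * (Y k s * G k s)\<bar> \<le> C * (1 + F s))"
    and "AE s in lborel. s \<in> {0..\<tau>} \<longrightarrow> (\<forall>k. \<bar>G k s\<bar> \<le> 2 / \<delta> * (1 + D s))"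
    and Sl: "AE s in lborel. s \<in> {0..\<tau>} \<longrightarrow> (\<lambda>m. \<Sum>k\<in>{1..<m}. fejer_weight m k * (Y k s * G k s)) \<longlonglongrightarrow> V s"
    and VD: "AE s in lborel. s \<in> {0..\<tau>} \<longrightarrow> - 2 * V s \<le> - D s + \<epsilon>\<^sup>2 / \<delta>\<^sup>2"
    by (rule AE_bounds)
  obtain B where B: "\<And>s. E s \<le> B" using E_bounded by blast
  have sub: "set_integrable lborel {s..t} f" if "set_integrable lborel {0..\<tau>} f" for f :: "real \<Rightarrow> real"
    using st that by (auto intro: set_integrable_subset)
  define e where "e m r = (\<Sum>k\<in>{1..<m}. fejer_weight m k * ((Y k r)\<^sup>2 / ell k))" for m r
  define S where "S m r = (\<Sum>k\<in>{1..<m}. fejer_weight m k * (Y k r * G k r))" for m r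
  define \<kappa>1 where "\<kappa>1 = lam\<^sup>2 * \<epsilon>\<^sup>2"
  define R where "R m r = - (1/2) * e m r + \<kappa>1 + \<bar>lam\<bar> * q r - 2 * S m r" for m r
  define R' where "R' r = - (1/2) * E r + \<kappa>1 + \<bar>lam\<bar> * q r - 2 * V r" for r
  have e_eq: "e m r = (\<Sum>k\<in>{1..<m}. fejer_weight m k * ((Y (Suc (k - 1)) r)\<^sup>2 / ell (Suc (k - 1))))" for m r
    unfolding e_def by (intro sum.cong) auto
  have e_lim: "(\<lambda>m. e m r) \<longlonglongrightarrow> E r" and e_le: "e m r \<le> E r" for m r
    unfolding e_eq E_def
    using fejer_weighted_sum_tendsto[OF summable_Y[of r]] by auto
  have e_nn: "0 \<le> e m r" for m r
    unfolding e_def by (intro sum_nonneg mult_nonneg_nonneg fejer_weight_nonneg divide_nonneg_nonneg) auto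
  have [measurable]: "q \<in> borel_measurable borel" unfolding q_def by measurable
  have [measurable]: "e m \<in> borel_measurable borel" "S m \<in> borel_measurable borel" for m
    unfolding e_def S_def by measurable
  have q_nn: "0 \<le> q r" for r unfolding q_def by (intro sum_nonneg) auto
  \<comment> \<open>A majorant of all \<open>R m\<close>, for the passage to the limit; it depends
    on \<open>n\<close> through \<open>C\<close>.\<close>
  define W where "W r = B + \<kappa>1 + \<bar>lam\<bar> * q r + 2 * (C * (1 + F r))" for r
  have Wi: "set_integrable lborel {0..\<tau>} W"
    unfolding W_def by (intro set_integral_add set_integrable_mult_right const_integrable q_integrable F_integrable)
  have RW: "AE r in lborel. r \<in> {0..\<tau>} \<longrightarrow> (\<forall>m. \<bar>R m r\<bar> \<le> W r)"
    using Sb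
  proof eventually_elim
    case (elim r)
    show ?case
    proof (intro impI allI)
      fix m assume r: "r \<in> {0..\<tau>}"
      have "\<bar>S m r\<bar> \<le> C * (1 + F r)" using elim r unfolding S_def by blast
      moreover have "0 \<le> \<kappa>1" by (simp add: \<kappa>1_def)
      moreover have "0 \<le> \<bar>lam\<bar> * q r" using q_nn[of r] by simp
      ultimately show "\<bar>R m r\<bar> \<le> W r"
        using e_nn[of m r] e_le[of m r] B[of r] unfolding R_def W_def by linarith
    qed
  qed
  have Ri: "set_integrable lborel {0..\<tau>} (R m)" for m
  proof (rule set_integrable_bounded_by[OF Wi])
    show "R m \<in> borel_measurable borel" unfolding R_def by measurable
    show "AE s in lborel. s \<in> {0..\<tau>} \<longrightarrow> \<bar>R m s\<bar> \<le> W s" using RW by eventually_elim blast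
  qed
  have R_lim: "AE r in lborel. r \<in> {0..\<tau>} \<longrightarrow> (\<lambda>m. R m r) \<longlonglongrightarrow> R' r"
    using Sl
  proof eventually_elim
    case (elim r)
    show ?case
    proof
      assume "r \<in> {0..\<tau>}"
      hence "(\<lambda>m. S m r) \<longlonglongrightarrow> V r" using elim unfolding S_def by blast
      thus "(\<lambda>m. R m r) \<longlonglongrightarrow> R' r"
        unfolding R_def R'_def by (intro tendsto_intros e_lim)
    qed
  qed
  have Vm [measurable]: "V \<in> borel_measurable borel"
  proof -
    have [measurable]: "(\<lambda>x. zhat (fst x) (snd x)) \<in> borel_measurable (borel \<Otimes>\<^sub>M unit_lborel)"
      "(\<lambda>x. u (fst x, snd x)) \<in> borel_measurable (borel \<Otimes>\<^sub>M unit_lborel)"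
      using measurable_pair_unit[OF zhat_measurable] measurable_pair_unit[OF u_meas] by simp_all
    show ?thesis
      unfolding V_def by (rule unit_lborel.borel_measurable_lebesgue_integral) (simp add: case_prod_beta')
  qed
  have "(\<lambda>m. \<integral>r. indicator {s..t} r *\<^sub>R R m r \<partial>lborel) \<longlonglongrightarrow> (\<integral>r. indicator {s..t} r *\<^sub>R R' r \<partial>lborel)"
  proof (rule integral_dominated_convergence)
    show "integrable lborel (\<lambda>r. indicator {s..t} r *\<^sub>R W r)"
      using sub[OF Wi] by (simp add: set_integrable_def)
    show "AE r in lborel. (\<lambda>m. indicator {s..t} r *\<^sub>R R m r) \<longlonglongrightarrow> indicator {s..t} r *\<^sub>R R' r"
      using R_lim by eventually_elim (use st in \<open>auto simp: indicator_def\<close>)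
    show "AE r in lborel. norm (indicator {s..t} r *\<^sub>R R m r) \<le> indicator {s..t} r *\<^sub>R W r" for m
      using RW by eventually_elim (use st in \<open>auto simp: indicator_def\<close>)
    show "(\<lambda>r. indicator {s..t} r *\<^sub>R R' r) \<in> borel_measurable lborel" unfolding R'_def by measurable
    show "(\<lambda>r. indicator {s..t} r *\<^sub>R R m r) \<in> borel_measurable lborel" for m unfolding R_def by measurable
  qed
  hence lim: "(\<lambda>m. LINT r:{s..t}|lborel. R m r) \<longlonglongrightarrow> (LINT r:{s..t}|lborel. R' r)"
    by (simp add: set_lebesgue_integral_def)
  have step: "e m t - e m s \<le> (LINT r:{s..t}|lborel. R m r)" for m
  proof -
    have Ygi: "set_integrable lborel {s..t} (\<lambda>r. fejer_weight m k / ell k * 2 * (Y k r * g k r))" if "k \<in> {1..<m}" for k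
      using that st by (intro set_integrable_mult_right sub Y_square_eq(2)[of s t]) auto
    have "e m t - e m s = (\<Sum>k\<in>{1..<m}. fejer_weight m k / ell k * ((Y k t)\<^sup>2 - (Y k s)\<^sup>2))"
      unfolding e_def by (simp add: sum_subtractf right_diff_distrib)
    also have "\<dots> = (\<Sum>k\<in>{1..<m}. LINT r:{s..t}|lborel. fejer_weight m k / ell k * 2 * (Y k r * g k r))"
      using st by (intro sum.cong refl) (simp add: Y_square_eq(1))
    also have "\<dots> = (LINT r:{s..t}|lborel. \<Sum>k\<in>{1..<m}. fejer_weight m k / ell k * 2 * (Y k r * g k r))"
      unfolding set_lebesgue_integral_def scaleR_sum_right
      using Ygi by (intro Bochner_Integration.integral_sum[symmetric]) (simp add: set_integrable_def)
    also have "\<dots> \<le> (LINT r:{s..t}|lborel. R m r)"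
    proof (rule set_integral_mono[OF _ sub[OF Ri]])
      show "set_integrable lborel {s..t} (\<lambda>r. \<Sum>k\<in>{1..<m}. fejer_weight m k / ell k * 2 * (Y k r * g k r))"
        unfolding set_integrable_def scaleR_sum_right
        using Ygi by (intro Bochner_Integration.integrable_sum) (simp add: set_integrable_def)
      fix r
      have "(\<Sum>k\<in>{1..<m}. fejer_weight m k / ell k * 2 * (Y k r * g k r))
          \<le> (\<Sum>k\<in>{1..<m}. fejer_weight m k * (- (1/2) * ((Y k r)\<^sup>2 / ell k) - 2 * (Y k r * G k r))
              + ((if k \<le> N then \<bar>lam\<bar> * (Y k r - coord y k)\<^sup>2 else 0) + lam\<^sup>2 * (Z k r)\<^sup>2))"
      proof (rule sum_mono)
        fix k assume k: "k \<in> {1..<m}"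
        have l: "9 \<le> ell k" using k by (intro ell_ge_9) auto
        let ?f = "fejer_weight m k" and ?x = "(if k \<le> N then \<bar>lam\<bar> * (Y k r - coord y k)\<^sup>2 else 0) + lam\<^sup>2 * (Z k r)\<^sup>2"
        have md: "2 * Y k r / ell k * (- ((ell k)\<^sup>2 / 2) * Y k r + ell k / 2 * (lam * (Y k r + Z k r)) + a k)
          \<le> - (1/2) * ((Y k r)\<^sup>2 / ell k) + (if k \<le> N then \<bar>lam\<bar> * (Y k r - coord y k)\<^sup>2 else 0) + lam\<^sup>2 * (Z k r)\<^sup>2"
          using l k a_def[of k] high[of k] by (intro mode_dissipation) auto
        have "2 / ell k * (Y k r * g k r) = 2 * Y k r / ell k * (- ((ell k)\<^sup>2 / 2) * Y k r
            + ell k / 2 * (lam * (Y k r + Z k r)) + a k) - 2 * (Y k r * G k r)"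
          using l by (simp add: g_def field_simps)
        hence "2 / ell k * (Y k r * g k r) \<le> (- (1/2) * ((Y k r)\<^sup>2 / ell k) - 2 * (Y k r * G k r)) + ?x"
          using md by linarith
        hence "?f * (2 / ell k * (Y k r * g k r)) \<le> ?f * ((- (1/2) * ((Y k r)\<^sup>2 / ell k) - 2 * (Y k r * G k r)) + ?x)"
          by (intro mult_left_mono fejer_weight_nonneg)
        also have "\<dots> \<le> ?f * (- (1/2) * ((Y k r)\<^sup>2 / ell k) - 2 * (Y k r * G k r)) + 1 * ?x"
        proof -
          have "0 \<le> ?x" by simp
          hence "?f * ?x \<le> 1 * ?x" by (rule mult_right_mono[OF fejer_weight_le_1])
          thus ?thesis using distrib_left[of ?f _ ?x] by simp
        qed
        finally show "?f / ell k * 2 * (Y k r * g k r)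
            \<le> ?f * (- (1/2) * ((Y k r)\<^sup>2 / ell k) - 2 * (Y k r * G k r)) + ?x"
          by simp
      qed
      also have "\<dots> = - (1/2) * e m r - 2 * S m r
          + (\<Sum>k\<in>{1..<m}. if k \<le> N then \<bar>lam\<bar> * (Y k r - coord y k)\<^sup>2 else 0) + lam\<^sup>2 * (\<Sum>k\<in>{1..<m}. (Z k r)\<^sup>2)"
        unfolding e_def S_def sum_distrib_left sum.distrib right_diff_distrib sum_subtractf
        by (simp add: mult.left_commute)
      also have "(\<Sum>k\<in>{1..<m}. if k \<le> N then \<bar>lam\<bar> * (Y k r - coord y k)\<^sup>2 else 0)
          = (\<Sum>k\<in>{k\<in>{1..<m}. k \<le> N}. \<bar>lam\<bar> * (Y k r - coord y k)\<^sup>2)"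
        by (rule sum.inter_filter[symmetric]) simp
      also have "\<dots> \<le> (\<Sum>k\<in>{1..N}. \<bar>lam\<bar> * (Y k r - coord y k)\<^sup>2)"
        by (intro sum_mono2) auto
      also have "\<dots> = \<bar>lam\<bar> * q r" by (simp add: q_def sum_distrib_left)
      also have "lam\<^sup>2 * (\<Sum>k\<in>{1..<m}. (Z k r)\<^sup>2) \<le> \<kappa>1"
        unfolding \<kappa>1_def by (intro mult_left_mono Z_square_sum) auto
      finally show "(\<Sum>k\<in>{1..<m}. fejer_weight m k / ell k * 2 * (Y k r * g k r)) \<le> R m r"
        unfolding R_def by simp
    qed
    finally show ?thesis .
  qed
  have "(\<lambda>m. e m t - e m s) \<longlonglongrightarrow> E t - E s" by (intro tendsto_intros e_lim)
  hence "E t - E s \<le> (LINT r:{s..t}|lborel. R' r)"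
    using lim step by (intro LIMSEQ_le) auto
  also have "\<dots> \<le> (LINT r:{s..t}|lborel. - (1/2) * E r - D r + \<kappa> + \<bar>lam\<bar> * q r)"
  proof (rule set_integral_mono_AE)
    have "set_integrable lborel {0..\<tau>} R'"
    proof (rule set_integrable_bounded_by[OF Wi])
      show "R' \<in> borel_measurable borel" unfolding R'_def by measurable
      show "AE s in lborel. s \<in> {0..\<tau>} \<longrightarrow> \<bar>R' s\<bar> \<le> W s"
        using R_lim RW
      proof eventually_elim
        case (elim r)
        thus ?case by (auto intro!: LIMSEQ_le_const2[of "\<lambda>m. \<bar>R m r\<bar>"] tendsto_rabs)
      qed
    qed
    thus "set_integrable lborel {s..t} R'" by (rule sub)
    show "set_integrable lborel {s..t} (\<lambda>r. - (1/2) * E r - D r + \<kappa> + \<bar>lam\<bar> * q r)"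
      by (intro sub set_integral_add set_integral_diff set_integrable_mult_right const_integrable
          E_integrable D_integrable q_integrable)
    show "AE r\<in>{s..t} in lborel. R' r \<le> - (1/2) * E r - D r + \<kappa> + \<bar>lam\<bar> * q r"
      using VD
    proof eventually_elim
      case (elim r)
      show ?case
      proof
        assume "r \<in> {s..t}"
        hence "- 2 * V r \<le> - D r + \<epsilon>\<^sup>2 / \<delta>\<^sup>2" using elim st by auto
        moreover have "\<kappa> = \<kappa>1 + \<epsilon>\<^sup>2 / \<delta>\<^sup>2" by (simp add: \<kappa>_def \<kappa>1_def algebra_simps)
        ultimately show "R' r \<le> - (1/2) * E r - D r + \<kappa> + \<bar>lam\<bar> * q r"
          unfolding R'_def by linarith
      qed
    qed
  qed
  finally show ?thesis .
qed

end

section \<open>Displacement of the low modes over one step\<close>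

definition drift_growth :: "real \<Rightarrow> real \<Rightarrow> real \<Rightarrow> real \<Rightarrow> real" where
  "drift_growth lam \<delta> e R = e\<^sup>2 * (e * (3 + 2 * R)) + 2 * e / \<delta> + \<bar>lam\<bar> * e * (e * (3 + 2 * R) + 1)
     + \<bar>lam\<bar> * e * (e * (3 + 2 * R))"

lemma drift_growth_nonneg: "0 \<le> e \<Longrightarrow> 0 \<le> R \<Longrightarrow> 0 < \<delta> \<Longrightarrow> 0 \<le> drift_growth lam \<delta> e R"
  unfolding drift_growth_def by (intro add_nonneg_nonneg mult_nonneg_nonneg divide_nonneg_nonneg) auto

context controlled_path
begin

text \<open>\<open>drift_growth\<close> adds up bounds of the summands of \<open>g\<close>, where
  \<open>e * (3 + 2 * R)\<close> bounds a low coefficient. The nonlinear coefficient is controlled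
  only through the dissipation, hence the factor \<open>1 + D s\<close>.\<close>

lemma g_bound:
  assumes k: "k \<in> {1..N}" and E0: "E 0 \<le> 2 * R + 2" and Es: "E s \<le> 2 * R + 2" and R: "0 \<le> R"
    and Gs: "\<bar>G k s\<bar> \<le> 2 / \<delta> * (1 + D s)"
  shows "\<bar>g k s\<bar> \<le> drift_growth lam \<delta> (ell N) R * (1 + D s)"
proof -
  define e where "e = ell N"
  define B where "B = e * (3 + 2 * R)"
  have l: "9 \<le> ell k" "ell k \<le> e" using k by (auto simp: e_def intro: ell_mono ell_ge_9)
  have D: "1 \<le> 1 + D s" using D_nonneg[of s] by simp
  have YB: "\<bar>Y k s\<bar> \<le> B" if "E s \<le> 2 * R + 2" for s
  proof -
    have "\<bar>Y k s\<bar> \<le> 1 + (Y k s)\<^sup>2"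
      using young_power[of 1 "\<bar>Y k s\<bar>" 1 1] by (simp add: power2_eq_square)
    also have "\<dots> \<le> 1 + ell k * E s" using Y_square_le_E[of k s] k by simp
    also have "\<dots> \<le> 1 * e + e * (2 * R + 2)"
      using l that R E_nonneg[of s] by (intro add_mono mult_mono) auto
    also have "\<dots> = B" by (simp add: B_def algebra_simps)
    finally show ?thesis .
  qed
  have B0: "0 \<le> B" using YB[OF Es] by linarith
  have yB: "\<bar>coord y k\<bar> \<le> B" using YB[OF E0] k by (simp add: Y_0)
  have ZB: "\<bar>Z k s\<bar> \<le> 1"
  proof -
    have "(Z k s)\<^sup>2 \<le> (\<Sum>j\<in>{1..<Suc k}. (Z j s)\<^sup>2)" using k by (intro member_le_sum) auto
    also have "\<dots> \<le> \<epsilon>\<^sup>2" by (rule Z_square_sum)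
    also have "\<dots> \<le> 1" using eps by (simp add: power_le_one)
    finally show ?thesis by (simp add: abs_square_le_1)
  qed
  have t1: "\<bar>- ((ell k)\<^sup>2 / 2) * Y k s\<bar> \<le> e\<^sup>2 * B"
  proof -
    have "\<bar>- ((ell k)\<^sup>2 / 2) * Y k s\<bar> = (ell k)\<^sup>2 / 2 * \<bar>Y k s\<bar>" by (simp add: abs_mult)
    also have "\<dots> \<le> e\<^sup>2 * B"
    proof (rule mult_mono)
      have "(ell k)\<^sup>2 \<le> e\<^sup>2" using l by (intro power_mono) auto
      thus "(ell k)\<^sup>2 / 2 \<le> e\<^sup>2" using zero_le_power2[of "ell k"] by linarith
    qed (use YB[OF Es] in auto)
    finally show ?thesis .
  qed
  have t2: "\<bar>ell k / 2 * (- 2 * G k s)\<bar> \<le> 2 * e / \<delta> * (1 + D s)"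
  proof -
    have "\<bar>ell k / 2 * (- 2 * G k s)\<bar> = ell k * \<bar>G k s\<bar>" using l by (simp add: abs_mult)
    also have "\<dots> \<le> e * (2 / \<delta> * (1 + D s))" using l Gs by (intro mult_mono) auto
    also have "\<dots> = 2 * e / \<delta> * (1 + D s)"
    proof -
      have "e * (2 / \<delta> * r) = 2 * e / \<delta> * r" for r by simp
      thus ?thesis .
    qed
    finally show ?thesis .
  qed
  have t3: "\<bar>ell k / 2 * (lam * (Y k s + Z k s))\<bar> \<le> \<bar>lam\<bar> * e * (B + 1)"
  proof -
    have "\<bar>ell k / 2 * (lam * (Y k s + Z k s))\<bar> = ell k / 2 * (\<bar>lam\<bar> * \<bar>Y k s + Z k s\<bar>)"
      using l by (simp add: abs_mult)
    also have "\<dots> \<le> e * (\<bar>lam\<bar> * (B + 1))"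
      using l YB[OF Es] ZB by (intro mult_mono) auto
    finally show ?thesis by (simp add: mult_ac)
  qed
  have t4: "\<bar>a k\<bar> \<le> \<bar>lam\<bar> * e * B"
  proof -
    have "\<bar>a k\<bar> = \<bar>lam\<bar> * ell k * \<bar>coord y k\<bar>" using k l by (simp add: a_def abs_mult)
    also have "\<dots> \<le> \<bar>lam\<bar> * e * B" using l yB by (intro mult_mono) auto
    finally show ?thesis .
  qed
  have m: "x \<le> x * (1 + D s)" if "0 \<le> x" for x using mult_left_mono[OF D that] by simp
  have "\<bar>g k s\<bar> \<le> e\<^sup>2 * B + 2 * e / \<delta> * (1 + D s) + \<bar>lam\<bar> * e * (B + 1) + \<bar>lam\<bar> * e * B"
    using t1 t2 t3 t4 unfolding g_def distrib_left[of "ell k / 2"] by linarith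
  also have "\<dots> \<le> e\<^sup>2 * B * (1 + D s) + 2 * e / \<delta> * (1 + D s) + \<bar>lam\<bar> * e * (B + 1) * (1 + D s)
      + \<bar>lam\<bar> * e * B * (1 + D s)"
    using B0 l by (intro add_mono order_refl m mult_nonneg_nonneg) auto
  also have "\<dots> = drift_growth lam \<delta> (ell N) R * (1 + D s)"
    unfolding drift_growth_def e_def[symmetric] B_def[symmetric] by (simp only: distrib_right)
  finally show ?thesis .
qed

text \<open>Integrating \<open>g_bound\<close> shows that a low mode moves by at most a multiple of
  \<open>\<tau>\<close> plus the integrated dissipation: the sharper bound for the second pass of
  \<open>energy_decay\<close>.\<close>

lemma q_le_dissipation:
  assumes E: "\<And>r. r \<in> {0..\<tau>} \<Longrightarrow> E r \<le> 2 * R + 2" and R: "0 \<le> R" and t: "t \<in> {0..\<tau>}"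
  shows "q t \<le> real N * (drift_growth lam \<delta> (ell N) R)\<^sup>2 * (\<tau> + (LINT r:{0..\<tau>}|lborel. D r))\<^sup>2"
proof -
  define \<Gamma> where "\<Gamma> = drift_growth lam \<delta> (ell N) R"
  define Db where "Db = (LINT r:{0..\<tau>}|lborel. D r)"
  have \<Gamma>: "0 \<le> \<Gamma>" unfolding \<Gamma>_def by (intro drift_growth_nonneg R \<delta>) simp
  have sub: "set_integrable lborel {0..t} f" if "set_integrable lborel {0..\<tau>} f" for f :: "real \<Rightarrow> real"
    using t that by (auto intro: set_integrable_subset)
  have E0: "E 0 \<le> 2 * R + 2" using E \<tau> by simp
  have dev: "\<bar>Y k t - coord y k\<bar> \<le> \<Gamma> * (\<tau> + Db)" if k: "k \<in> {1..N}" for k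
  proof -
    obtain C where "AE s in lborel. s \<in> {0..\<tau>} \<longrightarrow> (\<forall>k. \<bar>G k s\<bar> \<le> 2 / \<delta> * (1 + D s))"
      using AE_bounds by blast
    hence AE: "AE s\<in>{0..t} in lborel. \<bar>g k s\<bar> \<le> \<Gamma> * (1 + D s)"
    proof eventually_elim
      case (elim s)
      show ?case
      proof
        assume "s \<in> {0..t}"
        hence s: "s \<in> {0..\<tau>}" using t by auto
        show "\<bar>g k s\<bar> \<le> \<Gamma> * (1 + D s)"
          unfolding \<Gamma>_def using elim s by (intro g_bound k E0 E R) auto
      qed
    qed
    have i1: "set_integrable lborel {0..t} (\<lambda>s. \<bar>g k s\<bar>)" by (intro set_integrable_abs sub g_integrable)
    have i2: "set_integrable lborel {0..t} (\<lambda>_. 1 :: real)" by (intro sub const_integrable)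
    have i3: "set_integrable lborel {0..t} D" by (intro sub D_integrable)
    have "\<bar>Y k t - coord y k\<bar> = \<bar>LINT s:{0..t}|lborel. g k s\<bar>" using Y_eq[OF t, of k] k by simp
    also have "\<dots> \<le> (LINT s:{0..t}|lborel. \<bar>g k s\<bar>)"
      using set_integral_norm_bound[OF sub[OF g_integrable[of k]]] by simp
    also have "\<dots> \<le> (LINT s:{0..t}|lborel. \<Gamma> * (1 + D s))"
      by (rule set_integral_mono_AE[OF i1 set_integrable_mult_right[OF set_integral_add(1)[OF i2 i3]] AE])
    also have "\<dots> = \<Gamma> * (t + (LINT s:{0..t}|lborel. D s))"
      unfolding set_integral_mult_right set_integral_add(2)[OF i2 i3]
      using t by (simp add: set_lebesgue_integral_def measure_lborel_Icc)
    also have "\<dots> \<le> \<Gamma> * (\<tau> + Db)"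
    proof (intro mult_left_mono add_mono \<Gamma>)
      have "0 \<le> (LINT s:{t..\<tau>}|lborel. D s)"
        unfolding set_lebesgue_integral_def by (intro integral_nonneg_AE) (auto simp: D_nonneg)
      thus "(LINT s:{0..t}|lborel. D s) \<le> Db"
        unfolding Db_def using set_integral_Icc_split[OF D_integrable, of t] t by simp
    qed (use t in auto)
    finally show ?thesis .
  qed
  have "q t \<le> (\<Sum>k\<in>{1..N}. (\<Gamma> * (\<tau> + Db))\<^sup>2)"
    unfolding q_def
  proof (rule sum_mono)
    fix k assume "k \<in> {1..N}"
    from power_mono[OF dev[OF this] abs_ge_zero, of 2] show "(Y k t - coord y k)\<^sup>2 \<le> (\<Gamma> * (\<tau> + Db))\<^sup>2" by simp
  qed
  thus ?thesis by (simp add: \<Gamma>_def Db_def power_mult_distrib mult.assoc)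
qed

theorem energy_contraction:
  assumes E0: "E 0 \<le> R" and \<kappa>: "\<kappa> \<le> \<tau>"
    and small1: "\<tau> * (\<bar>lam\<bar> * (2 * ell N)) \<le> 1 / 4"
    and small2: "\<tau> * (\<bar>lam\<bar> * (real N * (drift_growth lam \<delta> (ell N) R)\<^sup>2)) * (4 * R + 4) \<le> 1"
    and small3: "2 * (\<tau> * (\<bar>lam\<bar> * (real N * (drift_growth lam \<delta> (ell N) R)\<^sup>2))) \<le> 1"
  shows "(1 + \<tau> / 2) * E \<tau> \<le> E 0 + (2 + (1 + \<bar>lam\<bar> * (2 * ell N) * (3 * R + 2)) / 2) * \<tau>\<^sup>2"
proof -
  have R: "0 \<le> R" using E0 E_nonneg[of 0] by linarith
  interpret energy_balance E D q \<tau> \<kappa> "\<bar>lam\<bar>"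
    by standard (use \<tau> \<kappa> E_nonneg D_nonneg E_integrable D_integrable q_integrable energy_inequality
        in \<open>auto simp: \<kappa>_def\<close>)
  obtain B where B: "\<And>s. E s \<le> B" using E_bounded by blast
  show ?thesis
    by (rule energy_decay[OF E0 B _ _ q_le_E q_le_dissipation[OF _ R] small1 small2 small3]) auto
qed

text \<open>Returns from the remainder to the solution by adding the convolution. The parameter
  \<open>\<eta>\<close> trades a factor close to 1 on the energy against a large one on the small
  \<open>\<epsilon>\<^sup>2\<close>.\<close>

lemma coord_end:
  assumes \<eta>: "0 < \<eta>"
  shows "coord (\<xi> \<tau>) 0 = c"
    and "(\<Sum>i. (coord (\<xi> \<tau>) (Suc i))\<^sup>2 / ell (Suc i)) \<le> (1 + \<eta>) * E \<tau> + (1 + 1 / \<eta>) * \<epsilon>\<^sup>2"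
proof -
  show "coord (\<xi> \<tau>) 0 = c"
    using eqn[of \<tau> 0] w_0[of \<tau>] \<tau> y_avg by (simp add: laplace_def diag_op_def eigval_def)
  have sq: "(p + r)\<^sup>2 \<le> (1 + \<eta>) * p\<^sup>2 + (1 + 1 / \<eta>) * r\<^sup>2" for p r :: real
  proof -
    have "0 \<le> (sqrt \<eta> * p - r / sqrt \<eta>)\<^sup>2" by simp
    also have "\<dots> = \<eta> * p\<^sup>2 - 2 * p * r + r\<^sup>2 / \<eta>"
      using \<eta> by (simp add: power2_diff power_mult_distrib power_divide)
    finally show ?thesis by (simp add: power2_sum algebra_simps)
  qed
  let ?Y = "\<lambda>i. (Y (Suc i) \<tau>)\<^sup>2 / ell (Suc i)" and ?Z = "\<lambda>i. (Z (Suc i) \<tau>)\<^sup>2 / ell (Suc i)"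
  have \<xi>: "coord (\<xi> \<tau>) (Suc i) = Y (Suc i) \<tau> + Z (Suc i) \<tau>" for i
    using \<tau> by (simp add: Y_def clamp_id)
  have sm: "summable (\<lambda>i. (1 + \<eta>) * ?Y i + (1 + 1 / \<eta>) * ?Z i)"
    by (intro summable_add summable_mult summable_Y summable_Z)
  have "(\<Sum>i. (coord (\<xi> \<tau>) (Suc i))\<^sup>2 / ell (Suc i)) \<le> (\<Sum>i. (1 + \<eta>) * ?Y i + (1 + 1 / \<eta>) * ?Z i)"
  proof (rule suminf_le[OF _ summable_coord sm])
    fix i
    show "(coord (\<xi> \<tau>) (Suc i))\<^sup>2 / ell (Suc i) \<le> (1 + \<eta>) * ?Y i + (1 + 1 / \<eta>) * ?Z i"
      using divide_right_mono[OF sq[of "Y (Suc i) \<tau>" "Z (Suc i) \<tau>"] ell_nonneg[of "Suc i"]]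
      unfolding \<xi> by (simp add: add_divide_distrib)
  qed
  also have "\<dots> = (1 + \<eta>) * E \<tau> + (1 + 1 / \<eta>) * (\<Sum>i. ?Z i)"
    unfolding suminf_add[OF summable_mult[OF summable_Y] summable_mult[OF summable_Z], symmetric]
      suminf_mult[OF summable_Y] suminf_mult[OF summable_Z] E_def ..
  also have "\<dots> \<le> (1 + \<eta>) * E \<tau> + (1 + 1 / \<eta>) * \<epsilon>\<^sup>2"
    using \<eta> by (intro add_left_mono mult_left_mono Z_sum_le) auto
  finally show "(\<Sum>i. (coord (\<xi> \<tau>) (Suc i))\<^sup>2 / ell (Suc i)) \<le> (1 + \<eta>) * E \<tau> + (1 + 1 / \<eta>) * \<epsilon>\<^sup>2" .
qed

lemma E_0: "E 0 = (\<Sum>i. (coord y (Suc i))\<^sup>2 / ell (Suc i))"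
  unfolding E_def by (simp add: Y_0)

end

section \<open>Moving towards the constant\<close>

definition const_H :: "real \<Rightarrow> H" where
  "const_H c = Abs_H (\<lambda>i. if i = 0 then c else 0)"

lemma coord_const_H: "coord (const_H c) i = (if i = 0 then c else 0)"
  unfolding const_H_def by (subst Abs_H_inverse) (auto simp: V_def)

lemma const_H_in: "const_H c \<in> H_avg c"
  by (simp add: H_avg_def coord_const_H)

lemma dist_const_H:
  assumes "x \<in> H_avg c"
  shows "(dist x (const_H c))\<^sup>2 = (\<Sum>i. (coord x (Suc i))\<^sup>2 / ell (Suc i))"
  using assms by (simp add: dist_H_def norm_H_square coord_diff coord_const_H H_avg_def)

lemma closed_H_avg: "closed (H_avg c)"
proof -
  have "H_avg c = (\<lambda>x. coord x 0) -` {c}" by (auto simp: H_avg_def)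
  moreover have "closed ((\<lambda>x. coord x 0) -` {c})"
    by (intro continuous_closed_vimage linear_continuous_at bounded_linear_coord) auto
  ultimately show ?thesis by simp
qed

text \<open>The radii and the time are common to all \<open>y\<close>, while \<open>p\<close> may
  depend on \<open>y\<close>, because the slope of the noise does, but not on \<open>n\<close>. The
  limit in \<open>n\<close> keeps the bound, and afterwards only positivity at each \<open>y\<close>
  is used.\<close>

lemma one_step:
  fixes M :: "'w measure" and lam c \<rho> :: real
  assumes W: "cylindrical_wiener M W" and b_nonneg: "\<And>k. 0 \<le> b k"
    and b_0: "cov_sqrt b (basis_vec 0) = (\<lambda>_. 0)"
    and trace: "finite_trace (-1) (cov_sqrt b)"
    and b_pos: "\<And>k. k \<in> {1..N} \<Longrightarrow> 0 < b k"
    and N_large: "1/2 * (real N + 1)\<^sup>2 - lam > 0" and c: "\<bar>c\<bar> < 1" and \<rho>: "0 < \<rho>"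
  obtains s s' \<tau> where "\<rho> < s" "0 < s'" "s' < \<rho>" "0 < \<tau>"
    "\<And>y. y \<in> H_avg c \<Longrightarrow> dist y (const_H c) < s \<Longrightarrow>
      \<exists>p>0. \<forall>n X. solution M W (cov_sqrt b) lam n y X \<longrightarrow>
        p \<le> measure M {\<omega> \<in> space M. X \<tau> \<omega> \<in> H_avg c \<and> dist (X \<tau> \<omega>) (const_H c) < s'}"
proof -
  interpret prob_space M using W by (simp add: cylindrical_wiener_def)
  have high: "2 * lam \<le> ell k" if "N < k" for k
  proof -
    have "(real N + 1)\<^sup>2 \<le> (real k)\<^sup>2" using that by (intro power_mono) auto
    moreover have "0 \<le> (real k)\<^sup>2" by simp
    ultimately show ?thesis using N_large ell_ge[of k] by linarith
  qed
  define \<delta> where "\<delta> = (1 - \<bar>c\<bar>) / 4"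
  \<comment> \<open>An upper bound of the initial energy, since \<open>s\<^sup>2\<close> stays below
    \<open>2 * \<rho>\<^sup>2\<close>.\<close>
  define R where "R = 2 * \<rho>\<^sup>2"
  define L where "L = \<bar>lam\<bar> * (2 * ell N)"
  define L' where "L' = \<bar>lam\<bar> * (real N * (drift_growth lam \<delta> (ell N) R)\<^sup>2)"
  define K where "K = 2 + (1 + L * (3 * R + 2)) / 2"
  \<comment> \<open>The sum of all quantities whose product with \<open>\<tau>\<close> has to be at
    most 1.\<close>
  define Q where "Q = 4 + 4 * L + L' * (4 * R + 4) + 2 * L' + 8 * K / \<rho>\<^sup>2"
  define \<tau> where "\<tau> = 1 / Q"
  have \<delta>: "0 < \<delta>" using c by (simp add: \<delta>_def)
  have R: "0 < R" using \<rho> by (simp add: R_def)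
  have L0: "0 \<le> L" and L'0: "0 \<le> L'" by (auto simp: L_def L'_def)
  have K0: "0 \<le> K" using L0 R by (simp add: K_def)
  have L'R: "0 \<le> L' * (4 * R + 4)" using L'0 R by simp
  have KQ0: "0 \<le> 8 * K / \<rho>\<^sup>2" using K0 by simp
  have Q: "4 \<le> Q" "4 * L \<le> Q" "L' * (4 * R + 4) \<le> Q" "2 * L' \<le> Q" "8 * K / \<rho>\<^sup>2 \<le> Q"
    using L0 L'0 L'R KQ0 unfolding Q_def by linarith+
  have \<tau>0: "0 < \<tau>" using Q(1) by (simp add: \<tau>_def)
  have \<tau>Q: "\<tau> * r \<le> 1" if "r \<le> Q" for r using that Q(1) by (simp add: \<tau>_def)
  have \<tau>: "\<tau> \<le> 1 / 4" using \<tau>Q[OF Q(1)] by linarith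
  have small1: "\<tau> * (\<bar>lam\<bar> * (2 * ell N)) \<le> 1 / 4"
    using \<tau>Q[OF Q(2)] unfolding L_def by linarith
  have small2: "\<tau> * L' * (4 * R + 4) \<le> 1" using \<tau>Q[OF Q(3)] by (simp only: mult.assoc)
  have small3: "2 * (\<tau> * L') \<le> 1" using \<tau>Q[OF Q(4)] by linarith
  have K\<tau>: "K * \<tau> \<le> \<rho>\<^sup>2 / 8" using \<tau>Q[OF Q(5)] \<rho> by (simp add: field_simps)

  \<comment> \<open>The step divides the energy by \<open>1 + \<tau> / 2\<close> after adding an
    error of at most \<open>\<rho>\<^sup>2 * \<tau> / 8\<close>. Starting from
    \<open>\<rho>\<^sup>2 * (1 + \<tau> / 8)\<close>, it ends at \<open>e1\<close>, still below
    \<open>\<rho>\<^sup>2\<close>.\<close>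
  define s where "s = sqrt (\<rho>\<^sup>2 * (1 + \<tau> / 8))"
  define e1 where "e1 = \<rho>\<^sup>2 * (1 + \<tau> / 4) / (1 + \<tau> / 2)"
  \<comment> \<open>Of the gap \<open>d\<close>, one half is spent on the factor
    \<open>1 + \<eta>\<close> and one quarter on the convolution; 7/8 in \<open>s'\<close> leaves
    strict inequalities on both sides.\<close>
  define d where "d = \<rho>\<^sup>2 - e1"
  define \<eta> where "\<eta> = d / (2 * \<rho>\<^sup>2)"
  have \<rho>2: "0 < \<rho>\<^sup>2" using \<rho> by simp
  have s2: "s\<^sup>2 = \<rho>\<^sup>2 * (1 + \<tau> / 8)" using \<tau>0 by (simp add: s_def)
  have e1: "0 \<le> e1" "e1 < \<rho>\<^sup>2" using \<tau>0 \<rho>2 by (simp_all add: e1_def field_simps)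
  have d: "0 < d" using e1 by (simp add: d_def)
  have \<eta>: "0 < \<eta>" using d \<rho>2 by (simp add: \<eta>_def)
  have \<eta>e1: "(1 + \<eta>) * e1 \<le> e1 + d / 2"
  proof -
    have "\<eta> * e1 \<le> \<eta> * \<rho>\<^sup>2" using \<eta> e1 by (intro mult_left_mono) auto
    also have "\<dots> = d / 2" using \<rho>2 by (simp add: \<eta>_def)
    finally show ?thesis by (simp add: algebra_simps)
  qed
  define s' where "s' = sqrt (e1 + 7 / 8 * d)"
  have s': "s'\<^sup>2 = e1 + 7 / 8 * d" using e1 d by (simp add: s'_def)
  define m where "m = min (\<tau> / (lam\<^sup>2 + 1 / \<delta>\<^sup>2)) (d / (4 * (1 + 1 / \<eta>)))"
  have lam\<delta>: "0 < lam\<^sup>2 + 1 / \<delta>\<^sup>2" using \<delta> by (intro add_nonneg_pos) auto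
  have \<eta>1: "0 < 1 + 1 / \<eta>" using \<eta> by (intro add_pos_pos) auto
  have m0: "0 < m" using \<tau>0 d lam\<delta> \<eta>1 by (simp add: m_def)
  \<comment> \<open>The bound \<open>2 * \<delta>\<close> keeps \<open>c\<close> plus the
    convolution away from 1 and -1; \<open>m\<close> limits the noise error in the energy and in the
    return to the solution.\<close>
  define \<epsilon> where "\<epsilon> = min (2 * \<delta>) (sqrt m)"
  have \<epsilon>0: "0 < \<epsilon>" using \<delta> m0 by (simp add: \<epsilon>_def)
  have "\<epsilon>\<^sup>2 \<le> (sqrt m)\<^sup>2" using \<epsilon>0 by (intro power_mono) (auto simp: \<epsilon>_def)
  hence \<epsilon>m: "\<epsilon>\<^sup>2 \<le> m" using m0 by simp
  have \<epsilon>1: "(lam\<^sup>2 + 1 / \<delta>\<^sup>2) * \<epsilon>\<^sup>2 \<le> \<tau>"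
  proof -
    have "\<epsilon>\<^sup>2 \<le> \<tau> / (lam\<^sup>2 + 1 / \<delta>\<^sup>2)" using \<epsilon>m by (simp add: m_def)
    thus ?thesis using lam\<delta> by (simp add: pos_le_divide_eq mult.commute)
  qed
  have \<epsilon>2: "(1 + 1 / \<eta>) * \<epsilon>\<^sup>2 \<le> d / 4"
  proof -
    have "\<epsilon>\<^sup>2 \<le> d / 4 / (1 + 1 / \<eta>)" using \<epsilon>m by (simp add: m_def)
    thus ?thesis using \<eta>1 by (simp only: pos_le_divide_eq mult.commute)
  qed
  have \<epsilon>3: "\<bar>c\<bar> + \<epsilon> \<le> 1 - 2 * \<delta>"
  proof -
    have "\<epsilon> \<le> 2 * \<delta>" by (simp add: \<epsilon>_def)
    moreover have "4 * \<delta> = 1 - \<bar>c\<bar>" by (simp add: \<delta>_def)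
    ultimately show ?thesis by linarith
  qed
  show ?thesis
  proof (rule that)
    show "\<rho> < s"
    proof (rule power_less_imp_less_base[of _ 2])
      show "\<rho>\<^sup>2 < s\<^sup>2" unfolding s2 using \<rho>2 \<tau>0 by simp
    qed (simp add: s_def \<tau>0 less_imp_le)
    show "s' < \<rho>"
    proof (rule power_less_imp_less_base[of _ 2])
      show "s'\<^sup>2 < \<rho>\<^sup>2" unfolding s' using d d_def by linarith
    qed (use \<rho> in simp)
    show "0 < s'" using e1 d by (simp add: s'_def add_nonneg_pos)
    show "0 < \<tau>" by (rule \<tau>0)
    fix y assume y: "y \<in> H_avg c" and ys: "dist y (const_H c) < s"
    define a where "a k = (if 1 \<le> k \<and> k \<le> N then - \<bar>lam\<bar> * ell k * coord y k else 0)" for k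
    have a0: "a k = 0" if "b k = 0" for k using b_pos[of k] that by (auto simp: a_def)
    have a1: "a k = 0" if "N < k" for k using that by (simp add: a_def)
    have \<epsilon>': "0 < \<epsilon> / sqrt 2" using \<epsilon>0 by simp
    obtain A h where A: "A \<in> sets M" "0 < measure M A" and h: "summable h" "\<And>k. 0 \<le> h k" "(\<Sum>k. h k) \<le> \<epsilon> / sqrt 2"
      and AEz: "AE \<omega> in M. \<omega> \<in> A \<longrightarrow> (\<exists>z. \<forall>k. continuous_on {0..\<tau>} (z k) \<and> (\<forall>t\<in>{0..\<tau>}. \<bar>z k t\<bar> \<le> h k
        \<and> z k t = cov_sqrt b (W t \<omega>) k - a k * t - (eigval k)\<^sup>2 / 2 * (LINT s:{0..t}|lborel. z k s)))"
      by (rule noise_event[OF W b_nonneg trace a0 a1 \<tau>0 \<epsilon>']) blast+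
    have h3: "sqrt 2 * (\<Sum>k. h k) \<le> \<epsilon>"
      using mult_left_mono[OF h(3), of "sqrt 2"] by simp
    have wb0: "cov_sqrt b f 0 = 0" for f
    proof -
      have "sqrt (b 0) = 0" using fun_cong[OF b_0, of 0] by (simp add: cov_sqrt_def diag_op_def basis_vec_def)
      thus ?thesis by (simp add: cov_sqrt_def diag_op_def)
    qed
    have key: "\<xi> \<tau> \<in> H_avg c \<and> dist (\<xi> \<tau>) (const_H c) < s'"
      if sol: "solution_path lam n (\<lambda>t. cov_sqrt b (W t \<omega>)) y \<xi>"
        and z: "\<And>k. continuous_on {0..\<tau>} (z k)" "\<And>k t. t \<in> {0..\<tau>} \<Longrightarrow> \<bar>z k t\<bar> \<le> h k"
          "\<And>k t. t \<in> {0..\<tau>} \<Longrightarrow> z k t = cov_sqrt b (W t \<omega>) k - a k * t - (eigval k)\<^sup>2 / 2 * (LINT s:{0..t}|lborel. z k s)"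
      for n \<omega> \<xi> z
    proof -
      obtain u where u: "u \<in> borel_measurable borel"
         "\<forall>T>0. set_integrable lborel ({0<..<T} \<times> {0<..<1}) (\<lambda>z. \<bar>u z\<bar> ^ (2 * n + 2))"
         "AE s in lborel. 0 < s \<longrightarrow> coord (\<xi> s) = coeffs (\<lambda>\<theta>. u (s, \<theta>))"
         "\<forall>t\<ge>0. \<forall>k. coord (\<xi> t) k = coord y k
            - 1/2 * (LINT s:{0..t}|lborel. laplace (laplace (coord (\<xi> s))) k
                       + laplace (coeffs (\<lambda>\<theta>. f_approx lam n (u (s, \<theta>)))) k)
            + cov_sqrt b (W t \<omega>) k" and \<xi>: "continuous_on {0..} \<xi>"
        using sol unfolding solution_path_def by blast
      interpret controlled_path lam c \<delta> \<epsilon> \<tau> n N y \<xi> "\<lambda>t. cov_sqrt b (W t \<omega>)" z h a u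
      proof
        show "coord y 0 = c" using y by (simp add: H_avg_def)
        show "z k t = cov_sqrt b (W t \<omega>) k - a k * t - (eigval k)\<^sup>2 / 2 * (LINT s:{0..t}|lborel. z k s)"
          if "t \<in> {0..\<tau>}" for k t using z(3)[OF that] .
      qed (use u \<xi> wb0 \<tau>0 \<tau> h h3 z(1,2) a_def high \<delta> \<epsilon>3 in auto)
      have E0: "E 0 = (dist y (const_H c))\<^sup>2" unfolding E_0 by (rule dist_const_H[OF y, symmetric])
      have "(dist y (const_H c))\<^sup>2 \<le> s\<^sup>2" using ys by (intro power_mono) auto
      hence E0s: "E 0 \<le> \<rho>\<^sup>2 * (1 + \<tau> / 8)" unfolding E0 s2 .
      have "\<rho>\<^sup>2 * (1 + \<tau> / 8) \<le> \<rho>\<^sup>2 * 2" using \<tau> by (intro mult_left_mono) auto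
      hence E0R: "E 0 \<le> R" using E0s by (simp add: R_def)
      have "(1 + \<tau> / 2) * E \<tau> \<le> E 0 + K * \<tau>\<^sup>2"
        unfolding K_def L_def
        by (rule energy_contraction[OF E0R _ small1 small2[unfolded L'_def] small3[unfolded L'_def]])
           (use \<epsilon>1 in \<open>simp add: \<kappa>_def\<close>)
      also have "K * \<tau>\<^sup>2 \<le> \<rho>\<^sup>2 / 8 * \<tau>"
        using mult_right_mono[OF K\<tau>, of \<tau>] \<tau>0 by (simp add: power2_eq_square)
      also have "E 0 + \<rho>\<^sup>2 / 8 * \<tau> \<le> \<rho>\<^sup>2 * (1 + \<tau> / 4)" using E0s by (simp add: algebra_simps)
      finally have "E \<tau> \<le> e1" using \<tau>0 by (simp add: e1_def pos_le_divide_eq mult.commute)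
      hence "(1 + \<eta>) * E \<tau> \<le> (1 + \<eta>) * e1" using \<eta> by (intro mult_left_mono) auto
      hence fin: "(1 + \<eta>) * E \<tau> + (1 + 1 / \<eta>) * \<epsilon>\<^sup>2 \<le> e1 + d / 2 + d / 4" using \<eta>e1 \<epsilon>2 by linarith
      have in_avg: "\<xi> \<tau> \<in> H_avg c" using coord_end(1)[OF \<eta>] by (simp add: H_avg_def)
      have "(dist (\<xi> \<tau>) (const_H c))\<^sup>2 \<le> e1 + d / 2 + d / 4"
        unfolding dist_const_H[OF in_avg] using coord_end(2)[OF \<eta>] fin by (rule order_trans)
      also have "\<dots> < s'\<^sup>2" unfolding s' using d by simp
      finally have "dist (\<xi> \<tau>) (const_H c) < s'"
        by (rule power_less_imp_less_base) (use e1 d in \<open>simp add: s'_def\<close>)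
      thus ?thesis using in_avg by simp
    qed
    show "\<exists>p>0. \<forall>n X. solution M W (cov_sqrt b) lam n y X \<longrightarrow>
        p \<le> measure M {\<omega> \<in> space M. X \<tau> \<omega> \<in> H_avg c \<and> dist (X \<tau> \<omega>) (const_H c) < s'}"
    proof (intro exI[of _ "measure M A"] conjI allI impI A(2))
      fix n X assume X: "solution M W (cov_sqrt b) lam n y X"
      have [measurable]: "X \<tau> \<in> measurable M borel" using X \<tau>0 by (simp add: solution_def)
      have [measurable]: "H_avg c \<in> sets borel" using closed_H_avg by (rule borel_closed)
      have AEs: "AE \<omega> in M. solution_path lam n (\<lambda>t. cov_sqrt b (W t \<omega>)) y (\<lambda>t. X t \<omega>)"
        using X by (simp add: solution_def)
      show "measure M A \<le> measure M {\<omega> \<in> space M. X \<tau> \<omega> \<in> H_avg c \<and> dist (X \<tau> \<omega>) (const_H c) < s'}"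
      proof (rule finite_measure_mono_AE)
        show "AE \<omega> in M. \<omega> \<in> A \<longrightarrow> \<omega> \<in> {\<omega> \<in> space M. X \<tau> \<omega> \<in> H_avg c \<and> dist (X \<tau> \<omega>) (const_H c) < s'}"
          using AEs AEz AE_space
        proof eventually_elim
          case (elim \<omega>)
          show ?case
          proof
            assume "\<omega> \<in> A"
            then obtain z where "\<forall>k. continuous_on {0..\<tau>} (z k) \<and> (\<forall>t\<in>{0..\<tau>}. \<bar>z k t\<bar> \<le> h k
              \<and> z k t = cov_sqrt b (W t \<omega>) k - a k * t - (eigval k)\<^sup>2 / 2 * (LINT s:{0..t}|lborel. z k s))"
              using elim(2) by blast
            hence "X \<tau> \<omega> \<in> H_avg c \<and> dist (X \<tau> \<omega>) (const_H c) < s'"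
              by (intro key[OF elim(1), of z]) blast+
            thus "\<omega> \<in> {\<omega> \<in> space M. X \<tau> \<omega> \<in> H_avg c \<and> dist (X \<tau> \<omega>) (const_H c) < s'}"
              using elim(3) by simp
          qed
        qed
        have "ball (const_H c) s' \<in> sets borel" by simp
        hence "{\<omega> \<in> space M. X \<tau> \<omega> \<in> H_avg c \<inter> ball (const_H c) s'} \<in> sets M" by measurable
        thus "{\<omega> \<in> space M. X \<tau> \<omega> \<in> H_avg c \<and> dist (X \<tau> \<omega>) (const_H c) < s'} \<in> sets M"
          by (simp add: dist_commute)
      qed
    qed
  qed
qed

section \<open>Irreducibility of the limit semigroup\<close>

lemma indicator_bounded_borel:
  assumes "U \<in> sets borel"
  shows "indicator U \<in> bounded_borel S"
  unfolding bounded_borel_def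
proof (intro CollectI conjI)
  show "(indicator U :: H \<Rightarrow> real) \<in> borel_measurable (restrict_space borel S)"
    using assms by (intro measurable_restrict_space1) simp
  show "bounded ((indicator U :: H \<Rightarrow> real) ` S)"
    by (rule boundedI[of _ 1]) (auto simp: indicator_def)
qed

lemma P_approx_indicator:
  "P_approx M X c t (indicator U) x = measure M {\<omega> \<in> space M. X x t \<omega> \<in> H_avg c \<and> X x t \<omega> \<in> U}"
proof -
  have "P_approx M X c t (indicator U) x
      = (\<integral>\<omega>. indicator {\<omega> \<in> space M. X x t \<omega> \<in> H_avg c \<and> X x t \<omega> \<in> U} \<omega> \<partial>M)"
    unfolding P_approx_def set_lebesgue_integral_def
    by (intro Bochner_Integration.integral_cong) (auto simp: indicator_def)
  also have "\<dots> = measure M ({\<omega> \<in> space M. X x t \<omega> \<in> H_avg c \<and> X x t \<omega> \<in> U} \<inter> space M)"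
    by (rule Bochner_Integration.integral_indicator)
  also have "{\<omega> \<in> space M. X x t \<omega> \<in> H_avg c \<and> X x t \<omega> \<in> U} \<inter> space M
      = {\<omega> \<in> space M. X x t \<omega> \<in> H_avg c \<and> X x t \<omega> \<in> U}"
    by (rule Int_absorb2[OF Collect_restrict])
  finally show ?thesis .
qed

lemma semigroup_kernel:
  assumes "transition_semigroup S P" "0 \<le> t"
  obtains \<kappa> where "\<kappa> \<in> measurable (restrict_space borel S) (prob_algebra (restrict_space borel S))"
    "\<And>\<phi> x. \<phi> \<in> bounded_borel S \<Longrightarrow> x \<in> S \<Longrightarrow> P t \<phi> x = (\<integral>y. \<phi> y \<partial>\<kappa> x)"
    "\<And>x. x \<in> S \<Longrightarrow> prob_space (\<kappa> x)" "\<And>x. x \<in> S \<Longrightarrow> sets (\<kappa> x) = sets (restrict_space borel S)"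
    "\<And>x. x \<in> S \<Longrightarrow> space (\<kappa> x) = S"
    "\<And>U x. U \<in> sets borel \<Longrightarrow> x \<in> S \<Longrightarrow> P t (indicator U) x = measure (\<kappa> x) (S \<inter> U)"
proof -
  have "\<forall>t\<ge>0. \<exists>\<kappa>\<in>measurable (restrict_space borel S) (prob_algebra (restrict_space borel S)).
      \<forall>\<phi>\<in>bounded_borel S. \<forall>x\<in>S. P t \<phi> x = (\<integral>y. \<phi> y \<partial>\<kappa> x)"
    using assms(1) unfolding transition_semigroup_def by (rule conjunct1)
  from mp[OF spec[OF this] assms(2)]
  obtain \<kappa> where \<kappa>: "\<kappa> \<in> measurable (restrict_space borel S) (prob_algebra (restrict_space borel S))"
    and P': "\<forall>\<phi>\<in>bounded_borel S. \<forall>x\<in>S. P t \<phi> x = (\<integral>y. \<phi> y \<partial>\<kappa> x)"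
    by (rule bexE)
  have P: "P t \<phi> x = (\<integral>y. \<phi> y \<partial>\<kappa> x)" if "\<phi> \<in> bounded_borel S" "x \<in> S" for \<phi> x
    by (rule bspec[OF bspec[OF P' that(1)] that(2)])
  have in_alg: "\<kappa> x \<in> space (prob_algebra (restrict_space borel S))" if "x \<in> S" for x
    using measurable_space[OF \<kappa>, of x] that by (simp add: space_restrict_space)
  have prob: "prob_space (\<kappa> x)" and sets: "sets (\<kappa> x) = sets (restrict_space borel S)" if "x \<in> S" for x
    using in_alg[OF that] by (auto simp: space_prob_algebra)
  have space: "space (\<kappa> x) = S" if "x \<in> S" for x
    using sets_eq_imp_space_eq[OF sets[OF that]] by (simp add: space_restrict_space)
  have ind: "P t (indicator U) x = measure (\<kappa> x) (S \<inter> U)" if "U \<in> sets borel" "x \<in> S" for U x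
    using P[OF indicator_bounded_borel[OF that(1)] that(2)] space[OF that(2)] by (simp add: Int_commute)
  show ?thesis by (rule that[OF \<kappa> P prob sets space ind])
qed

theorem proposition3p4:
  fixes M :: "'w measure"
    and W :: "real \<Rightarrow> 'w \<Rightarrow> nat \<Rightarrow> real"
    and b :: "nat \<Rightarrow> real"
    and N :: nat
    and lam c :: real
    and X :: "nat \<Rightarrow> H \<Rightarrow> real \<Rightarrow> 'w \<Rightarrow> H"
    and r :: "nat \<Rightarrow> nat"
    and P :: "real \<Rightarrow> (H \<Rightarrow> real) \<Rightarrow> H \<Rightarrow> real"
  assumes wiener: "cylindrical_wiener M W"
    and b_nonneg: "\<And>k. 0 \<le> b k"
    and b_0: "cov_sqrt b (basis_vec 0) = (\<lambda>_. 0)"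
    and trace: "finite_trace (-1) (cov_sqrt b)"
    and b_pos: "\<And>k. k \<in> {1..N} \<Longrightarrow> 0 < b k"
    and N_large: "1/2 * (real N + 1)\<^sup>2 - lam > 0"
    and X_sol: "\<And>n x. solution M W (cov_sqrt b) lam n x (X n x)"
    and c: "c \<in> {-1<..<1}"
    and subseq: "strict_mono r"
    and semigroup: "transition_semigroup (H_avg c) P"
    and limit: "\<And>\<phi> x t. \<phi> \<in> bounded_borel (H_avg c) \<Longrightarrow> x \<in> H_avg c \<Longrightarrow> 0 \<le> t \<Longrightarrow>
      (\<lambda>k. P_approx M (X (r k)) c t \<phi> x) \<longlonglongrightarrow> P t \<phi> x"
  shows "weakly_top_irreducible (H_avg c) P"
proof -
  interpret prob_space M using wiener by (simp add: cylindrical_wiener_def)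
  let ?S = "H_avg c" and ?K = "const_H c"
  have c1: "\<bar>c\<bar> < 1" using c by auto
  have ball: "ball ?K r \<in> sets borel" for r by simp
  have mono: "P t (indicator U) x \<le> P t (indicator U') x"
    if asm: "0 \<le> t" "x \<in> ?S" "U \<in> sets borel" "U' \<in> sets borel" "?S \<inter> U \<subseteq> U'" for t x U U'
  proof -
    obtain \<kappa> where \<kappa>: "\<kappa> \<in> measurable (restrict_space borel ?S) (prob_algebra (restrict_space borel ?S))"
        "\<And>\<phi> x. \<phi> \<in> bounded_borel ?S \<Longrightarrow> x \<in> ?S \<Longrightarrow> P t \<phi> x = (\<integral>y. \<phi> y \<partial>\<kappa> x)"
        "\<And>x. x \<in> ?S \<Longrightarrow> prob_space (\<kappa> x)" "\<And>x. x \<in> ?S \<Longrightarrow> sets (\<kappa> x) = sets (restrict_space borel ?S)"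
        "\<And>x. x \<in> ?S \<Longrightarrow> space (\<kappa> x) = ?S"
        "\<And>U x. U \<in> sets borel \<Longrightarrow> x \<in> ?S \<Longrightarrow> P t (indicator U) x = measure (\<kappa> x) (?S \<inter> U)"
      by (rule semigroup_kernel[OF semigroup asm(1)]) blast
    interpret \<kappa>: prob_space "\<kappa> x" by (rule \<kappa>(3)[OF asm(2)])
    show ?thesis
      unfolding \<kappa>(6)[OF asm(3,2)] \<kappa>(6)[OF asm(4,2)]
      using asm by (intro \<kappa>.finite_measure_mono) (auto simp: \<kappa>(4) sets_restrict_space)
  qed
  have reach: "\<exists>t>0. 0 < P t (indicator (ball ?K e)) x" if x: "x \<in> ?S" and e: "0 < e" for x e
  proof -
    define A where "A = {r. 0 < r \<and> (\<exists>t>0. 0 < P t (indicator (ball ?K r)) x)}"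
    \<comment> \<open>Time 1 suffices: the balls of integer radius exhaust the space, so one of them
      has positive mass.\<close>
    have A_ne: "A \<noteq> {}"
    proof
      assume empty: "A = {}"
      obtain \<kappa> where \<kappa>: "\<kappa> \<in> measurable (restrict_space borel ?S) (prob_algebra (restrict_space borel ?S))"
        "\<And>\<phi> x. \<phi> \<in> bounded_borel ?S \<Longrightarrow> x \<in> ?S \<Longrightarrow> P 1 \<phi> x = (\<integral>y. \<phi> y \<partial>\<kappa> x)"
        "\<And>x. x \<in> ?S \<Longrightarrow> prob_space (\<kappa> x)" "\<And>x. x \<in> ?S \<Longrightarrow> sets (\<kappa> x) = sets (restrict_space borel ?S)"
        "\<And>x. x \<in> ?S \<Longrightarrow> space (\<kappa> x) = ?S"
        "\<And>U x. U \<in> sets borel \<Longrightarrow> x \<in> ?S \<Longrightarrow> P 1 (indicator U) x = measure (\<kappa> x) (?S \<inter> U)"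
        by (rule semigroup_kernel[OF semigroup zero_le_one]) blast
      interpret \<kappa>: prob_space "\<kappa> x" by (rule \<kappa>(3)[OF x])
      have "measure (\<kappa> x) (?S \<inter> ball ?K (real (Suc m))) = 0" for m
      proof -
        have "\<not> 0 < P 1 (indicator (ball ?K (real (Suc m)))) x"
          using empty unfolding A_def by (auto dest!: spec[of _ "real (Suc m)"] simp del: of_nat_Suc)
        thus ?thesis unfolding \<kappa>(6)[OF ball x] using measure_nonneg by (simp add: order_antisym not_less)
      qed
      hence "?S \<inter> ball ?K (real (Suc m)) \<in> null_sets (\<kappa> x)" for m
        using x ball by (auto simp: null_sets_def \<kappa>.emeasure_eq_measure \<kappa>(4) sets_restrict_space)
      hence "(\<Union>m. ?S \<inter> ball ?K (real (Suc m))) \<in> null_sets (\<kappa> x)" by (intro null_sets_UN) auto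
      moreover have "(\<Union>m. ?S \<inter> ball ?K (real (Suc m))) = space (\<kappa> x)"
      proof -
        have "\<exists>m. dist ?K y < real (Suc m)" for y
        proof -
          obtain m where "dist ?K y < real m" using reals_Archimedean2 by blast
          hence "dist ?K y < real (Suc m)" by simp
          thus ?thesis by blast
        qed
        thus ?thesis unfolding \<kappa>(5)[OF x] by auto
      qed
      ultimately show False using \<kappa>.emeasure_space_1 by (simp add: null_sets_def)
    qed
    have A_bdd: "bdd_below A" by (rule bdd_belowI[of _ 0]) (auto simp: A_def)
    define \<rho> where "\<rho> = Inf A"
    have \<rho>0: "0 \<le> \<rho>" unfolding \<rho>_def using A_ne by (intro cInf_greatest) (auto simp: A_def)
    have near: "\<exists>t>0. 0 < P t (indicator (ball ?K r)) x" if r: "\<rho> < r" for r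
    proof -
      obtain r' where r': "r' \<in> A" "r' < r" using cInf_lessD[OF A_ne] r unfolding \<rho>_def by blast
      then obtain t where t: "0 < t" "0 < P t (indicator (ball ?K r')) x" by (auto simp: A_def)
      moreover have "P t (indicator (ball ?K r')) x \<le> P t (indicator (ball ?K r)) x"
        using t r' x by (intro mono ball) auto
      ultimately show ?thesis by (intro exI[of _ t]) auto
    qed
    have "\<rho> = 0"
    proof (rule ccontr)
      assume "\<rho> \<noteq> 0"
      hence "0 < \<rho>" using \<rho>0 by simp
      from one_step[OF wiener b_nonneg b_0 trace b_pos N_large c1 this]
      obtain s s' \<tau> where s: "\<rho> < s" "0 < s'" "s' < \<rho>" "0 < \<tau>"
        and step: "\<And>y. y \<in> ?S \<Longrightarrow> dist y ?K < s \<Longrightarrow>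
          \<exists>p>0. \<forall>n X. solution M W (cov_sqrt b) lam n y X \<longrightarrow>
            p \<le> measure M {\<omega> \<in> space M. X \<tau> \<omega> \<in> ?S \<and> dist (X \<tau> \<omega>) ?K < s'}"
        by blast
      obtain t where t: "0 < t" "0 < P t (indicator (ball ?K s)) x" using near[OF s(1)] by blast
      \<comment> \<open>Its integral against the law at time \<open>t\<close> is positive: a zero
        integral would make \<open>\<psi>\<close> vanish almost everywhere, while it is positive at
        each point of a ball of positive mass. Pointwise positivity thus takes the place of a
        uniform lower bound.\<close>
      define \<psi> where "\<psi> = P \<tau> (indicator (ball ?K s'))"
      have \<psi>_pos: "0 < \<psi> y" if y: "y \<in> ?S" "y \<in> ball ?K s" for y
      proof -
        obtain p where p: "0 < p" "\<And>n X. solution M W (cov_sqrt b) lam n y X \<Longrightarrow>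
            p \<le> measure M {\<omega> \<in> space M. X \<tau> \<omega> \<in> ?S \<and> dist (X \<tau> \<omega>) ?K < s'}"
          using step[OF y(1)] y(2) by (auto simp: dist_commute)
        \<comment> \<open>The convergence is assumed for all bounded Borel functions, so it applies
          to the indicator of a ball and keeps the lower bound.\<close>
        have "p \<le> P_approx M (X (r k)) c \<tau> (indicator (ball ?K s')) y" for k
          unfolding P_approx_indicator using p(2)[OF X_sol[of "r k" y]] by (simp add: dist_commute)
        moreover have "(\<lambda>k. P_approx M (X (r k)) c \<tau> (indicator (ball ?K s')) y) \<longlonglongrightarrow> \<psi> y"
          unfolding \<psi>_def using s y by (intro limit indicator_bounded_borel ball) auto
        ultimately have "p \<le> \<psi> y" by (intro LIMSEQ_le_const) auto
        thus ?thesis using p by linarith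
      qed
      obtain \<kappa>' where \<kappa>': "\<kappa>' \<in> measurable (restrict_space borel ?S) (prob_algebra (restrict_space borel ?S))"
        "\<And>\<phi> x. \<phi> \<in> bounded_borel ?S \<Longrightarrow> x \<in> ?S \<Longrightarrow> P \<tau> \<phi> x = (\<integral>y. \<phi> y \<partial>\<kappa>' x)"
        "\<And>x. x \<in> ?S \<Longrightarrow> prob_space (\<kappa>' x)" "\<And>x. x \<in> ?S \<Longrightarrow> sets (\<kappa>' x) = sets (restrict_space borel ?S)"
        "\<And>x. x \<in> ?S \<Longrightarrow> space (\<kappa>' x) = ?S"
        "\<And>U x. U \<in> sets borel \<Longrightarrow> x \<in> ?S \<Longrightarrow> P \<tau> (indicator U) x = measure (\<kappa>' x) (?S \<inter> U)"
        by (rule semigroup_kernel[OF semigroup less_imp_le[OF s(4)]]) blast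
      have \<psi>_eq: "\<psi> y = measure (\<kappa>' y) (?S \<inter> ball ?K s')" if "y \<in> ?S" for y
        unfolding \<psi>_def by (rule \<kappa>'(6)[OF ball that])
      have \<psi>_range: "0 \<le> \<psi> y" "\<psi> y \<le> 1" if "y \<in> ?S" for y
        unfolding \<psi>_eq[OF that] using prob_space.prob_le_1[OF \<kappa>'(3)[OF that]] by auto
      have \<psi>_meas: "\<psi> \<in> borel_measurable (restrict_space borel ?S)"
      proof -
        have "?S \<inter> ball ?K s' \<in> sets (restrict_space borel ?S)" using ball by (auto simp: sets_restrict_space)
        hence "(\<lambda>y. measure (\<kappa>' y) (?S \<inter> ball ?K s')) \<in> borel_measurable (restrict_space borel ?S)"
          by (intro measurable_compose[OF \<kappa>'(1)] measurable_measure_prob_algebra)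
        thus ?thesis
          by (rule measurable_cong[THEN iffD1, rotated]) (simp add: \<psi>_eq space_restrict_space)
      qed
      \<comment> \<open>Allows inserting \<open>\<psi>\<close> into the kernel at time
        \<open>t\<close>, which links the semigroup property to an integral.\<close>
      have \<psi>_bb: "\<psi> \<in> bounded_borel ?S"
        unfolding bounded_borel_def using \<psi>_meas \<psi>_range by (auto intro!: boundedI[of _ 1])
      obtain \<kappa> where \<kappa>: "\<kappa> \<in> measurable (restrict_space borel ?S) (prob_algebra (restrict_space borel ?S))"
        "\<And>\<phi> x. \<phi> \<in> bounded_borel ?S \<Longrightarrow> x \<in> ?S \<Longrightarrow> P t \<phi> x = (\<integral>y. \<phi> y \<partial>\<kappa> x)"
        "\<And>x. x \<in> ?S \<Longrightarrow> prob_space (\<kappa> x)" "\<And>x. x \<in> ?S \<Longrightarrow> sets (\<kappa> x) = sets (restrict_space borel ?S)"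
        "\<And>x. x \<in> ?S \<Longrightarrow> space (\<kappa> x) = ?S"
        "\<And>U x. U \<in> sets borel \<Longrightarrow> x \<in> ?S \<Longrightarrow> P t (indicator U) x = measure (\<kappa> x) (?S \<inter> U)"
        by (rule semigroup_kernel[OF semigroup less_imp_le[OF t(1)]]) blast
      interpret \<kappa>: prob_space "\<kappa> x" by (rule \<kappa>(3)[OF x])
      have \<psi>m: "\<psi> \<in> borel_measurable (\<kappa> x)"
        using \<psi>_meas measurable_cong_sets[OF \<kappa>(4)[OF x] refl] by blast
      have \<psi>i: "integrable (\<kappa> x) \<psi>"
        by (rule \<kappa>.integrable_const_bound[of _ 1]) (use \<psi>_range \<psi>m \<kappa>(5)[OF x] in \<open>auto intro!: AE_I2\<close>)
      have \<psi>_AE: "AE y in \<kappa> x. 0 \<le> \<psi> y" using \<psi>_range \<kappa>(5)[OF x] by (auto intro!: AE_I2)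
      have "(\<integral>y. \<psi> y \<partial>\<kappa> x) \<noteq> 0"
      proof
        assume "(\<integral>y. \<psi> y \<partial>\<kappa> x) = 0"
        hence "AE y in \<kappa> x. \<psi> y = 0" using integral_nonneg_eq_0_iff_AE[OF \<psi>i \<psi>_AE] by simp
        hence "AE y in \<kappa> x. y \<notin> ?S \<inter> ball ?K s"
          by eventually_elim (use \<psi>_pos in force)
        hence "measure (\<kappa> x) (?S \<inter> ball ?K s) = 0"
          using x ball by (subst \<kappa>.prob_eq_0) (auto simp: \<kappa>(4) sets_restrict_space)
        thus False using t(2) \<kappa>(6)[OF ball x] by simp
      qed
      moreover have "0 \<le> (\<integral>y. \<psi> y \<partial>\<kappa> x)" by (rule integral_nonneg_AE[OF \<psi>_AE])
      moreover have "P (t + \<tau>) (indicator (ball ?K s')) x = (\<integral>y. \<psi> y \<partial>\<kappa> x)"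
      proof -
        have "P (t + \<tau>) (indicator (ball ?K s')) x = P t \<psi> x"
        proof -
          have "\<forall>s\<ge>0. \<forall>t\<ge>0. \<forall>\<phi>\<in>bounded_borel ?S. \<forall>x\<in>?S. P (s + t) \<phi> x = P s (P t \<phi>) x"
            using semigroup unfolding transition_semigroup_def by (elim conjE)
          from this[rule_format, OF less_imp_le[OF t(1)] less_imp_le[OF s(4)] indicator_bounded_borel[OF ball] x]
          show ?thesis unfolding \<psi>_def .
        qed
        thus ?thesis using \<kappa>(2)[OF \<psi>_bb x] by simp
      qed
      ultimately have "s' \<in> A" using s t by (auto simp: A_def intro!: exI[of _ "t + \<tau>"])
      hence "\<rho> \<le> s'" unfolding \<rho>_def using A_bdd by (rule cInf_lower)
      thus False using s by simp
    qed
    thus ?thesis using near e by simp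
  qed
  show ?thesis
    unfolding weakly_top_irreducible_def
  proof (intro ballI bexI[of _ ?K] allI impI)
    fix x1 x2 U assume x: "x1 \<in> ?S" "x2 \<in> ?S" and U: "openin (top_of_set ?S) U \<and> ?K \<in> U"
    then obtain T where T: "open T" "U = ?S \<inter> T" by (auto simp: openin_open)
    then obtain e where e: "0 < e" "ball ?K e \<subseteq> T" using U by (auto simp: open_contains_ball)
    have "U \<in> sets borel" using T closed_H_avg by auto
    moreover have "?S \<inter> ball ?K e \<subseteq> U" using T e by auto
    ultimately have le: "P t (indicator (ball ?K e)) x \<le> P t (indicator U) x" if "0 < t" "x \<in> ?S" for t x
      using that by (intro mono ball) auto
    show "\<exists>t\<^sub>1>0. \<exists>t\<^sub>2>0. P t\<^sub>1 (indicator U) x1 > 0 \<and> P t\<^sub>2 (indicator U) x2 > 0"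
      using reach[OF x(1) e(1)] reach[OF x(2) e(1)] le x by (meson less_le_trans)
  qed (rule const_H_in)
qed

end
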